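(* Let $\|\cdot\|_\phi$ be a symmetric norm, let $u,v\in\mathcal U_\phi$ and let $z\in\mathcal I_\phi$ be Hermitian with $\|z\|\le\pi$ and $v=ue^{iz}$. Then the curve $\delta(t)=ue^{itz}$, $t\in[0,1]$, is shorter than any other piecewise smooth curve $\gamma$ in $\mathcal U_\phi$ joining $u$ to $v$, i.e. $L_\phi(\delta)\le L_\phi(\gamma)$ for every such $\gamma$. In particular, $d_\phi(u,v)=\|z\|_\phi$.
   Context: $\mathcal H$ is a complex separable infinite dimensional Hilbert space, $\mathcal B(\mathcal H)$ its bounded operators, $\|\cdot\|$ the uniform (operator) norm, and Hermitian means self-adjoint. A symmetric norm is a norm $\|\cdot\|_\phi:\mathcal B(\mathcal H)\to\mathbb R\cup\{\infty\}$ with $\|xyz\|_\phi\le\|x\|\,\|y\|_\phi\,\|z\|$ for all $x,y,z\in\mathcal B(\mathcal H)$. Put $\mathcal I_\phi=\{x\in\mathcal B(\mathcal H):\|x\|_\phi<\infty\}$, a two-sided ideal. As in the classical theory (Gohberg–Krein, Simon), $\mathcal I_\phi$ is the maximal ideal of the norm: there is a symmetric gauge function $\phi$ on finitely supported sequences with $\|x\|_\phi=\sup_n\phi(s_1(x),\dots,s_n(x),0,0,\dots)$ for compact $x$ with singular values $s_j(x)$; in particular finite rank operators have finite norm. Standing assumption: $\|\cdot\|_\phi$ is inequivalent to the uniform norm, so $\mathcal I_\phi$ is a proper ideal consisting of compact operators. $\mathcal U_\phi=\{u\text{ unitary in }\mathcal H: u-1\in\mathcal I_\phi\}$, with the topology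 given by the metric $\|u-v\|_\phi$. Smooth curves are $C^1$ (with respect to $\|\cdot\|_\phi$) with non-vanishing derivative. For a piecewise smooth $\gamma:[0,1]\to\mathcal U_\phi$ (so $\dot\gamma\in\mathcal I_\phi$), $L_\phi(\gamma)=\int_0^1\|\dot\gamma(t)\|_\phi\,dt$, and $d_\phi(u,v)$ is the infimum of $L_\phi(\gamma)$ over piecewise smooth $\gamma:[0,1]\to\mathcal U_\phi$ joining $u$ to $v$. *)

theory Defs
  imports "HOL-Analysis.Analysis"
begin

section \<open>Complex Hilbert spaces\<close>

class scaleC =
  fixes scaleC :: "complex \<Rightarrow> 'a \<Rightarrow> 'a"  (infixr \<open>*\<^sub>C\<close> 75)

class complex_vector = real_vector + scaleC +
  assumes scaleC_add_right: "a *\<^sub>C (x + y) = a *\<^sub>C x + a *\<^sub>C y"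
    and scaleC_add_left: "(a + b) *\<^sub>C x = a *\<^sub>C x + b *\<^sub>C x"
    and scaleC_scaleC: "a *\<^sub>C b *\<^sub>C x = (a * b) *\<^sub>C x"
    and scaleC_one: "1 *\<^sub>C x = x"
    and scaleC_of_real: "complex_of_real r *\<^sub>C x = r *\<^sub>R x"

global_interpretation complex_vector: vector_space "scaleC :: complex \<Rightarrow> 'a \<Rightarrow> 'a::complex_vector"
  defines cdim = complex_vector.dim
  by unfold_locales (simp_all add: scaleC_add_right scaleC_add_left scaleC_scaleC scaleC_one)

text \<open>
  The inner product is linear in its first argument.  The normed space axioms inherited from
  \<^class>\<open>banach\<close> beyond completeness (e.g. the triangle inequality) are consequences of
  the inner product axioms, so nothing but a Hilbert space is described here.
\<close>

class complex_hilbert_space = banach + complex_vector +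
  fixes cinner :: "'a \<Rightarrow> 'a \<Rightarrow> complex"
  assumes cinner_add_left: "cinner (x + y) w = cinner x w + cinner y w"
    and cinner_scaleC_left: "cinner (c *\<^sub>C x) y = c * cinner x y"
    and cinner_commute: "cinner x y = cnj (cinner y x)"
    and cinner_norm: "cinner x x = complex_of_real ((norm x)\<^sup>2)"

class separable_hilbert_space = complex_hilbert_space +
  assumes separable: "\<exists>D. countable D \<and> (\<forall>x. \<forall>e>0. \<exists>d\<in>D. dist d x < e)"
    and infinite_dimensional: "finite B \<Longrightarrow> \<exists>x. \<forall>r. x \<noteq> (\<Sum>b\<in>B. r b *\<^sub>C b)"

lemma exists_nonzero: "\<exists>x :: 'a::separable_hilbert_space. x \<noteq> 0"
  using infinite_dimensional[of "{} :: 'a set"] by simp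


section \<open>The Banach algebra of bounded operators\<close>

typedef (overloaded) 'h operator =
  "{f :: 'h::complex_hilbert_space \<Rightarrow>\<^sub>L 'h. \<forall>c x. blinfun_apply f (c *\<^sub>C x) = c *\<^sub>C blinfun_apply f x}"
  morphisms blinfun_of Operator
  by (rule exI[of _ 0]) (simp add: complex_vector.scale_zero_right)

setup_lifting type_definition_operator

definition app :: "'h::complex_hilbert_space operator \<Rightarrow> 'h \<Rightarrow> 'h"  (infixr \<open>\<cdot>\<close> 76)
  where "x \<cdot> v = blinfun_apply (blinfun_of x) v"

lemma bounded_linear_scaleC: "bounded_linear (\<lambda>v :: 'h::complex_hilbert_space. c *\<^sub>C v)"
proof (rule bounded_linear_intro[where K = "cmod c"])
  fix x y :: 'h and r :: real
  show "c *\<^sub>C (x + y) = c *\<^sub>C x + c *\<^sub>C y" by (rule scaleC_add_right)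
  show "c *\<^sub>C (r *\<^sub>R x) = r *\<^sub>R (c *\<^sub>C x)"
    by (simp add: scaleC_of_real[symmetric] scaleC_scaleC mult.commute)
  have "complex_of_real ((norm (c *\<^sub>C x))\<^sup>2) = cinner (c *\<^sub>C x) (c *\<^sub>C x)"
    by (simp only: cinner_norm)
  also have "\<dots> = c * cnj (c * cinner x x)"
    by (metis cinner_commute cinner_scaleC_left)
  also have "\<dots> = (c * cnj c) * of_real ((norm x)\<^sup>2)"
    by (simp add: cinner_norm)
  also have "\<dots> = of_real ((cmod c * norm x)\<^sup>2)"
    by (simp add: complex_norm_square[symmetric] power_mult_distrib)
  finally have "(norm (c *\<^sub>C x))\<^sup>2 = (cmod c * norm x)\<^sup>2"
    by (simp only: of_real_eq_iff)
  then show "norm (c *\<^sub>C x) \<le> norm x * cmod c"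
    by (simp add: mult.commute)
qed

instantiation operator :: (complex_hilbert_space) real_normed_vector
begin

lift_definition zero_operator :: "'a operator" is 0
  by (simp add: complex_vector.scale_zero_right)
lift_definition plus_operator :: "'a operator \<Rightarrow> 'a operator \<Rightarrow> 'a operator" is "(+)"
  by (simp add: blinfun.add_left scaleC_add_right)
lift_definition minus_operator :: "'a operator \<Rightarrow> 'a operator \<Rightarrow> 'a operator" is "(-)"
  by (simp add: blinfun.diff_left complex_vector.scale_right_diff_distrib)
lift_definition uminus_operator :: "'a operator \<Rightarrow> 'a operator" is uminus
  by (simp add: blinfun.minus_left complex_vector.scale_minus_right)
lift_definition scaleR_operator :: "real \<Rightarrow> 'a operator \<Rightarrow> 'a operator" is scaleR
  by (simp add: blinfun.scaleR_left scaleC_of_real[symmetric] scaleC_scaleC mult.commute)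
lift_definition norm_operator :: "'a operator \<Rightarrow> real" is norm .
definition dist_operator :: "'a operator \<Rightarrow> 'a operator \<Rightarrow> real"
  where "dist_operator x y = norm (x - y)"
definition sgn_operator :: "'a operator \<Rightarrow> 'a operator"
  where "sgn_operator x = scaleR (inverse (norm x)) x"
definition uniformity_operator :: "('a operator \<times> 'a operator) filter"
  where "uniformity_operator = (INF e\<in>{0<..}. principal {(x, y). dist x y < e})"
definition open_operator :: "'a operator set \<Rightarrow> bool"
  where "open_operator U = (\<forall>x\<in>U. eventually (\<lambda>(x', y). x' = x \<longrightarrow> y \<in> U) uniformity)"

instance
proof
  fix x y w :: "'a operator" and a b :: real
  show "dist x y = norm (x - y)" by (rule dist_operator_def)
  show "sgn x = inverse (norm x) *\<^sub>R x" by (rule sgn_operator_def)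
  show "(uniformity :: ('a operator \<times> 'a operator) filter) = (INF e\<in>{0<..}. principal {(x, y). dist x y < e})"
    by (rule uniformity_operator_def)
  show "open U = (\<forall>x\<in>U. eventually (\<lambda>(x', y). x' = x \<longrightarrow> y \<in> U) uniformity)"
    for U :: "'a operator set" by (rule open_operator_def)
  show "x + y + w = x + (y + w)" by transfer simp
  show "x + y = y + x" by transfer simp
  show "0 + x = x" by transfer simp
  show "- x + x = 0" by transfer simp
  show "x - y = x + - y" by transfer simp
  show "a *\<^sub>R (x + y) = a *\<^sub>R x + a *\<^sub>R y" by transfer (simp add: scaleR_add_right)
  show "(a + b) *\<^sub>R x = a *\<^sub>R x + b *\<^sub>R x" by transfer (simp add: scaleR_add_left)
  show "a *\<^sub>R b *\<^sub>R x = (a * b) *\<^sub>R x" by transfer simp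
  show "1 *\<^sub>R x = x" by transfer simp
  show "(norm x = 0) = (x = 0)" by transfer simp
  show "norm (x + y) \<le> norm x + norm y" by transfer (rule norm_triangle_ineq)
  show "norm (a *\<^sub>R x) = \<bar>a\<bar> * norm x" by transfer simp
qed

end

instantiation operator :: (complex_hilbert_space) complex_vector
begin

lift_definition scaleC_operator :: "complex \<Rightarrow> 'a operator \<Rightarrow> 'a operator"
  is "\<lambda>c f. Blinfun (\<lambda>v. c *\<^sub>C v) o\<^sub>L f"
  by (simp add: bounded_linear_Blinfun_apply bounded_linear_scaleC scaleC_scaleC mult.commute)

instance
proof
  fix x y :: "'a operator" and a b :: complex and r :: real
  note s = bounded_linear_Blinfun_apply bounded_linear_scaleC
  show "a *\<^sub>C (x + y) = a *\<^sub>C x + a *\<^sub>C y"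
    by transfer (rule blinfun_eqI, simp add: s blinfun.add_left scaleC_add_right)
  show "(a + b) *\<^sub>C x = a *\<^sub>C x + b *\<^sub>C x"
    by transfer (rule blinfun_eqI, simp add: s blinfun.add_left scaleC_add_left)
  show "a *\<^sub>C b *\<^sub>C x = (a * b) *\<^sub>C x"
    by transfer (rule blinfun_eqI, simp add: s scaleC_scaleC)
  show "1 *\<^sub>C x = x"
    by transfer (rule blinfun_eqI, simp add: s scaleC_one)
  show "complex_of_real r *\<^sub>C x = r *\<^sub>R x"
    by transfer (rule blinfun_eqI, simp add: s scaleC_of_real blinfun.scaleR_left)
qed

end

instance operator :: (complex_hilbert_space) banach
proof
  fix X :: "nat \<Rightarrow> 'a operator"
  assume X: "Cauchy X"
  have dist_eq: "dist x y = dist (blinfun_of x) (blinfun_of y)" for x y :: "'a operator"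
    by (simp add: dist_norm norm_operator.rep_eq minus_operator.rep_eq)
  have "Cauchy (\<lambda>n. blinfun_of (X n))"
    using X by (simp add: Cauchy_def dist_eq)
  then obtain L where L: "(\<lambda>n. blinfun_of (X n)) \<longlonglongrightarrow> L"
    using Cauchy_convergent convergent_def by blast
  have "blinfun_apply L (c *\<^sub>C v) = c *\<^sub>C blinfun_apply L v" for c v
  proof (rule LIMSEQ_unique)
    show "(\<lambda>n. blinfun_of (X n) (c *\<^sub>C v)) \<longlonglongrightarrow> L (c *\<^sub>C v)"
      by (intro tendsto_intros L)
    have "(\<lambda>n. c *\<^sub>C blinfun_of (X n) v) \<longlonglongrightarrow> c *\<^sub>C L v"
      by (intro bounded_linear.tendsto[OF bounded_linear_scaleC] tendsto_intros L)
    moreover have "blinfun_of (X n) (c *\<^sub>C v) = c *\<^sub>C blinfun_of (X n) v" for n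
      using blinfun_of[of "X n"] by simp
    ultimately show "(\<lambda>n. blinfun_of (X n) (c *\<^sub>C v)) \<longlonglongrightarrow> c *\<^sub>C L v" by simp
  qed
  then have "blinfun_of (Operator L) = L" by (simp add: Operator_inverse)
  then have "X \<longlonglongrightarrow> Operator L"
    using L by (simp add: tendsto_iff dist_eq)
  then show "convergent X" by (rule convergentI)
qed

instantiation operator :: (separable_hilbert_space) real_normed_algebra_1
begin

lift_definition one_operator :: "'a operator" is id_blinfun
  by simp
lift_definition times_operator :: "'a operator \<Rightarrow> 'a operator \<Rightarrow> 'a operator" is "(o\<^sub>L)"
  by simp

instance
proof
  fix x y w :: "'a operator" and a :: real
  show "x * y * w = x * (y * w)" by transfer (rule blinfun_eqI, simp)
  show "1 * x = x" by transfer (rule blinfun_eqI, simp)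
  show "x * 1 = x" by transfer (rule blinfun_eqI, simp)
  show "(x + y) * w = x * w + y * w" by transfer (rule blinfun_eqI, simp add: blinfun.add_left)
  show "x * (y + w) = x * y + x * w"
    by transfer (rule blinfun_eqI, simp add: blinfun.add_left blinfun.add_right)
  show "a *\<^sub>R x * y = a *\<^sub>R (x * y)" by transfer (rule blinfun_eqI, simp add: blinfun.scaleR_left)
  show "x * a *\<^sub>R y = a *\<^sub>R (x * y)"
    by transfer (rule blinfun_eqI, simp add: blinfun.scaleR_left blinfun.scaleR_right)
  show "norm (x * y) \<le> norm x * norm y" by transfer (rule norm_blinfun_compose)
  obtain v :: 'a where v: "v \<noteq> 0" using exists_nonzero by blast
  show "(0 :: 'a operator) \<noteq> 1"
  proof
    assume "(0 :: 'a operator) = 1"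
    then have "(0 :: 'a \<Rightarrow>\<^sub>L 'a) = id_blinfun" by transfer
    then have "blinfun_apply 0 v = blinfun_apply id_blinfun v" by simp
    then show False using v by simp
  qed
  show "norm (1 :: 'a operator) = 1"
  proof (transfer, rule antisym)
    show "norm (id_blinfun :: 'a \<Rightarrow>\<^sub>L 'a) \<le> 1" by (rule norm_blinfun_id_le)
    have "norm v \<le> norm (id_blinfun :: 'a \<Rightarrow>\<^sub>L 'a) * norm v"
      using norm_blinfun[of id_blinfun v] by simp
    then show "1 \<le> norm (id_blinfun :: 'a \<Rightarrow>\<^sub>L 'a)" using v by simp
  qed
qed

end

definition adj :: "'h::complex_hilbert_space operator \<Rightarrow> 'h operator"
  where "adj x = (THE y. \<forall>v w. cinner (x \<cdot> v) w = cinner v (y \<cdot> w))"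

definition hermitian :: "'h::complex_hilbert_space operator \<Rightarrow> bool"
  where "hermitian x \<longleftrightarrow> adj x = x"

definition unitary :: "'h::separable_hilbert_space operator \<Rightarrow> bool"
  where "unitary u \<longleftrightarrow> adj u * u = 1 \<and> u * adj u = 1"

definition compact_operator :: "'h::complex_hilbert_space operator \<Rightarrow> bool"
  where "compact_operator x \<longleftrightarrow> compact (closure ((\<cdot>) x ` cball 0 1))"

text \<open>
  The singular values of a compact \<open>x\<close> are the square roots of the eigenvalues of \<open>x\<^sup>* x\<close>, in
  decreasing order, repeated according to multiplicity, and followed by zeros if there are only
  finitely many positive ones.  Indices start at \<open>0\<close>.
\<close>

definition singular_values :: "'h::separable_hilbert_space operator \<Rightarrow> nat \<Rightarrow> real"
  where "singular_values x = (THE s. decseq s \<and> (\<forall>j. 0 \<le> s j) \<and>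
    (\<forall>r>0. finite {j. s j = r} \<and>
       card {j. s j = r} = cdim {v. (adj x * x) \<cdot> v = complex_of_real (r\<^sup>2) *\<^sub>C v}))"


section \<open>Symmetric norms\<close>

locale symmetric_gauge =
  fixes \<phi> :: "(nat \<Rightarrow> real) \<Rightarrow> real"
  assumes pos: "finite {j. a j \<noteq> 0} \<Longrightarrow> a \<noteq> (\<lambda>j. 0) \<Longrightarrow> 0 < \<phi> a"
    and scale: "finite {j. a j \<noteq> 0} \<Longrightarrow> \<phi> (\<lambda>j. c * a j) = \<bar>c\<bar> * \<phi> a"
    and triangle: "finite {j. a j \<noteq> 0} \<Longrightarrow> finite {j. b j \<noteq> 0} \<Longrightarrow>
      \<phi> (\<lambda>j. a j + b j) \<le> \<phi> a + \<phi> b"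
    and permute: "finite {j. a j \<noteq> 0} \<Longrightarrow> bij \<pi> \<Longrightarrow> \<phi> (\<lambda>j. a (\<pi> j)) = \<phi> a"
    and abs: "finite {j. a j \<noteq> 0} \<Longrightarrow> \<phi> (\<lambda>j. \<bar>a j\<bar>) = \<phi> a"

text \<open>
  In \<^typ>\<open>ennreal\<close> we have \<open>0 * \<infinity> = 0\<close>, as needed for \<open>c = 0\<close> in the homogeneity
  axiom.  No normalisation of \<open>\<phi>\<close> is imposed.
\<close>

locale symmetric_norm = symmetric_gauge \<phi> for \<phi> +
  fixes N :: "'h::separable_hilbert_space operator \<Rightarrow> ennreal"
  assumes norm_eq_0: "N x = 0 \<longleftrightarrow> x = 0"
    and norm_scale: "N (c *\<^sub>C x) = ennreal (cmod c) * N x"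
    and norm_triangle: "N (x + y) \<le> N x + N y"
    and norm_mult_mult: "N (x * y * w) \<le> ennreal (norm x) * N y * ennreal (norm w)"
    and norm_compact: "compact_operator x \<Longrightarrow>
      N x = (SUP n. ennreal (\<phi> (\<lambda>j. if j < n then singular_values x j else 0)))"

definition equivalent_to_uniform_norm :: "('h::separable_hilbert_space operator \<Rightarrow> ennreal) \<Rightarrow> bool"
  where "equivalent_to_uniform_norm N \<longleftrightarrow>
    (\<exists>c C :: real. 0 < c \<and> 0 < C \<and> (\<forall>x. ennreal (c * norm x) \<le> N x \<and> N x \<le> ennreal (C * norm x)))"

definition norm_ideal :: "('h::separable_hilbert_space operator \<Rightarrow> ennreal) \<Rightarrow> 'h operator set"
  where "norm_ideal N = {x. N x < \<infinity>}"

definition unitary_group :: "('h::separable_hilbert_space operator \<Rightarrow> ennreal) \<Rightarrow> 'h operator set"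
  where "unitary_group N = {u. unitary u \<and> u - 1 \<in> norm_ideal N}"


section \<open>Curves, length and distance\<close>

text \<open>Derivatives are taken with respect to \<open>N\<close>, not with respect to the uniform norm.\<close>

definition has_norm_derivative ::
  "('h::separable_hilbert_space operator \<Rightarrow> ennreal) \<Rightarrow> (real \<Rightarrow> 'h operator) \<Rightarrow> 'h operator \<Rightarrow>
    real \<Rightarrow> real set \<Rightarrow> bool"
  where "has_norm_derivative N \<gamma> D t S \<longleftrightarrow>
    ((\<lambda>s. N ((\<gamma> s - \<gamma> t) /\<^sub>R (s - t) - D)) \<longlongrightarrow> 0) (at t within S)"

definition smooth_on_interval ::
  "('h::separable_hilbert_space operator \<Rightarrow> ennreal) \<Rightarrow> (real \<Rightarrow> 'h operator) \<Rightarrow> real \<Rightarrow> real \<Rightarrow> bool"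
  where "smooth_on_interval N \<gamma> a b \<longleftrightarrow>
    (\<exists>D. \<forall>t\<in>{a..b}. has_norm_derivative N \<gamma> (D t) t {a..b} \<and> D t \<noteq> 0 \<and>
      ((\<lambda>s. N (D s - D t)) \<longlongrightarrow> 0) (at t within {a..b}))"

text \<open>
  The pieces are closed intervals with one-sided derivatives at their ends, so a curve satisfying
  this definition is automatically continuous for \<open>N\<close>.
\<close>

definition piecewise_smooth ::
  "('h::separable_hilbert_space operator \<Rightarrow> ennreal) \<Rightarrow> (real \<Rightarrow> 'h operator) \<Rightarrow> bool"
  where "piecewise_smooth N \<gamma> \<longleftrightarrow>
    (\<exists>(n :: nat) \<tau>. \<tau> 0 = 0 \<and> \<tau> n = 1 \<and>
      (\<forall>i<n. \<tau> i < \<tau> (Suc i) \<and> smooth_on_interval N \<gamma> (\<tau> i) (\<tau> (Suc i))))"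

definition joining_curves ::
  "('h::separable_hilbert_space operator \<Rightarrow> ennreal) \<Rightarrow> 'h operator \<Rightarrow> 'h operator \<Rightarrow>
    (real \<Rightarrow> 'h operator) set"
  where "joining_curves N u v =
    {\<gamma>. piecewise_smooth N \<gamma> \<and> \<gamma> ` {0..1} \<subseteq> unitary_group N \<and> \<gamma> 0 = u \<and> \<gamma> 1 = v}"

text \<open>
  At the finitely many breakpoints of a piecewise smooth curve the derivative below may be
  unspecified; this does not affect the integral.
\<close>

definition norm_derivative ::
  "('h::separable_hilbert_space operator \<Rightarrow> ennreal) \<Rightarrow> (real \<Rightarrow> 'h operator) \<Rightarrow> real \<Rightarrow> 'h operator"
  where "norm_derivative N \<gamma> t = (THE D. has_norm_derivative N \<gamma> D t {0..1})"

definition curve_length ::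
  "('h::separable_hilbert_space operator \<Rightarrow> ennreal) \<Rightarrow> (real \<Rightarrow> 'h operator) \<Rightarrow> ennreal"
  where "curve_length N \<gamma> = (\<integral>\<^sup>+t\<in>{0..1}. N (norm_derivative N \<gamma> t) \<partial>lborel)"

definition curve_dist ::
  "('h::separable_hilbert_space operator \<Rightarrow> ennreal) \<Rightarrow> 'h operator \<Rightarrow> 'h operator \<Rightarrow> ennreal"
  where "curve_dist N u v = (INF \<gamma>\<in>joining_curves N u v. curve_length N \<gamma>)"

end

theory Submission
  imports Defs
begin

text \<open>
  After translating by \<open>u\<^sup>*\<close> let \<open>\<gamma>\<close> run from \<open>1\<close> to \<open>e\<^bsup>iz\<^esup>\<close>.  The singular values of \<open>\<gamma>(t) - 1\<close> are
  \<open>2 sin(\<theta>\<^sub>j/2)\<close> for the eigenvalues \<open>e\<^bsup>i\<theta>\<^sub>j\<^esup>\<close> of \<open>\<gamma>(t)\<close>, \<open>\<bar>\<theta>\<^sub>j\<bar> \<le> \<pi>\<close>, so \<open>F(t) = \<Sum>\<^sub>j c\<^sub>j \<bar>\<theta>\<^sub>j\<bar>\<close> with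
  decreasing weights \<open>c\<^sub>j \<ge> 0\<close> is a Ky Fan functional of \<open>\<gamma>(t) - 1\<close>.  If the weights support the
  gauge \<open>\<phi>\<close>, first order perturbation theory and a pinching argument bound the derivative of \<open>F\<close> by
  \<open>N (\<gamma>'(t))\<close>; to avoid the kinks of \<open>\<bar>\<theta>\<bar>\<close> at \<open>0\<close> and \<open>\<pi>\<close> one works with smooth approximations.
  Hence \<open>\<Sum>\<^sub>j c\<^sub>j s\<^sub>j(z)\<close> is at most the length of \<open>\<gamma>\<close>, and by the Hahn-Banach theorem the
  supremum over the weights is \<open>N z\<close>.  An element of finite norm is compact because otherwise
  it would divide the identity, and \<open>N\<close> would be equivalent to the uniform norm.
\<close>

section \<open>Inner products and operators\<close>

text \<open>The obstacle is that eigenvalues cross along \<gamma> and singular vectors need not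
  depend continuously on t. Hence F is never differentiated: an increment of F ending at t is
  bounded through the singular vectors at t alone, by a term linear in \<gamma>(t) - \<gamma>(t')
  plus a quadratic error, and a mean value inequality for left Dini derivatives turns this into an
  integral. Two facts make this possible. For unitary g the square
  \<open>adj (g - 1) * (g - 1)\<close> is affine in g; and \<open>arc\<close> lies above tangent
  parabolas of a fixed curvature, which is true for r < 1 but fails for r = 1. The passage r -> 1
  comes last and concerns only the values at the end points. Working with singular values of g - 1
  rather than with the spectrum of g means that only positive compact operators are diagonalised,
  which is done by maximising a norm. The bound on the uniform norm of z enters where the end point
  is evaluated: the angles of the end point agree with the singular values of z only up to
  \<pi>.\<close>

lemma cinner_add_right: "cinner x (y + w) = cinner x y + cinner x w"
  by (metis cinner_add_left cinner_commute complex_cnj_add)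

lemma cinner_scaleC_right: "cinner x (c *\<^sub>C y) = cnj c * cinner x y"
  by (metis cinner_scaleC_left cinner_commute complex_cnj_mult)

lemma norm_scaleC: "norm (c *\<^sub>C x :: 'a::complex_hilbert_space) = cmod c * norm x"
proof -
  have "complex_of_real ((norm (c *\<^sub>C x))\<^sup>2) = c * cnj c * of_real ((norm x)\<^sup>2)"
    by (simp only: cinner_norm[symmetric] cinner_scaleC_left cinner_scaleC_right mult_ac)
  also have "\<dots> = of_real ((cmod c * norm x)\<^sup>2)"
    by (simp add: complex_norm_square[symmetric] power_mult_distrib)
  finally have "(norm (c *\<^sub>C x))\<^sup>2 = (cmod c * norm x)\<^sup>2"
    by (simp only: of_real_eq_iff)
  then show ?thesis by simp
qed

lemma cinner_Cauchy_Schwarz: "cmod (cinner x y) \<le> norm x * norm y"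
proof (cases "y = 0")
  case True
  then show ?thesis
    using cinner_scaleC_right[of x 0 y] by simp
next
  case False
  define n where "n = (norm y)\<^sup>2"
  have n: "n > 0" using False by (simp add: n_def)
  define c where "c = cinner x y / of_real n"
  have yy: "cinner y y = of_real n" by (simp add: cinner_norm n_def)
  have "cinner (x + (- c) *\<^sub>C y) (x + (- c) *\<^sub>C y)
    = cinner x x - cnj c * cinner x y - c * cnj (cinner x y) + c * cnj c * of_real n"
    unfolding cinner_add_left cinner_add_right cinner_scaleC_left cinner_scaleC_right yy
      cinner_commute[of y x] by (simp add: algebra_simps)
  also have "\<dots> = cinner x x - cinner x y * cnj (cinner x y) / of_real n"
    using n by (simp add: c_def field_simps)
  also have "\<dots> = of_real ((norm x)\<^sup>2 - (cmod (cinner x y))\<^sup>2 / n)"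
    by (simp add: cinner_norm complex_norm_square[symmetric])
  finally have "(norm (x + (- c) *\<^sub>C y))\<^sup>2 = (norm x)\<^sup>2 - (cmod (cinner x y))\<^sup>2 / n"
    by (simp only: cinner_norm of_real_eq_iff)
  then have "(cmod (cinner x y))\<^sup>2 / n \<le> (norm x)\<^sup>2"
    by (metis diff_ge_0_iff_ge zero_le_power2)
  then have "(cmod (cinner x y))\<^sup>2 \<le> (norm x * norm y)\<^sup>2"
    using n by (simp add: pos_divide_le_eq power_mult_distrib n_def)
  then show ?thesis by (rule power2_le_imp_le) simp
qed

lemma cinner_scaleR_left: "cinner (r *\<^sub>R x) y = r *\<^sub>R cinner x y"
  by (simp add: scaleC_of_real[symmetric] cinner_scaleC_left scaleR_conv_of_real)

lemma cinner_scaleR_right: "cinner x (r *\<^sub>R y) = r *\<^sub>R cinner x y"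
  by (simp add: scaleC_of_real[symmetric] cinner_scaleC_right scaleR_conv_of_real)

interpretation cinner: bounded_bilinear "cinner :: 'a::complex_hilbert_space \<Rightarrow> 'a \<Rightarrow> complex"
proof
  show "\<exists>K. \<forall>a b::'a. norm (cinner a b) \<le> norm a * norm b * K"
    using cinner_Cauchy_Schwarz by (intro exI[of _ 1]) auto
qed (simp_all add: cinner_add_left cinner_add_right cinner_scaleR_left cinner_scaleR_right)

interpretation scaleC: bounded_bilinear "scaleC :: complex \<Rightarrow> 'a::complex_hilbert_space \<Rightarrow> 'a"
proof
  fix a b :: complex and x y :: 'a and r :: real
  show "\<exists>K. \<forall>a (b::'a). norm (a *\<^sub>C b) \<le> norm a * norm b * K"
    by (intro exI[of _ 1]) (simp add: norm_scaleC)
  show "(r *\<^sub>R a) *\<^sub>C x = r *\<^sub>R a *\<^sub>C x"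
    by (simp add: scaleC_of_real[symmetric] scaleC_scaleC scaleR_conv_of_real)
  show "a *\<^sub>C r *\<^sub>R x = r *\<^sub>R a *\<^sub>C x"
    by (simp add: scaleC_of_real[symmetric] scaleC_scaleC mult.commute)
qed (simp_all add: scaleC_add_left scaleC_add_right)

lemma cinner_self_eq_0_iff: "cinner x x = 0 \<longleftrightarrow> x = (0::'a::complex_hilbert_space)"
  by (simp add: cinner_norm)

lemma cinner_eqI:
  assumes "\<And>w. cinner x w = cinner y w" shows "x = (y::'a::complex_hilbert_space)"
  using assms[of "x - y"] cinner_self_eq_0_iff[of "x - y"] by (simp add: cinner.diff_left)

lemma norm_add_sq:
  fixes x y :: "'a::complex_hilbert_space"
  shows "(norm (x + y))\<^sup>2 = (norm x)\<^sup>2 + 2 * Re (cinner x y) + (norm y)\<^sup>2"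
proof -
  have "complex_of_real ((norm (x + y))\<^sup>2) = cinner x x + (cinner x y + cnj (cinner x y)) + cinner y y"
    by (simp only: cinner_norm[symmetric] cinner_add_left cinner_add_right
        cinner_commute[of y x] add_ac)
  also have "\<dots> = of_real ((norm x)\<^sup>2 + 2 * Re (cinner x y) + (norm y)\<^sup>2)"
    by (simp add: cinner_norm complex_add_cnj)
  finally show ?thesis by (simp only: of_real_eq_iff)
qed

lemma norm_diff_sq:
  fixes x y :: "'a::complex_hilbert_space"
  shows "(norm (x - y))\<^sup>2 = (norm x)\<^sup>2 - 2 * Re (cinner x y) + (norm y)\<^sup>2"
  using norm_add_sq[of x "- y"] by (simp add: cinner.minus_right)

lemma app_times [simp]: "(x * y) \<cdot> v = x \<cdot> y \<cdot> v"
  by (simp add: app_def times_operator.rep_eq)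

lemma app_one [simp]: "1 \<cdot> v = v"
  by (simp add: app_def one_operator.rep_eq)

lemma app_scaleC_left [simp]: "(c *\<^sub>C x) \<cdot> v = c *\<^sub>C (x \<cdot> v)"
  by (simp add: app_def scaleC_operator.rep_eq bounded_linear_Blinfun_apply bounded_linear_scaleC)

lemma app_scaleC_right [simp]: "x \<cdot> (c *\<^sub>C v) = c *\<^sub>C (x \<cdot> v)"
  using blinfun_of[of x] by (simp add: app_def)

lemma norm_app: "norm (x \<cdot> v) \<le> norm x * norm v"
  by (simp add: app_def norm_operator.rep_eq norm_blinfun)

interpretation app: bounded_bilinear "app :: 'a::complex_hilbert_space operator \<Rightarrow> 'a \<Rightarrow> 'a"
proof
  show "\<exists>K. \<forall>x (v::'a). norm (x \<cdot> v) \<le> norm x * norm v * K"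
    by (intro exI[of _ 1]) (simp add: norm_app)
qed (simp_all add: app_def plus_operator.rep_eq scaleR_operator.rep_eq
      blinfun.add_left blinfun.add_right blinfun.scaleR_left blinfun.scaleR_right)

lemma operator_eqI:
  assumes "\<And>v. x \<cdot> v = y \<cdot> v" shows "x = y"
  using assms by (metis app_def blinfun_eqI blinfun_of_inject)

lemma norm_operator_le:
  assumes "0 \<le> b" and "\<And>v. norm (x \<cdot> v) \<le> b * norm v" shows "norm x \<le> b"
  using assms by (simp add: app_def norm_operator.rep_eq norm_blinfun_bound)

lemma ex_operator:
  fixes f :: "'a::complex_hilbert_space \<Rightarrow> 'a"
  assumes add: "\<And>v w. f (v + w) = f v + f w" and scale: "\<And>c v. f (c *\<^sub>C v) = c *\<^sub>C f v"
    and bound: "\<And>v. norm (f v) \<le> b * norm v" and b: "0 \<le> b"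
  obtains x where "\<And>v. x \<cdot> v = f v" and "norm x \<le> b"
proof -
  have "bounded_linear f"
    using add scale bound
    by (intro bounded_linear_intro[where K = b])
      (simp_all add: mult.commute flip: scaleC_of_real)
  then have "x \<cdot> v = f v" if "x = Operator (Blinfun f)" for x v
    unfolding that app_def
    by (subst Operator_inverse) (simp_all add: bounded_linear_Blinfun_apply scale)
  then show thesis using that norm_operator_le[OF b] bound by metis
qed

section \<open>Orthonormal families and adjoints\<close>

definition orthonormal :: "'i set \<Rightarrow> ('i \<Rightarrow> 'h::complex_hilbert_space) \<Rightarrow> bool"
  where "orthonormal I e \<longleftrightarrow> (\<forall>i\<in>I. \<forall>j\<in>I. cinner (e i) (e j) = (if i = j then 1 else 0))"

text \<open>Zero vectors are allowed. The vectors paired with the singular vectors in the first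
  variation are scaled images under \<open>(1 / 2) *\<^sub>R (g - adj g)\<close>; they may vanish,
  so they cannot be normalised.\<close>

definition orthogonal_contractive :: "'i set \<Rightarrow> ('i \<Rightarrow> 'h::complex_hilbert_space) \<Rightarrow> bool"
  where "orthogonal_contractive I y \<longleftrightarrow>
    (\<forall>i\<in>I. \<forall>j\<in>I. i \<noteq> j \<longrightarrow> cinner (y i) (y j) = 0) \<and> (\<forall>i\<in>I. norm (y i) \<le> 1)"

lemma orthonormalD: "orthonormal I e \<Longrightarrow> i \<in> I \<Longrightarrow> j \<in> I \<Longrightarrow> cinner (e i) (e j) = (if i = j then 1 else 0)"
  by (simp add: orthonormal_def)

lemma orthonormal_subset: "orthonormal I e \<Longrightarrow> J \<subseteq> I \<Longrightarrow> orthonormal J e"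
  unfolding orthonormal_def by blast

lemma orthonormal_norm: "orthonormal I e \<Longrightarrow> i \<in> I \<Longrightarrow> norm (e i) = 1"
  using orthonormalD[of I e i i] cinner_norm[of "e i"] norm_ge_zero[of "e i"]
  by (simp add: power2_eq_1_iff flip: of_real_power)

lemma orthonormal_contractive: "orthonormal I e \<Longrightarrow> orthogonal_contractive I e"
  by (auto simp: orthogonal_contractive_def orthonormal_norm orthonormalD)

lemma norm_orthogonal_sum:
  fixes y :: "'i \<Rightarrow> 'h::complex_hilbert_space"
  assumes "finite I" and "\<And>i j. i \<in> I \<Longrightarrow> j \<in> I \<Longrightarrow> i \<noteq> j \<Longrightarrow> cinner (y i) (y j) = 0"
  shows "(norm (\<Sum>i\<in>I. y i))\<^sup>2 = (\<Sum>i\<in>I. (norm (y i))\<^sup>2)"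
  using assms
proof (induction I rule: finite_induct)
  case (insert k F)
  have "cinner (y k) (\<Sum>i\<in>F. y i) = 0"
    unfolding cinner.sum_right using insert by (intro sum.neutral) auto
  with insert show ?case by (simp add: norm_add_sq)
qed simp

text \<open>Pairing \<open>v\<close> with \<open>w\<close> gives the sum \<open>S\<close>, and since
  all lengths are at most 1 the squared norm of \<open>w\<close> is at most \<open>S\<close>.
  Cauchy-Schwarz then bounds S^2 by S times the squared norm of \<open>v\<close>.\<close>

lemma Bessel:
  fixes y :: "'i \<Rightarrow> 'h::complex_hilbert_space"
  assumes "finite I" and y: "orthogonal_contractive I y"
  shows "(\<Sum>i\<in>I. (cmod (cinner v (y i)))\<^sup>2) \<le> (norm v)\<^sup>2"
proof -
  define S where "S = (\<Sum>i\<in>I. (cmod (cinner v (y i)))\<^sup>2)"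
  define w where "w = (\<Sum>i\<in>I. cinner v (y i) *\<^sub>C y i)"
  have "cinner v w = (\<Sum>i\<in>I. cnj (cinner v (y i)) * cinner v (y i))"
    by (simp add: w_def cinner.sum_right cinner_scaleC_right)
  also have "\<dots> = of_real S"
    by (simp only: S_def of_real_sum complex_norm_square mult.commute)
  finally have "S \<le> norm v * norm w"
    using cinner_Cauchy_Schwarz[of v w] by (metis Re_complex_of_real complex_Re_le_cmod order_trans)
  moreover have "(norm w)\<^sup>2 = (\<Sum>i\<in>I. (cmod (cinner v (y i)) * norm (y i))\<^sup>2)"
    unfolding w_def using assms
    by (subst norm_orthogonal_sum)
      (auto simp: orthogonal_contractive_def cinner_scaleC_left cinner_scaleC_right norm_scaleC)
  then have "(norm w)\<^sup>2 \<le> S"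
    unfolding S_def using y
    by (auto simp: orthogonal_contractive_def power_mult_distrib intro!: sum_mono mult_left_le power_le_one)
  moreover have S0: "0 \<le> S" by (simp add: S_def sum_nonneg)
  ultimately have "S * S \<le> (norm v)\<^sup>2 * S"
    by (smt (verit, best) mult_left_mono mult_mono norm_ge_zero power2_eq_square power_mult_distrib
        zero_le_power2 mult_nonneg_nonneg)
  then show ?thesis
    using S0 unfolding S_def[symmetric] by (metis mult_right_le_imp_le zero_le_power2 order_le_less)
qed

lemma residual_orthogonal:
  assumes "finite I" "orthonormal I e" "i \<in> I"
  shows "cinner (v - (\<Sum>j\<in>I. cinner v (e j) *\<^sub>C e j)) (e i) = 0"
proof -
  have "(\<Sum>j\<in>I. cinner v (e j) * cinner (e j) (e i)) = (\<Sum>j\<in>I. if j = i then cinner v (e i) else 0)"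
    using assms by (intro sum.cong) (auto simp: orthonormalD)
  then show ?thesis
    using assms by (simp add: cinner.diff_left cinner.sum_left cinner_scaleC_left)
qed

text \<open>A Gram-Schmidt step that never fails: \<open>x\<close> is the normalised residual of
  \<open>d\<close> or, if \<open>d\<close> already lies in the span of the \<open>e i\<close>, of a
  vector outside that span, which infinite dimension supplies. The last conclusion expresses that
  \<open>d\<close> lies in the span of \<open>x\<close> and the \<open>e i\<close> without
  mentioning spans.\<close>

lemma ex_unit_orthogonal:
  fixes d :: "'h::separable_hilbert_space"
  assumes I: "finite I" and e: "orthonormal I e"
  obtains x where "norm x = 1" and "\<And>i. i \<in> I \<Longrightarrow> cinner x (e i) = 0"
    and "\<And>v. cinner v x = 0 \<Longrightarrow> (\<And>i. i \<in> I \<Longrightarrow> cinner v (e i) = 0) \<Longrightarrow> cinner v d = 0"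
proof -
  note unit_thesis = that
  define P where "P v = (\<Sum>j\<in>I. cinner v (e j) *\<^sub>C e j)" for v
  have ort: "cinner (v - P v) (e i) = 0" if "i \<in> I" for v i
    unfolding P_def using I e that by (rule residual_orthogonal)
  have unit: thesis if w: "w - P w \<noteq> 0" and d: "d = P d \<or> w = d" for w
  proof -
    define x where "x = (1 / norm (w - P w)) *\<^sub>R (w - P w)"
    have 1: "norm x = 1" using w by (simp add: x_def)
    have 2: "cinner x (e i) = 0" if "i \<in> I" for i
      using ort[OF that] by (simp add: x_def cinner.scaleR_left)
    have 3: "cinner v d = 0" if v: "cinner v x = 0" "\<And>i. i \<in> I \<Longrightarrow> cinner v (e i) = 0" for v
    proof -
      have P0: "cinner v (P u) = 0" for u
        using v(2) by (simp add: P_def cinner.sum_right cinner_scaleC_right)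
      show ?thesis
        using d
      proof
        assume "d = P d" then show ?thesis using P0 by metis
      next
        assume "w = d"
        then have "cinner v (d - P d) = 0"
          using v(1) w by (simp add: x_def cinner.scaleR_right)
        then show ?thesis using P0 by (simp add: cinner.diff_right)
      qed
    qed
    show thesis by (rule unit_thesis[OF 1 2 3])
  qed
  show thesis
  proof (cases "d = P d")
    case False
    then show ?thesis using unit[of d] by simp
  next
    case True
    obtain w where w: "\<And>r. w \<noteq> (\<Sum>b\<in>e ` I. r b *\<^sub>C b)"
      using infinite_dimensional[of "e ` I"] I by auto
    have "inj_on e I"
      using e by (auto simp: inj_on_def orthonormal_def) (metis zero_neq_one)
    then have "P w = (\<Sum>b\<in>e ` I. cinner w b *\<^sub>C b)"
      by (simp add: P_def sum.reindex)
    then have "w - P w \<noteq> 0" using w by auto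
    then show ?thesis using unit True by blast
  qed
qed

section \<open>Orthonormal bases, Fourier series and the Riesz representation\<close>

lemma orthonormalI:
  fixes e :: "nat \<Rightarrow> 'h::complex_hilbert_space"
  assumes "\<And>i. i \<in> I \<Longrightarrow> norm (e i) = 1" and "\<And>i j. i \<in> I \<Longrightarrow> j \<in> I \<Longrightarrow> i < j \<Longrightarrow> cinner (e j) (e i) = 0"
  shows "orthonormal I e"
  unfolding orthonormal_def
proof (intro ballI)
  fix i j assume "i \<in> I" "j \<in> I"
  then show "cinner (e i) (e j) = (if i = j then 1 else 0)"
    using assms cinner_commute[of "e i" "e j"]
    by (cases i j rule: linorder_cases) (auto simp: cinner_norm)
qed

text \<open>Gram-Schmidt along an enumeration of a countable dense set \<open>D\<close>. A vector
  \<open>v\<close> orthogonal to all \<open>b i\<close> is orthogonal to \<open>D\<close>, so by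
  Pythagoras no point of \<open>D\<close> comes closer to \<open>v\<close> than
  \<open>norm v\<close>; by density \<open>v\<close> is 0.\<close>

lemma ex_orthonormal_basis:
  obtains b :: "nat \<Rightarrow> 'h::separable_hilbert_space"
  where "orthonormal UNIV b" and "\<And>v. (\<And>i. cinner v (b i) = 0) \<Longrightarrow> v = 0"
proof -
  obtain D :: "'h set" where D: "countable D" "\<And>x e. e > 0 \<Longrightarrow> \<exists>d\<in>D. dist d x < e"
    using separable by blast
  then have "D \<noteq> {}" using zero_less_one by blast
  then have d: "range (from_nat_into D) = D" using D(1) by (rule range_from_nat_into)
  let ?P = "\<lambda>(e :: nat \<Rightarrow> 'h) n x. norm x = 1 \<and> (\<forall>i<n. cinner x (e i) = 0) \<and>
    (\<forall>v. cinner v x = 0 \<longrightarrow> (\<forall>i<n. cinner v (e i) = 0) \<longrightarrow> cinner v (from_nat_into D n) = 0)"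
  have "\<exists>e. \<forall>n. ?P e n (e n)"
  proof (rule dependent_wellorder_choice)
    fix n and e :: "nat \<Rightarrow> 'h"
    assume IH: "\<And>m. m < n \<Longrightarrow> ?P e m (e m)"
    have "orthonormal {..<n} e"
      using IH by (intro orthonormalI) auto
    from ex_unit_orthogonal[OF _ this, of "from_nat_into D n"]
    obtain x where "norm x = 1" "\<And>i. i \<in> {..<n} \<Longrightarrow> cinner x (e i) = 0"
      "\<And>v. cinner v x = 0 \<Longrightarrow> (\<And>i. i \<in> {..<n} \<Longrightarrow> cinner v (e i) = 0) \<Longrightarrow> cinner v (from_nat_into D n) = 0"
      by (metis finite_lessThan)
    then show "\<exists>x. ?P e n x" by (intro exI[of _ x]) auto
  next
    fix x n and f g :: "nat \<Rightarrow> 'h"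
    assume "\<And>y. y < n \<Longrightarrow> f y = g y"
    then show "?P f n x = ?P g n x" by simp
  qed
  then obtain b where b: "\<And>n. ?P b n (b n)" by blast
  show thesis
  proof (rule that)
    show "orthonormal UNIV b"
      using b by (intro orthonormalI) auto
    fix v :: 'h assume v: "\<And>i. cinner v (b i) = 0"
    have vD: "cinner v d = 0" if "d \<in> D" for d
      using that b v d by (metis (no_types, lifting) imageE)
    show "v = 0"
    proof (rule ccontr)
      assume "v \<noteq> 0"
      then obtain d where "d \<in> D" "dist d v < norm v" using D(2)[of "norm v" v] by auto
      moreover have "(norm (v - d))\<^sup>2 = (norm v)\<^sup>2 + (norm d)\<^sup>2"
        using vD[OF \<open>d \<in> D\<close>] by (simp add: norm_diff_sq)
      then have "(norm v)\<^sup>2 \<le> (norm (v - d))\<^sup>2" by simp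
      then have "norm v \<le> norm (v - d)" by (rule power2_le_imp_le) simp
      ultimately show False by (simp add: dist_norm norm_minus_commute)
    qed
  qed
qed

lemma summable_orthogonal:
  fixes y :: "nat \<Rightarrow> 'h::complex_hilbert_space"
  assumes ort: "\<And>i j. i \<noteq> j \<Longrightarrow> cinner (y i) (y j) = 0"
    and bound: "\<And>n. (\<Sum>i<n. (norm (y i))\<^sup>2) \<le> B\<^sup>2" and "0 \<le> B"
  shows "summable y" and "norm (suminf y) \<le> B"
proof -
  have s: "summable (\<lambda>i. (norm (y i))\<^sup>2)"
    using bound by (intro summableI_nonneg_bounded[where x = "B\<^sup>2"]) auto
  show 1: "summable y"
    unfolding summable_Cauchy
  proof (intro allI impI)
    fix e :: real assume "0 < e"
    with s[unfolded summable_Cauchy, rule_format, of "e\<^sup>2"] obtain N where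
      N: "\<And>m n. m \<ge> N \<Longrightarrow> norm (\<Sum>i=m..<n. (norm (y i))\<^sup>2) < e\<^sup>2" by auto
    have "norm (sum y {m..<n}) < e" if "m \<ge> N" for m n
    proof (rule power2_less_imp_less)
      show "(norm (sum y {m..<n}))\<^sup>2 < e\<^sup>2"
        using N[OF that, of n] ort by (subst norm_orthogonal_sum) auto
    qed (use \<open>0 < e\<close> in simp)
    then show "\<exists>N. \<forall>m\<ge>N. \<forall>n. norm (sum y {m..<n}) < e" by blast
  qed
  have "norm (\<Sum>i<n. y i) \<le> B" for n
    using bound[of n] ort \<open>0 \<le> B\<close>
    by (intro power2_le_imp_le[OF _ \<open>0 \<le> B\<close>]) (simp add: norm_orthogonal_sum)
  then show "norm (suminf y) \<le> B"
    using summable_LIMSEQ[OF 1] by (intro LIMSEQ_le_const2[OF tendsto_norm]) auto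
qed

lemma summable_Fourier:
  fixes e y :: "nat \<Rightarrow> 'h::complex_hilbert_space"
  assumes e: "orthonormal UNIV e" and ort: "\<And>i j. i \<noteq> j \<Longrightarrow> cinner (y i) (y j) = 0"
    and bound: "\<And>i. norm (y i) \<le> B" and "0 \<le> B"
  shows "summable (\<lambda>i. cinner v (e i) *\<^sub>C y i)"
    and "norm (\<Sum>i. cinner v (e i) *\<^sub>C y i) \<le> B * norm v"
proof -
  have "(\<Sum>i<n. (norm (cinner v (e i) *\<^sub>C y i))\<^sup>2) \<le> (B * norm v)\<^sup>2" for n
  proof -
    have "(\<Sum>i<n. (norm (cinner v (e i) *\<^sub>C y i))\<^sup>2) \<le> (\<Sum>i<n. B\<^sup>2 * (cmod (cinner v (e i)))\<^sup>2)"
      using bound \<open>0 \<le> B\<close>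
      by (intro sum_mono) (auto simp: norm_scaleC power_mult_distrib mult.commute
          intro!: mult_right_mono power_mono)
    also have "\<dots> \<le> B\<^sup>2 * (norm v)\<^sup>2"
      unfolding sum_distrib_left[symmetric]
      by (intro mult_left_mono Bessel orthonormal_contractive orthonormal_subset[OF e]) auto
    finally show ?thesis by (simp add: power_mult_distrib)
  qed
  note * = summable_orthogonal[OF _ this]
  show "summable (\<lambda>i. cinner v (e i) *\<^sub>C y i)"
    "norm (\<Sum>i. cinner v (e i) *\<^sub>C y i) \<le> B * norm v"
    using ort \<open>0 \<le> B\<close> by (auto intro!: * simp: cinner_scaleC_left cinner_scaleC_right)
qed

text \<open>The family is not assumed complete, and \<open>w\<close> is the component that it
  misses. The lemma is later applied to singular vectors, which may leave out part of the
  kernel.\<close>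

lemma Fourier_expansion:
  fixes e :: "nat \<Rightarrow> 'h::complex_hilbert_space"
  assumes e: "orthonormal UNIV e"
  obtains w where "(\<lambda>i. cinner v (e i) *\<^sub>C e i) sums (v - w)" and "\<And>i. cinner w (e i) = 0"
proof -
  define w where "w = v - (\<Sum>i. cinner v (e i) *\<^sub>C e i)"
  have s: "summable (\<lambda>i. cinner v (e i) *\<^sub>C e i)"
    using e by (intro summable_Fourier(1)[where B = 1]) (auto simp: orthonormalD orthonormal_norm)
  then have 1: "(\<lambda>i. cinner v (e i) *\<^sub>C e i) sums (v - w)"
    by (simp add: w_def summable_sums)
  have "cinner w (e k) = 0" for k
  proof -
    have "(\<lambda>i. cinner (cinner v (e i) *\<^sub>C e i) (e k)) sums cinner (v - w) (e k)"
      using 1 by (rule bounded_linear.sums[OF cinner.bounded_linear_left])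
    moreover have "(\<lambda>i. cinner (cinner v (e i) *\<^sub>C e i) (e k)) sums cinner v (e k)"
      using sums_single[of k "\<lambda>i. cinner v (e i)"]
      by (rule sums_cong[THEN iffD1, rotated]) (use e in \<open>auto simp: cinner_scaleC_left orthonormalD\<close>)
    ultimately have "cinner (v - w) (e k) = cinner v (e k)" by (rule sums_unique2)
    then show ?thesis by (simp add: cinner.diff_left)
  qed
  with 1 show thesis by (rule that)
qed

lemma ex_Fourier_operator:
  fixes e y :: "nat \<Rightarrow> 'h::complex_hilbert_space"
  assumes e: "orthonormal UNIV e" and ort: "\<And>i j. i \<noteq> j \<Longrightarrow> cinner (y i) (y j) = 0"
    and bound: "\<And>i. norm (y i) \<le> B" and B: "0 \<le> B"
  obtains x where "\<And>v. x \<cdot> v = (\<Sum>i. cinner v (e i) *\<^sub>C y i)" and "\<And>i. x \<cdot> e i = y i"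
proof -
  note s = summable_Fourier[OF assms]
  obtain x where x: "\<And>v. x \<cdot> v = (\<Sum>i. cinner v (e i) *\<^sub>C y i)"
  proof (rule ex_operator[of "\<lambda>v. \<Sum>i. cinner v (e i) *\<^sub>C y i" B])
    fix v w c
    show "(\<Sum>i. cinner (v + w) (e i) *\<^sub>C y i)
      = (\<Sum>i. cinner v (e i) *\<^sub>C y i) + (\<Sum>i. cinner w (e i) *\<^sub>C y i)"
      using suminf_add[OF s(1)[where v = v] s(1)[where v = w]] by (simp add: cinner_add_left scaleC_add_left)
    show "(\<Sum>i. cinner (c *\<^sub>C v) (e i) *\<^sub>C y i) = c *\<^sub>C (\<Sum>i. cinner v (e i) *\<^sub>C y i)"
      using bounded_linear.suminf[OF scaleC.bounded_linear_right s(1)[where v = v]] by (simp add: cinner_scaleC_left scaleC_scaleC)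
  qed (use s B in auto)
  have "x \<cdot> e k = y k" for k
  proof -
    have "(\<lambda>i. cinner (e k) (e i) *\<^sub>C y i) = (\<lambda>i. if i = k then y i else 0)"
      using e by (auto simp: orthonormalD scaleC_one)
    then show ?thesis
      using sums_unique[OF sums_single[of k y]] by (simp add: x)
  qed
  with x show thesis by (rule that)
qed

text \<open>The representing vector is the series of the \<open>y i\<close>. Applying
  \<open>f\<close> to a partial sum gives the square of its norm, so the bound on \<open>f\<close>
  bounds every partial sum by \<open>B\<close>, and orthogonality makes the series converge.\<close>

lemma ex_Riesz:
  fixes f :: "'h::separable_hilbert_space \<Rightarrow> complex"
  assumes add: "\<And>v w. f (v + w) = f v + f w" and scale: "\<And>c v. f (c *\<^sub>C v) = c * f v"
    and bound: "\<And>v. cmod (f v) \<le> B * norm v" and B: "0 \<le> B"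
  obtains w where "\<And>v. f v = cinner v w" and "norm w \<le> B"
proof -
  obtain b :: "nat \<Rightarrow> 'h" where b: "orthonormal UNIV b"
    and total: "\<And>v. (\<And>i. cinner v (b i) = 0) \<Longrightarrow> v = 0" using ex_orthonormal_basis by blast
  define y where "y i = cnj (f (b i)) *\<^sub>C b i" for i
  have f0: "f 0 = 0" using scale[of 0 0] by simp
  have f_sum: "f (\<Sum>i\<in>I. g i) = (\<Sum>i\<in>I. f (g i))" if "finite I" for g :: "nat \<Rightarrow> 'h" and I
    using that by (induction I rule: finite_induct) (simp_all add: f0 add)
  have "bounded_linear f"
    using add scale bound
    by (intro bounded_linear_intro[where K = B])
      (simp_all add: mult.commute scaleR_conv_of_real flip: scaleC_of_real)
  note f_lim = bounded_linear.tendsto[OF this] and f_sums = bounded_linear.sums[OF this]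
  have ort: "cinner (y i) (y j) = 0" if "i \<noteq> j" for i j
    using b that by (simp add: y_def cinner_scaleC_left cinner_scaleC_right orthonormalD)
  have yn: "norm (y i) = cmod (f (b i))" for i
    using b by (simp add: y_def norm_scaleC orthonormal_norm)
  have fy: "f (y i) = of_real ((norm (y i))\<^sup>2)" for i
    unfolding yn complex_norm_square by (simp add: y_def scale mult.commute)
  have bnd: "(\<Sum>i<n. (norm (y i))\<^sup>2) \<le> B\<^sup>2" for n
  proof -
    define S where "S = (\<Sum>i<n. (norm (y i))\<^sup>2)"
    have S: "S = (norm (\<Sum>i<n. y i))\<^sup>2" unfolding S_def using ort by (subst norm_orthogonal_sum) auto
    have "f (\<Sum>i<n. y i) = of_real S"
      by (simp add: f_sum fy S_def)
    then have "S \<le> B * norm (\<Sum>i<n. y i)"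
      using bound[of "\<Sum>i<n. y i"] by (simp add: S norm_power)
    then have "norm (\<Sum>i<n. y i) \<le> B"
      using B by (cases "norm (\<Sum>i<n. y i) = 0") (simp_all add: S power2_eq_square)
    then show ?thesis using S S_def by (metis norm_ge_zero power_mono)
  qed
  define w where "w = suminf y"
  note y = summable_orthogonal[OF ort bnd B, folded w_def]
  have "f v = cinner v w" for v
  proof -
    obtain u where u: "(\<lambda>i. cinner v (b i) *\<^sub>C b i) sums (v - u)" "\<And>i. cinner u (b i) = 0"
      using Fourier_expansion[OF b, of v] by blast
    then have "u = 0" using total by blast
    then have "(\<lambda>i. f (cinner v (b i) *\<^sub>C b i)) sums f v"
      using u by (intro f_sums) simp
    moreover have "(\<lambda>i. cinner v (y i)) sums cinner v w"
      using y(1) by (intro bounded_linear.sums[OF cinner.bounded_linear_right]) (simp add: w_def summable_sums)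
    moreover have "cinner v (y i) = f (cinner v (b i) *\<^sub>C b i)" for i
      by (simp add: y_def cinner_scaleC_right scale mult.commute)
    ultimately show ?thesis by (simp add: sums_unique2)
  qed
  with y(2) show thesis by (intro that) auto
qed

lemma ex_adjoint:
  fixes x :: "'h::separable_hilbert_space operator"
  obtains y where "\<And>v w. cinner (x \<cdot> v) w = cinner v (y \<cdot> w)"
proof -
  have "\<exists>a. (\<forall>v. cinner (x \<cdot> v) w = cinner v a) \<and> norm a \<le> norm x * norm w" for w
  proof (rule ex_Riesz[of "\<lambda>v. cinner (x \<cdot> v) w" "norm x * norm w"])
    fix v
    show "cmod (cinner (x \<cdot> v) w) \<le> norm x * norm w * norm v"
      using cinner_Cauchy_Schwarz[of "x \<cdot> v" w] mult_right_mono[OF norm_app[of x v], of "norm w"]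
      by (simp add: mult_ac)
  qed (auto simp: app.add_right cinner_add_left cinner_scaleC_left)
  then obtain f where f: "\<And>v w. cinner (x \<cdot> v) w = cinner v (f w)" "\<And>w. norm (f w) \<le> norm x * norm w"
    by metis
  have ext: "a = b" if "\<And>v. cinner v a = cinner v b" for a b :: 'h
    using that by (metis cinner_commute cinner_eqI)
  obtain y where "\<And>w. y \<cdot> w = f w"
  proof (rule ex_operator[of f "norm x"])
    show "f (v + w) = f v + f w" for v w
      by (rule ext) (simp add: f(1)[symmetric] cinner_add_right)
    show "f (c *\<^sub>C v) = c *\<^sub>C f v" for c v
      by (rule ext) (simp add: f(1)[symmetric] cinner_scaleC_right)
  qed (use f in auto)
  then show thesis using that f(1) by metis
qed

lemma adj_unique:
  fixes x :: "'h::complex_hilbert_space operator"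
  assumes "\<And>v w. cinner (x \<cdot> v) w = cinner v (y \<cdot> w)"
  shows "adj x = y"
  unfolding adj_def
proof (rule the_equality)
  fix y' assume *: "\<forall>v w. cinner (x \<cdot> v) w = cinner v (y' \<cdot> w)"
  show "y' = y"
  proof (rule operator_eqI, rule cinner_eqI)
    fix v w
    show "cinner (y' \<cdot> v) w = cinner (y \<cdot> v) w"
      using * assms by (metis cinner_commute)
  qed
qed (use assms in simp)

lemma adj_right:
  fixes x :: "'h::separable_hilbert_space operator"
  shows "cinner (x \<cdot> v) w = cinner v (adj x \<cdot> w)"
  by (metis ex_adjoint adj_unique)

lemma adj_left:
  fixes x :: "'h::separable_hilbert_space operator"
  shows "cinner (adj x \<cdot> v) w = cinner v (x \<cdot> w)"
  using adj_right[of x w v] by (metis cinner_commute)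

lemma adj_simps [simp]:
  fixes x y :: "'h::separable_hilbert_space operator"
  shows "adj (x * y) = adj y * adj x" and "adj (x + y) = adj x + adj y" and "adj (x - y) = adj x - adj y"
    and "adj (c *\<^sub>C x) = cnj c *\<^sub>C adj x" and "adj (r *\<^sub>R x) = r *\<^sub>R adj x" and "adj (1 :: 'h operator) = 1"
    and "adj (adj x) = x" and "adj (0 :: 'h operator) = 0" and "adj (- x) = - adj x"
proof -
  note s = adj_right adj_left app.add_left app.diff_left app.scaleR_left cinner_add_left
    cinner_add_right cinner.diff_left cinner.diff_right cinner_scaleC_left cinner_scaleC_right
    cinner.scaleR_left cinner.scaleR_right app.zero_left cinner.zero_left cinner.zero_right
    app.minus_left cinner.minus_left cinner.minus_right
  show "adj (x * y) = adj y * adj x" "adj (x + y) = adj x + adj y" "adj (x - y) = adj x - adj y"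
    "adj (c *\<^sub>C x) = cnj c *\<^sub>C adj x" "adj (r *\<^sub>R x) = r *\<^sub>R adj x" "adj (1 :: 'h operator) = 1"
    "adj (0 :: 'h operator) = 0" "adj (- x) = - adj x"
    by (rule adj_unique, simp add: s)+
  show "adj (adj x) = x"
    by (rule adj_unique) (rule adj_left)
qed

lemma norm_adj:
  fixes x :: "'h::separable_hilbert_space operator"
  shows "norm (adj x) = norm x"
proof -
  have le: "norm (adj x) \<le> norm x" for x :: "'h operator"
  proof (rule norm_operator_le)
    fix v
    have "(norm (adj x \<cdot> v))\<^sup>2 = cmod (cinner (adj x \<cdot> v) (adj x \<cdot> v))"
      by (simp add: cinner_norm norm_power)
    also have "\<dots> = cmod (cinner v (x \<cdot> adj x \<cdot> v))"
      by (simp add: adj_left)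
    also have "\<dots> \<le> norm v * (norm x * norm (adj x \<cdot> v))"
      using cinner_Cauchy_Schwarz[of v "x \<cdot> adj x \<cdot> v"] norm_app[of x "adj x \<cdot> v"]
      by (meson mult_left_mono norm_ge_zero order_trans)
    finally show "norm (adj x \<cdot> v) \<le> norm x * norm v"
      by (cases "adj x \<cdot> v = 0") (simp_all add: power2_eq_square mult_ac)
  qed simp
  from le[of x] le[of "adj x"] show ?thesis by simp
qed

lemma unitary_norm_app:
  assumes "unitary u" shows "norm (u \<cdot> v) = norm v"
proof -
  have "cinner (u \<cdot> v) (u \<cdot> v) = cinner v ((adj u * u) \<cdot> v)" by (simp add: adj_right)
  also have "\<dots> = cinner v v" using assms by (simp add: unitary_def)
  finally have "(norm (u \<cdot> v))\<^sup>2 = (norm v)\<^sup>2"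
    by (simp only: cinner_norm of_real_eq_iff)
  then show ?thesis by simp
qed

lemma unitary_norm_le: "unitary u \<Longrightarrow> norm u \<le> 1"
  by (rule norm_operator_le) (simp_all add: unitary_norm_app)

lemma unitary_adj: "unitary u \<Longrightarrow> unitary (adj u)"
  by (simp add: unitary_def)

lemma unitary_mult:
  assumes "unitary u" "unitary w" shows "unitary (u * w)"
proof -
  have "adj w * (adj u * u) * w = 1" "u * (w * adj w) * adj u = 1"
    using assms by (simp_all add: unitary_def)
  then show ?thesis by (simp add: unitary_def mult.assoc)
qed

section \<open>Compact operators and singular values\<close>

lemma compact_operator_convergent_subseq:
  assumes "compact_operator x" and "\<And>n. norm (v n) \<le> 1"
  obtains r y where "strict_mono (r :: nat \<Rightarrow> nat)" and "(\<lambda>n. x \<cdot> v (r n)) \<longlonglongrightarrow> y"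
proof -
  have "seq_compact (closure ((\<cdot>) x ` cball 0 1))"
    using assms(1) by (simp add: compact_operator_def compact_imp_seq_compact)
  moreover have "x \<cdot> v n \<in> closure ((\<cdot>) x ` cball 0 1)" for n
    using assms(2) by (intro closure_subset[THEN subsetD]) auto
  ultimately obtain l r where "strict_mono r" "((\<lambda>n. x \<cdot> v n) \<circ> r) \<longlonglongrightarrow> l"
    unfolding seq_compact_def by metis
  then show thesis by (intro that[of r l]) (simp_all add: o_def)
qed

text \<open>The box is a sum of \<open>m\<close> compact discs, and the vectors \<open>w i\<close>
  may be dependent. It serves as the finite-dimensional Heine-Borel theorem for the image of a
  polydisc.\<close>

lemma compact_box_sums:
  fixes w :: "nat \<Rightarrow> 'h::complex_hilbert_space"
  shows "compact {\<Sum>i<m. a i *\<^sub>C w i | a. \<forall>i<m. cmod (a i) \<le> 1}"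
proof (induction m)
  case (Suc m)
  have "compact ((\<lambda>a. a *\<^sub>C w m) ` cball 0 1)"
    by (intro compact_continuous_image compact_cball linear_continuous_on scaleC.bounded_linear_left)
  moreover have "{\<Sum>i<Suc m. a i *\<^sub>C w i | a. \<forall>i<Suc m. cmod (a i) \<le> 1} =
    {x + y | x y. x \<in> {\<Sum>i<m. a i *\<^sub>C w i | a. \<forall>i<m. cmod (a i) \<le> 1} \<and>
      y \<in> (\<lambda>a. a *\<^sub>C w m) ` cball 0 1}" (is "?L = ?R")
  proof
    show "?L \<subseteq> ?R"
    proof
      fix v assume "v \<in> ?L"
      then obtain a where a: "\<forall>i<Suc m. cmod (a i) \<le> 1" and v: "v = (\<Sum>i<Suc m. a i *\<^sub>C w i)"
        by blast
      show "v \<in> ?R"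
        using a by (intro CollectI exI[of _ "\<Sum>i<m. a i *\<^sub>C w i"] exI[of _ "a m *\<^sub>C w m"]) (auto simp: v)
    qed
    show "?R \<subseteq> ?L"
    proof
      fix v assume "v \<in> ?R"
      then obtain a c where a: "\<forall>i<m. cmod (a i) \<le> 1" and c: "cmod c \<le> 1"
        and v: "v = (\<Sum>i<m. a i *\<^sub>C w i) + c *\<^sub>C w m" by auto
      have "v = (\<Sum>i<Suc m. (a(m := c)) i *\<^sub>C w i)"
        unfolding v by simp
      then show "v \<in> ?L" using a c by (intro CollectI exI[of _ "a(m := c)"]) (auto simp: less_Suc_eq)
    qed
  qed
  ultimately show ?case using compact_sums[OF Suc.IH] by simp
qed simp

lemma norm_residual_le:
  assumes "finite I" "orthonormal I e"
  shows "norm (v - (\<Sum>j\<in>I. cinner v (e j) *\<^sub>C e j)) \<le> norm v"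
proof -
  define P where "P = (\<Sum>j\<in>I. cinner v (e j) *\<^sub>C e j)"
  have "cinner (v - P) P = (\<Sum>j\<in>I. cnj (cinner v (e j)) * cinner (v - P) (e j))"
    by (simp add: P_def cinner.sum_right cinner_scaleC_right)
  also have "\<dots> = 0"
    using residual_orthogonal[OF assms] by (intro sum.neutral) (simp add: P_def)
  finally have "(norm v)\<^sup>2 = (norm (v - P))\<^sup>2 + (norm P)\<^sup>2"
    using norm_add_sq[of "v - P" P] by simp
  then have "(norm (v - P))\<^sup>2 \<le> (norm v)\<^sup>2" by simp
  then show ?thesis
    unfolding P_def[symmetric] by (rule power2_le_imp_le) simp
qed

text \<open>Total boundedness: up to \<epsilon>/4 the image of a unit vector is the image of its
  projection onto the \<open>e i\<close>, and those images lie in a compact box with a finite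
  \<epsilon>/4-net. The third \<epsilon>/4 pays for the closure. The contrapositive produces the
  test vectors for an operator that is not compact.\<close>

lemma compact_operatorI:
  fixes x :: "'h::complex_hilbert_space operator"
  assumes "\<And>d. d > 0 \<Longrightarrow> \<exists>m e. orthonormal {..<m::nat} e \<and>
    (\<forall>v. (\<forall>i<m. cinner v (e i) = 0) \<longrightarrow> norm (x \<cdot> v) \<le> d * norm v)"
  shows "compact_operator x"
  unfolding compact_operator_def compact_eq_totally_bounded
proof (intro conjI allI impI)
  show "complete (closure ((\<cdot>) x ` cball 0 1))" by (simp add: complete_eq_closed)
  fix \<epsilon> :: real assume "0 < \<epsilon>"
  then obtain m e where e: "orthonormal {..<m::nat} e"
    and small: "\<And>v. (\<forall>i<m. cinner v (e i) = 0) \<Longrightarrow> norm (x \<cdot> v) \<le> \<epsilon> / 4 * norm v"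
    using assms[of "\<epsilon> / 4"] by auto
  have "compact {\<Sum>i<m. a i *\<^sub>C (x \<cdot> e i) | a. \<forall>i<m. cmod (a i) \<le> 1}"
    by (rule compact_box_sums)
  then obtain k where k: "finite k"
    "{\<Sum>i<m. a i *\<^sub>C (x \<cdot> e i) | a. \<forall>i<m. cmod (a i) \<le> 1} \<subseteq> (\<Union>c\<in>k. ball c (\<epsilon> / 4))"
    unfolding compact_eq_totally_bounded using \<open>0 < \<epsilon>\<close> by (elim conjE allE[of _ "\<epsilon> / 4"]) auto
  show "\<exists>k. finite k \<and> closure ((\<cdot>) x ` cball 0 1) \<subseteq> (\<Union>c\<in>k. ball c \<epsilon>)"
  proof (intro exI[of _ k] conjI subsetI k(1))
    fix s assume "s \<in> closure ((\<cdot>) x ` cball 0 1)"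
    then have "\<exists>y\<in>(\<cdot>) x ` cball 0 1. dist y s < \<epsilon> / 4"
      using \<open>0 < \<epsilon>\<close> unfolding closure_approachable by (elim allE[of _ "\<epsilon> / 4"]) auto
    then obtain v where v: "norm v \<le> 1" "dist (x \<cdot> v) s < \<epsilon> / 4" by auto
    define P where "P = (\<Sum>j<m. cinner v (e j) *\<^sub>C e j)"
    have "norm (x \<cdot> (v - P)) \<le> \<epsilon> / 4 * norm (v - P)"
      using residual_orthogonal[OF _ e, of _ v] by (intro small) (simp add: P_def)
    also have "\<dots> \<le> \<epsilon> / 4 * 1"
      using norm_residual_le[OF _ e, of v] v(1) \<open>0 < \<epsilon>\<close> by (intro mult_left_mono) (simp_all add: P_def)
    finally have 1: "dist (x \<cdot> P) (x \<cdot> v) \<le> \<epsilon> / 4"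
      by (simp add: dist_norm norm_minus_commute app.diff_right)
    have xP: "x \<cdot> P = (\<Sum>j<m. cinner v (e j) *\<^sub>C (x \<cdot> e j))"
      by (simp add: P_def app.sum_right)
    have coeff: "cmod (cinner v (e j)) \<le> 1" if "j < m" for j
      using cinner_Cauchy_Schwarz[of v "e j"] v(1) orthonormal_norm[OF e, of j] that by simp
    obtain c where c: "c \<in> k" "dist c (x \<cdot> P) < \<epsilon> / 4"
    proof -
      have "x \<cdot> P \<in> {\<Sum>i<m. a i *\<^sub>C (x \<cdot> e i) | a. \<forall>i<m. cmod (a i) \<le> 1}"
        using coeff by (intro CollectI exI[of _ "\<lambda>j. cinner v (e j)"] conjI xP) auto
      then show thesis using k(2) that by auto
    qed
    have "dist c s < \<epsilon>"
      using 1 c(2) v(2) \<open>0 < \<epsilon>\<close> dist_triangle[of c s "x \<cdot> v"] dist_triangle[of c "x \<cdot> v" "x \<cdot> P"] by linarith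
    then show "s \<in> (\<Union>c\<in>k. ball c \<epsilon>)" using c(1) by auto
  qed
qed

text \<open>Only the images of a maximising sequence converge along a subsequence. That the vectors
  converge too follows from the parallelogram law: the image of \<open>z k + z l\<close> has norm
  close to 2 s, so \<open>z k + z l\<close> has norm close to 2, and \<open>z k - z l\<close> is
  small.\<close>

lemma ex_maximizer:
  fixes x :: "'h::separable_hilbert_space operator" and e :: "nat \<Rightarrow> 'h"
  assumes x: "compact_operator x" and e: "orthonormal {..<n} e"
  obtains v where "norm v = 1" and "\<And>i. i < n \<Longrightarrow> cinner v (e i) = 0"
    and "\<And>w. (\<And>i. i < n \<Longrightarrow> cinner w (e i) = 0) \<Longrightarrow> norm (x \<cdot> w) \<le> norm (x \<cdot> v) * norm w"
proof -
  define V where "V = {w. \<forall>i<n. cinner w (e i) = 0}"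
  define U where "U = V \<inter> sphere 0 1"
  define s where "s = Sup ((\<lambda>v. norm (x \<cdot> v)) ` U)"
  obtain u where u: "u \<in> U"
  proof -
    obtain u where "norm u = 1" "\<And>i. i \<in> {..<n} \<Longrightarrow> cinner u (e i) = 0"
      using ex_unit_orthogonal[OF finite_lessThan e] by metis
    then show thesis using that[of u] by (simp add: U_def V_def)
  qed
  have bdd: "bdd_above ((\<lambda>v. norm (x \<cdot> v)) ` U)"
  proof (rule bdd_aboveI2)
    show "norm (x \<cdot> v) \<le> norm x" if "v \<in> U" for v
      using norm_app[of x v] that by (simp add: U_def)
  qed
  have le_s: "norm (x \<cdot> w) \<le> s * norm w" if "w \<in> V" for w
  proof (cases "w = 0")
    case False
    then have "(1 / norm w) *\<^sub>R w \<in> U"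
      using that by (simp add: U_def V_def cinner.scaleR_left)
    then have "norm (x \<cdot> ((1 / norm w) *\<^sub>R w)) \<le> s"
      unfolding s_def using bdd by (intro cSup_upper) auto
    then show ?thesis using False by (simp add: app.scaleR_right field_simps)
  qed (simp add: app.zero_right)
  have "0 \<le> s" 
    using u le_s[of u] order_trans[OF norm_ge_zero[of "x \<cdot> u"]] by (simp add: U_def)
  have "\<exists>v\<in>U. norm (x \<cdot> v) = s"
  proof (cases "s = 0")
    case True
    then show ?thesis using u le_s[of u] norm_ge_zero[of "x \<cdot> u"]
      by (intro bexI[of _ u]) (simp_all add: U_def)
  next
    case False
    with \<open>0 \<le> s\<close> have s: "s > 0" by simp
    have "\<exists>v\<in>U. s - 1 / Suc k < norm (x \<cdot> v)" for k
    proof -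
      have "s - 1 / Suc k < s" by simp
      then show ?thesis
        unfolding s_def using bdd u by (subst (asm) less_cSup_iff) auto
    qed
    then obtain v where v: "\<And>k. v k \<in> U" "\<And>k. s - 1 / Suc k < norm (x \<cdot> v k)" by metis
    have "norm (v k) \<le> 1" for k using v(1)[of k] by (simp add: U_def)
    then obtain r y where r: "strict_mono r" and y: "(\<lambda>k. x \<cdot> v (r k)) \<longlonglongrightarrow> y"
      using compact_operator_convergent_subseq[OF x] by metis
    define z where "z k = v (r k)" for k
    have z: "z k \<in> V" "norm (z k) = 1" for k using v(1)[of "r k"] by (auto simp: z_def U_def)
    have "(\<lambda>k. norm (x \<cdot> v k)) \<longlonglongrightarrow> s"
    proof (rule tendsto_sandwich)
      show "(\<lambda>k. s - 1 / Suc k) \<longlonglongrightarrow> s"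
        using tendsto_diff[OF tendsto_const[of s] LIMSEQ_inverse_real_of_nat] by (simp add: inverse_eq_divide)
      show "\<forall>\<^sub>F k in sequentially. norm (x \<cdot> v k) \<le> s"
        using le_s v(1) by (auto simp: U_def intro!: always_eventually) (metis mult.right_neutral)
    qed (use v(2) in \<open>auto simp: less_imp_le\<close>)
    from LIMSEQ_subseq_LIMSEQ[OF this r] have "(\<lambda>k. norm (x \<cdot> z k)) \<longlonglongrightarrow> s"
      by (simp add: o_def z_def)
    moreover have y': "(\<lambda>k. x \<cdot> z k) \<longlonglongrightarrow> y" using y by (simp add: z_def)
    ultimately have ny: "norm y = s" using tendsto_norm LIMSEQ_unique by blast
    have "Cauchy z"
    proof (rule CauchyI)
      fix \<epsilon> :: real assume "0 < \<epsilon>"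
      \<comment> \<open>The bound \<delta> \<le> s keeps 2 s - 2 \<delta> non-negative before
        squaring; the other bound makes the error 8 \<delta> s at most half of \<epsilon>^2
        s^2.\<close>
      define \<delta> where "\<delta> = min s (\<epsilon>\<^sup>2 * s / 16)"
      have \<delta>: "0 < \<delta>" "\<delta> \<le> s" "8 * (\<delta> * s) \<le> \<epsilon>\<^sup>2 * s\<^sup>2 / 2"
        using s \<open>0 < \<epsilon>\<close> mult_right_mono[of \<delta> "\<epsilon>\<^sup>2 * s / 16" s]
        by (auto simp: \<delta>_def power2_eq_square)
      then obtain M where M: "\<And>k. k \<ge> M \<Longrightarrow> norm (x \<cdot> z k - y) < \<delta>"
        using y' unfolding LIMSEQ_iff by blast
      show "\<exists>M. \<forall>k\<ge>M. \<forall>l\<ge>M. norm (z k - z l) < \<epsilon>"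
      proof (intro exI[of _ M] allI impI)
        fix k l assume "M \<le> k" "M \<le> l"
        have "norm ((x \<cdot> z k - y) + (x \<cdot> z l - y)) \<le> 2 * \<delta>"
          using M[OF \<open>M \<le> k\<close>] M[OF \<open>M \<le> l\<close>] norm_triangle_ineq[of "x \<cdot> z k - y" "x \<cdot> z l - y"] by linarith
        moreover have "(x \<cdot> z k - y) + (x \<cdot> z l - y) = x \<cdot> (z k + z l) - 2 *\<^sub>R y"
          by (simp add: app.add_right scaleR_2)
        moreover have "norm (2 *\<^sub>R y) = 2 * s" using ny by simp
        ultimately have "2 * s - 2 * \<delta> \<le> norm (x \<cdot> (z k + z l))"
          using norm_triangle_ineq2[of "2 *\<^sub>R y" "x \<cdot> (z k + z l)"] by (simp add: norm_minus_commute)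
        also have "\<dots> \<le> s * norm (z k + z l)"
          using z by (intro le_s) (auto simp: V_def cinner_add_left)
        finally have "(2 * s - 2 * \<delta>)\<^sup>2 \<le> (s * norm (z k + z l))\<^sup>2"
          using \<delta> by (intro power_mono) auto
        moreover have "(norm (z k + z l))\<^sup>2 = 4 - (norm (z k - z l))\<^sup>2"
          using z by (simp add: norm_add_sq norm_diff_sq)
        moreover have "(2 * s - 2 * \<delta>)\<^sup>2 = 4 * s\<^sup>2 - 8 * (\<delta> * s) + 4 * \<delta>\<^sup>2"
          by (simp add: power2_eq_square algebra_simps)
        ultimately have "s\<^sup>2 * (norm (z k - z l))\<^sup>2 \<le> 8 * (\<delta> * s)"
          by (simp add: power_mult_distrib algebra_simps) (smt (verit) zero_le_power2)
        also have "\<dots> \<le> s\<^sup>2 * (\<epsilon>\<^sup>2 / 2)" using \<delta>(3) by (simp add: mult.commute)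
        also have "\<dots> < s\<^sup>2 * \<epsilon>\<^sup>2" using s \<open>0 < \<epsilon>\<close> by simp
        finally have "(norm (z k - z l))\<^sup>2 < \<epsilon>\<^sup>2" using s by simp
        then show "norm (z k - z l) < \<epsilon>"
          by (rule power2_less_imp_less) (use \<open>0 < \<epsilon>\<close> in simp)
      qed
    qed
    then obtain v' where v': "z \<longlonglongrightarrow> v'" using Cauchy_convergent convergent_def by blast
    have "norm v' = 1"
      using tendsto_norm[OF v'] z(2) by (simp add: LIMSEQ_const_iff)
    moreover have "cinner v' (e i) = 0" if "i < n" for i
    proof -
      have "(\<lambda>k. cinner (z k) (e i)) \<longlonglongrightarrow> cinner v' (e i)"
        by (intro cinner.tendsto v' tendsto_const)
      then show ?thesis using z(1) that by (simp add: V_def LIMSEQ_const_iff)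
    qed
    moreover have "(\<lambda>k. x \<cdot> z k) \<longlonglongrightarrow> x \<cdot> v'"
      by (intro app.tendsto v' tendsto_const)
    then have "norm (x \<cdot> v') = s" using LIMSEQ_unique[OF y'] ny by simp
    ultimately show ?thesis by (auto simp: U_def V_def)
  qed
  then show thesis using that le_s by (auto simp: U_def V_def)
qed

text \<open>First variation at a maximiser: moving \<open>v\<close> by \<open>t\<close> times
  \<open>w\<close> with \<open>t\<close> proportional to \<open>a\<close> gains 2 \<epsilon>
  \<bar>a\<bar>^2 to first order, while the right-hand side grows only by \<epsilon>^2 s
  \<bar>a\<bar>^2. The choice of \<epsilon> gives \<epsilon> s < 1, so the gain would win.\<close>

lemma maximizer_orthogonal:
  assumes max: "\<And>t. norm (x \<cdot> (v + t *\<^sub>C w)) \<le> norm (x \<cdot> v) * norm (v + t *\<^sub>C w)"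
    and v: "norm v = 1" and vw: "cinner v w = 0"
  shows "cinner (x \<cdot> v) (x \<cdot> w) = 0"
proof (rule ccontr)
  define a where "a = cinner (x \<cdot> v) (x \<cdot> w)"
  define s where "s = (norm (x \<cdot> v))\<^sup>2 * (norm w)\<^sup>2"
  define \<epsilon> where "\<epsilon> = 1 / (s + 1)"
  assume "cinner (x \<cdot> v) (x \<cdot> w) \<noteq> 0"
  then have a: "cmod a > 0" by (simp add: a_def)
  have s: "0 \<le> s" by (simp add: s_def)
  then have \<epsilon>: "0 < \<epsilon>" "\<epsilon> * s < 1" by (auto simp: \<epsilon>_def)
  define t where "t = of_real \<epsilon> * a"
  have "(norm (x \<cdot> (v + t *\<^sub>C w)))\<^sup>2 \<le> (norm (x \<cdot> v) * norm (v + t *\<^sub>C w))\<^sup>2"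
    using max by (intro power_mono) auto
  moreover have "(norm (v + t *\<^sub>C w))\<^sup>2 = 1 + (cmod t * norm w)\<^sup>2"
    by (simp add: norm_add_sq v vw cinner_scaleC_right norm_scaleC)
  moreover have "cinner (x \<cdot> v) (t *\<^sub>C (x \<cdot> w)) = of_real (\<epsilon> * (cmod a)\<^sup>2)"
    by (simp add: cinner_scaleC_right t_def complex_norm_square mult_ac flip: a_def of_real_power)
  then have "(norm (x \<cdot> (v + t *\<^sub>C w)))\<^sup>2
      = (norm (x \<cdot> v))\<^sup>2 + 2 * (\<epsilon> * (cmod a)\<^sup>2) + (norm (t *\<^sub>C (x \<cdot> w)))\<^sup>2"
    by (simp only: app.add_right app_scaleC_right norm_add_sq Re_complex_of_real)
  moreover have "cmod t = \<epsilon> * cmod a" using \<epsilon> by (simp add: t_def norm_mult)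
  ultimately have "2 * (\<epsilon> * (cmod a)\<^sup>2) \<le> (\<epsilon> * s) * (\<epsilon> * (cmod a)\<^sup>2)"
    by (simp add: s_def power_mult_distrib algebra_simps power2_eq_square[of \<epsilon>])
       (smt (verit) zero_le_power2)
  moreover have "(\<epsilon> * s) * (\<epsilon> * (cmod a)\<^sup>2) < 1 * (\<epsilon> * (cmod a)\<^sup>2)"
    using \<epsilon> a by (intro mult_strict_right_mono) auto
  moreover have "0 < \<epsilon> * (cmod a)\<^sup>2" using \<epsilon> a by simp
  ultimately show False by linarith
qed

text \<open>A Schmidt decomposition. The eigenvector equation for \<open>adj x * x\<close> is
  written in weak form. The family is indexed by all naturals, so for finite rank it runs on into
  the kernel with \<open>s j = 0\<close>; it need not be complete, but what it misses is annihilated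
  by \<open>x\<close>.\<close>

definition singular_system ::
  "'h::separable_hilbert_space operator \<Rightarrow> (nat \<Rightarrow> 'h) \<Rightarrow> (nat \<Rightarrow> real) \<Rightarrow> bool"
  where "singular_system x e s \<longleftrightarrow> orthonormal UNIV e \<and> decseq s \<and> (\<forall>j. 0 \<le> s j) \<and> s \<longlonglongrightarrow> 0 \<and>
    (\<forall>j w. cinner (x \<cdot> e j) (x \<cdot> w) = of_real ((s j)\<^sup>2) * cinner (e j) w) \<and>
    (\<forall>v. (\<forall>j. cinner v (e j) = 0) \<longrightarrow> x \<cdot> v = 0)"

text \<open>Greedy choice: \<open>e n\<close> maximises the norm of the image on the orthogonal
  complement of its predecessors. The variational identity \<open>var\<close> then shows that the
  images are orthogonal and that the \<open>e n\<close> are eigenvectors of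
  \<open>adj x * x\<close>.\<close>

lemma ex_singular_system:
  fixes x :: "'h::separable_hilbert_space operator"
  assumes x: "compact_operator x"
  obtains e s where "singular_system x e s"
proof -
  let ?P = "\<lambda>(e :: nat \<Rightarrow> 'h) n v. norm v = 1 \<and> (\<forall>i<n. cinner v (e i) = 0) \<and>
    (\<forall>w. (\<forall>i<n. cinner w (e i) = 0) \<longrightarrow> norm (x \<cdot> w) \<le> norm (x \<cdot> v) * norm w)"
  have "\<exists>e. \<forall>n. ?P e n (e n)"
  proof (rule dependent_wellorder_choice)
    fix n and e :: "nat \<Rightarrow> 'h"
    assume IH: "\<And>m. m < n \<Longrightarrow> ?P e m (e m)"
    have "orthonormal {..<n} e"
      using IH by (intro orthonormalI) auto
    from ex_maximizer[OF x this]
    obtain v where v: "norm v = 1" "\<And>i. i < n \<Longrightarrow> cinner v (e i) = 0"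
      "\<And>w. (\<And>i. i < n \<Longrightarrow> cinner w (e i) = 0) \<Longrightarrow> norm (x \<cdot> w) \<le> norm (x \<cdot> v) * norm w"
      by metis
    then show "\<exists>v. ?P e n v" by (intro exI[of _ v]) auto
  next
    fix v n and f g :: "nat \<Rightarrow> 'h"
    assume "\<And>y. y < n \<Longrightarrow> f y = g y"
    then show "?P f n v = ?P g n v" by simp
  qed
  then obtain e where "\<And>n. ?P e n (e n)" by blast
  then have e: "\<And>n. norm (e n) = 1" "\<And>n i. i < n \<Longrightarrow> cinner (e n) (e i) = 0"
    and max: "\<And>n w. (\<And>i. i < n \<Longrightarrow> cinner w (e i) = 0) \<Longrightarrow> norm (x \<cdot> w) \<le> norm (x \<cdot> e n) * norm w"
    by simp_all
  have on: "orthonormal UNIV e" using e by (intro orthonormalI) auto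
  define s where "s n = norm (x \<cdot> e n)" for n
  have dec: "decseq s"
    unfolding decseq_Suc_iff s_def
  proof
    fix n
    show "norm (x \<cdot> e (Suc n)) \<le> norm (x \<cdot> e n)" using max[of n "e (Suc n)"] e by simp
  qed
  have var: "cinner (x \<cdot> e j) (x \<cdot> w) = 0" if w: "\<And>i. i \<le> j \<Longrightarrow> cinner w (e i) = 0" for j w
  proof (rule maximizer_orthogonal)
    show "cinner (e j) w = 0" using w[of j] cinner_commute[of "e j" w] by simp
    show "norm (x \<cdot> (e j + t *\<^sub>C w)) \<le> norm (x \<cdot> e j) * norm (e j + t *\<^sub>C w)" for t
      using w e by (intro max) (simp add: cinner_add_left cinner_scaleC_left)
  qed (rule e)
  have ort: "cinner (x \<cdot> e j) (x \<cdot> e i) = 0" if "i \<noteq> j" for i j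
  proof (cases "i < j")
    case True
    then have "cinner (x \<cdot> e i) (x \<cdot> e j) = 0" using e by (intro var) auto
    then show ?thesis using cinner_commute[of "x \<cdot> e j" "x \<cdot> e i"] by simp
  next
    case False
    then show ?thesis using that e by (intro var) auto
  qed
  have eig: "cinner (x \<cdot> e j) (x \<cdot> w) = of_real ((s j)\<^sup>2) * cinner (e j) w" for j w
  proof -
    define P where "P = (\<Sum>i\<le>j. cinner w (e i) *\<^sub>C e i)"
    have "cinner (x \<cdot> e j) (x \<cdot> (w - P)) = 0"
      using residual_orthogonal[of "{..j}" e _ w] orthonormal_subset[OF on]
      by (intro var) (simp add: P_def)
    then have "cinner (x \<cdot> e j) (x \<cdot> w) = cinner (x \<cdot> e j) (x \<cdot> P)"
      by (simp add: app.diff_right cinner.diff_right)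
    also have "\<dots> = (\<Sum>i\<le>j. cnj (cinner w (e i)) * cinner (x \<cdot> e j) (x \<cdot> e i))"
      by (simp add: P_def app.sum_right cinner.sum_right cinner_scaleC_right)
    also have "\<dots> = (\<Sum>i\<le>j. if i = j then cnj (cinner w (e j)) * cinner (x \<cdot> e j) (x \<cdot> e j) else 0)"
      using ort by (intro sum.cong) auto
    also have "\<dots> = of_real ((s j)\<^sup>2) * cinner (e j) w"
      by (simp add: s_def cinner_norm flip: cinner_commute)
    finally show ?thesis .
  qed
  have lim: "s \<longlonglongrightarrow> 0"
  proof -
    obtain L where L: "s \<longlonglongrightarrow> L" "\<And>i. L \<le> s i"
      using decseq_convergent[OF dec, of 0] by (auto simp: s_def)
    have "0 \<le> L" by (rule LIMSEQ_le_const[OF L(1)]) (auto simp: s_def)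
    moreover have "\<not> 0 < L"
    proof
      assume "0 < L"
      \<comment> \<open>Images with norms at least L are orthogonal, hence at mutual distance at
        least L, and cannot have a Cauchy subsequence.\<close>
      obtain r y where r: "strict_mono r" and "(\<lambda>k. x \<cdot> e (r k)) \<longlonglongrightarrow> y"
        using compact_operator_convergent_subseq[OF x, of e] e by (metis order_refl)
      then have "Cauchy (\<lambda>k. x \<cdot> e (r k))" by (intro LIMSEQ_imp_Cauchy)
      from CauchyD[OF this \<open>0 < L\<close>] obtain M where
        "\<forall>k\<ge>M. \<forall>l\<ge>M. norm (x \<cdot> e (r k) - x \<cdot> e (r l)) < L" by blast
      then have "norm (x \<cdot> e (r M) - x \<cdot> e (r (Suc M))) < L" by simp
      then have "(norm (x \<cdot> e (r M) - x \<cdot> e (r (Suc M))))\<^sup>2 < L\<^sup>2"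
        using \<open>0 < L\<close> by (intro power_strict_mono) auto
      moreover have "r (Suc M) \<noteq> r M" using r by (simp add: strict_mono_eq)
      ultimately have "(s (r M))\<^sup>2 + (s (r (Suc M)))\<^sup>2 < L\<^sup>2"
        by (simp add: norm_diff_sq ort s_def)
      moreover have "L\<^sup>2 \<le> (s (r M))\<^sup>2" using L(2) \<open>0 < L\<close> by (intro power_mono) auto
      ultimately show False by (smt (verit) zero_le_power2)
    qed
    ultimately show ?thesis using L(1) by simp
  qed
  have ker: "x \<cdot> v = 0" if "\<And>j. cinner v (e j) = 0" for v
  proof -
    have "(\<lambda>n. s n * norm v) \<longlonglongrightarrow> 0 * norm v" by (intro tendsto_intros lim)
    then have "norm (x \<cdot> v) \<le> 0 * norm v"
      using max that by (intro LIMSEQ_le_const) (auto simp: s_def)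
    then show ?thesis by simp
  qed
  have "singular_system x e s"
    unfolding singular_system_def using on dec lim eig ker by (auto simp: s_def)
  then show thesis by (rule that)
qed

section \<open>Identification of the singular values\<close>

lemma orthonormal_independent:
  fixes e :: "'i \<Rightarrow> 'h::complex_hilbert_space"
  assumes I: "finite I" and e: "orthonormal I e"
  shows "complex_vector.independent (e ` I)" and "inj_on e I"
proof -
  show inj: "inj_on e I"
    using e unfolding inj_on_def orthonormal_def by (metis zero_neq_one)
  show "complex_vector.independent (e ` I)"
  proof (rule complex_vector.independent_if_scalars_zero)
    fix f v assume f: "(\<Sum>v\<in>e ` I. f v *\<^sub>C v) = 0" and "v \<in> e ` I"
    then obtain i where i: "i \<in> I" "v = e i" by blast
    have "0 = cinner (\<Sum>j\<in>I. f (e j) *\<^sub>C e j) (e i)"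
      using f inj by (simp add: sum.reindex cinner.zero_left)
    also have "\<dots> = (\<Sum>j\<in>I. if j = i then f (e i) else 0)"
      unfolding cinner.sum_left cinner_scaleC_left
      using e i by (intro sum.cong) (auto simp: orthonormalD)
    also have "\<dots> = f v" using I i by simp
    finally show "f v = 0" by simp
  qed (use I in simp)
qed

text \<open>At a first index \<open>m\<close> where the sequences differ, let \<open>t m\<close> be
  the larger value. The other sequence can take this value only before \<open>m\<close>, where both
  agree, so it takes it fewer times.\<close>

lemma singular_values_unique:
  fixes s s' :: "nat \<Rightarrow> real"
  assumes "decseq s" "decseq s'" and "\<And>j. 0 \<le> s j" "\<And>j. 0 \<le> s' j"
    and "\<And>r. 0 < r \<Longrightarrow> finite {j. s j = r} \<and> finite {j. s' j = r} \<and> card {j. s j = r} = card {j. s' j = r}"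
  shows "s = s'"
proof
  have le: "t m \<le> t' m" if "decseq t" "decseq t'" "\<And>j. 0 \<le> t j" "\<And>j. 0 \<le> t' j"
    "\<And>r. 0 < r \<Longrightarrow> finite {j. t j = r} \<and> finite {j. t' j = r} \<and> card {j. t j = r} = card {j. t' j = r}"
    and eq: "\<And>j. j < m \<Longrightarrow> t j = t' j" for t t' :: "nat \<Rightarrow> real" and m
  proof (rule ccontr)
    assume less: "\<not> t m \<le> t' m"
    define r where "r = t m"
    have r: "0 < r" using less that(4)[of m] by (simp add: r_def)
    have "{j. t' j = r} \<subset> {j. t j = r}"
    proof (rule psubsetI)
      show "{j. t' j = r} \<subseteq> {j. t j = r}"
      proof (intro subsetI CollectI, elim CollectE)
        fix j assume "t' j = r"
        then have "j < m" using decseqD[OF that(2), of m j] less by (force simp: r_def)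
        with eq \<open>t' j = r\<close> show "t j = r" by simp
      qed
      have "m \<in> {j. t j = r}" "m \<notin> {j. t' j = r}" using less by (auto simp: r_def)
      then show "{j. t' j = r} \<noteq> {j. t j = r}" by blast
    qed
    then have "card {j. t' j = r} < card {j. t j = r}"
      using that(5)[OF r] by (intro psubset_card_mono) auto
    then show False using that(5)[OF r] by simp
  qed
  fix m
  show "s m = s' m"
  proof (induction m rule: less_induct)
    case (less m)
    show ?case using le[of s s' m] le[of s' s m] assms less by (simp add: antisym)
  qed
qed

text \<open>The eigenspace of \<open>adj x * x\<close> for r^2 is the span of the \<open>e j\<close>
  with \<open>s j = r\<close>: after removing its projection onto that span, an eigenvector is
  orthogonal to every \<open>e j\<close> with \<open>s j > 0\<close>, hence annihilated, hence 0.
  Multiplicities are finite because \<open>s\<close> tends to 0.\<close>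

lemma singular_values_eqI:
  fixes x :: "'h::separable_hilbert_space operator"
  assumes dec: "decseq s" and pos: "\<And>j. 0 \<le> s j" and lim: "s \<longlonglongrightarrow> 0"
    and e: "orthonormal {j. 0 < s j} e"
    and eig: "\<And>j. 0 < s j \<Longrightarrow> (adj x * x) \<cdot> e j = complex_of_real ((s j)\<^sup>2) *\<^sub>C e j"
    and ker: "\<And>v. (\<And>j. 0 < s j \<Longrightarrow> cinner v (e j) = 0) \<Longrightarrow> (adj x * x) \<cdot> v = 0"
  shows "singular_values x = s"
proof -
  define K where "K = adj x * x"
  have K: "cinner (K \<cdot> v) w = cinner v (K \<cdot> w)" for v w
    by (simp add: K_def adj_left adj_right)
  have fin: "finite {j. s j = r}" if "0 < r" for r
  proof -
    have "eventually (\<lambda>j. s j < r) sequentially" using lim that by (rule order_tendstoD)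
    then obtain M where "\<forall>j\<ge>M. s j < r" unfolding eventually_sequentially by blast
    then have "{j. s j = r} \<subseteq> {..<M}" by (force simp: not_le[symmetric])
    then show ?thesis by (rule finite_subset) simp
  qed
  have dim: "card {j. s j = r} = cdim {v. K \<cdot> v = complex_of_real (r\<^sup>2) *\<^sub>C v}" if r: "0 < r" for r
  proof -
    define J where "J = {j. s j = r}"
    have J: "finite J" "J \<subseteq> {j. 0 < s j}" using fin[OF r] r by (auto simp: J_def)
    have eJ: "orthonormal J e" using e J(2) by (rule orthonormal_subset)
    have "cdim {v. K \<cdot> v = complex_of_real (r\<^sup>2) *\<^sub>C v} = card (e ` J)"
    proof (rule complex_vector.dim_unique)
      show "e ` J \<subseteq> {v. K \<cdot> v = complex_of_real (r\<^sup>2) *\<^sub>C v}"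
        using eig r by (auto simp: J_def K_def)
      show "{v. K \<cdot> v = complex_of_real (r\<^sup>2) *\<^sub>C v} \<subseteq> complex_vector.span (e ` J)"
      proof (intro subsetI, elim CollectE)
        fix v assume v: "K \<cdot> v = complex_of_real (r\<^sup>2) *\<^sub>C v"
        define P where "P = (\<Sum>j\<in>J. cinner v (e j) *\<^sub>C e j)"
        have KP: "K \<cdot> P = complex_of_real (r\<^sup>2) *\<^sub>C P"
          unfolding P_def app.sum_right scaleC.sum_right
          using eig r by (intro sum.cong) (auto simp: J_def K_def scaleC_scaleC mult.commute)
        have "cinner (v - P) (e j) = 0" if j: "0 < s j" for j
        proof (cases "j \<in> J")
          case True
          then show ?thesis unfolding P_def using J(1) eJ by (intro residual_orthogonal)
        next
          case False
          have "of_real (r\<^sup>2) * cinner v (e j) = cinner (K \<cdot> v) (e j)"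
            by (simp add: v cinner_scaleC_left)
          also have "\<dots> = cnj (of_real ((s j)\<^sup>2)) * cinner v (e j)"
            unfolding K using eig[OF j] by (simp only: K_def cinner_scaleC_right)
          finally have "(of_real (r\<^sup>2) - of_real ((s j)\<^sup>2)) * cinner v (e j) = 0"
            by (simp add: algebra_simps)
          moreover have "r\<^sup>2 \<noteq> (s j)\<^sup>2" using False r j by (auto simp: J_def power2_eq_iff)
          then have "complex_of_real (r\<^sup>2) - of_real ((s j)\<^sup>2) \<noteq> 0"
            by (simp only: right_minus_eq of_real_eq_iff not_False_eq_True)
          ultimately have "cinner v (e j) = 0" by (metis mult_eq_0_iff)
          moreover have "cinner P (e j) = 0"
            unfolding P_def cinner.sum_left cinner_scaleC_left
            using False e J(2) j by (intro sum.neutral) (auto simp: orthonormal_def subset_eq)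
          ultimately show ?thesis by (simp add: cinner.diff_left)
        qed
        then have "K \<cdot> (v - P) = 0" unfolding K_def by (rule ker)
        then have "complex_of_real (r\<^sup>2) *\<^sub>C (v - P) = 0"
          using v KP by (simp add: app.diff_right scaleC.diff_right)
        then have "v = P" using r by (simp add: complex_vector.scale_eq_0_iff)
        moreover have "P \<in> complex_vector.span (e ` J)"
          unfolding P_def
          by (intro complex_vector.span_sum complex_vector.span_scale complex_vector.span_base) auto
        ultimately show "v \<in> complex_vector.span (e ` J)" by simp
      qed
      show "complex_vector.independent (e ` J)" using J(1) eJ by (rule orthonormal_independent)
    qed simp
    also have "\<dots> = card J" using orthonormal_independent(2)[OF J(1) eJ] by (rule card_image)
    finally show ?thesis by (simp add: J_def)
  qed
  show ?thesis
    unfolding singular_values_def K_def[symmetric]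
  proof (rule the_equality)
    show "decseq s \<and> (\<forall>j. 0 \<le> s j) \<and> (\<forall>r>0. finite {j. s j = r} \<and>
       card {j. s j = r} = cdim {v. K \<cdot> v = complex_of_real (r\<^sup>2) *\<^sub>C v})"
      using dec pos fin dim by simp
    fix s' assume s': "decseq s' \<and> (\<forall>j. 0 \<le> s' j) \<and> (\<forall>r>0. finite {j. s' j = r} \<and>
       card {j. s' j = r} = cdim {v. K \<cdot> v = complex_of_real (r\<^sup>2) *\<^sub>C v})"
    show "s' = s"
      using s' dec pos fin dim by (intro singular_values_unique) auto
  qed
qed

lemma singular_system_eigen:
  assumes "singular_system x e s"
  shows "(adj x * x) \<cdot> e j = complex_of_real ((s j)\<^sup>2) *\<^sub>C e j"
proof (rule cinner_eqI)
  fix w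
  show "cinner ((adj x * x) \<cdot> e j) w = cinner (complex_of_real ((s j)\<^sup>2) *\<^sub>C e j) w"
    using assms by (simp only: singular_system_def app_times adj_left cinner_scaleC_left)
qed

lemma singular_system_norm:
  assumes "singular_system x e s"
  shows "norm (x \<cdot> e j) = s j"
proof -
  have "complex_of_real ((norm (x \<cdot> e j))\<^sup>2) = of_real ((s j)\<^sup>2)"
    using assms by (simp only: singular_system_def orthonormalD[of UNIV] UNIV_I if_True mult_1_right simp_thms flip: cinner_norm)
  then have "(norm (x \<cdot> e j))\<^sup>2 = (s j)\<^sup>2" by (simp only: of_real_eq_iff)
  then show ?thesis using assms by (simp add: singular_system_def)
qed

lemma singular_system_values:
  assumes x: "singular_system x e s"
  shows "singular_values x = s"
proof (rule singular_values_eqI)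
  show "orthonormal {j. 0 < s j} e"
    using x unfolding singular_system_def by (auto intro: orthonormal_subset)
  show "(adj x * x) \<cdot> e j = complex_of_real ((s j)\<^sup>2) *\<^sub>C e j" for j
    using x by (rule singular_system_eigen)
  fix v assume v: "\<And>j. 0 < s j \<Longrightarrow> cinner v (e j) = 0"
  define f where "f = (\<lambda>i. cinner v (e i) *\<^sub>C e i)"
  obtain w where w: "f sums (v - w)" "\<And>i. cinner w (e i) = 0"
    using Fourier_expansion[of e v] x unfolding singular_system_def f_def by blast
  have "(\<lambda>i. x \<cdot> f i) sums (x \<cdot> (v - w))"
    using w(1) by (rule bounded_linear.sums[OF app.bounded_linear_right])
  moreover have "x \<cdot> f i = 0" for i
    using v[of i] x singular_system_norm[OF x, of i] unfolding singular_system_def f_def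
    by (cases "s i = 0") (auto simp: less_le scaleC.zero_left app.zero_right)
  ultimately have "x \<cdot> (v - w) = 0" by (simp add: sums_unique2)
  moreover have "x \<cdot> w = 0" using x w(2) by (simp add: singular_system_def)
  ultimately show "(adj x * x) \<cdot> v = 0" by (simp add: app.diff_right app.zero_right)
qed (use x in \<open>auto simp: singular_system_def\<close>)

section \<open>Symmetric norms and diagonals\<close>

definition rank_one :: "'h::complex_hilbert_space \<Rightarrow> 'h \<Rightarrow> 'h operator"
  where "rank_one a b = (SOME x. \<forall>v. x \<cdot> v = cinner v b *\<^sub>C a)"

lemma app_rank_one [simp]: "rank_one a b \<cdot> v = cinner v b *\<^sub>C a"
proof -
  have "norm (cinner v b *\<^sub>C a) \<le> norm a * norm b * norm v" for v
    using mult_right_mono[OF cinner_Cauchy_Schwarz[of v b] norm_ge_zero[of a]]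
    by (simp add: norm_scaleC mult_ac)
  then have "\<exists>x. \<forall>v. x \<cdot> v = cinner v b *\<^sub>C a"
    using ex_operator[of "\<lambda>v. cinner v b *\<^sub>C a" "norm a * norm b"]
    by (metis cinner_add_left cinner_scaleC_left mult_nonneg_nonneg norm_ge_zero scaleC_add_left scaleC_scaleC)
  then show ?thesis unfolding rank_one_def by (rule someI2_ex) simp
qed

lemma cnj_sgn_mult: "cnj (sgn w) * w = complex_of_real (cmod w)"
proof (cases "w = 0")
  case False
  have "w * cnj w = of_real (cmod w) * of_real (cmod w)"
    by (simp add: complex_norm_square[symmetric] power2_eq_square[symmetric])
  then show ?thesis using False by (simp add: sgn_eq field_simps)
qed simp

text \<open>Pythagoras for \<open>e\<close> and Bessel for \<open>y\<close>. The resulting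
  contractions include the projection onto the \<open>e j\<close> and operators that carry the
  \<open>y j\<close> to multiples of the \<open>e j\<close>.\<close>

lemma norm_orthonormal_combination_le:
  fixes e y :: "nat \<Rightarrow> 'h::complex_hilbert_space"
  assumes e: "orthonormal {..<n} e" and y: "orthogonal_contractive {..<n} y"
    and a: "\<And>j. j < n \<Longrightarrow> cmod (a j) \<le> 1"
  shows "norm (\<Sum>j<n. (a j * cinner v (y j)) *\<^sub>C e j) \<le> norm v"
proof (rule power2_le_imp_le)
  have "(norm (\<Sum>j<n. (a j * cinner v (y j)) *\<^sub>C e j))\<^sup>2
    = (\<Sum>j<n. (norm ((a j * cinner v (y j)) *\<^sub>C e j))\<^sup>2)"
    using e by (intro norm_orthogonal_sum) (auto simp: cinner_scaleC_left cinner_scaleC_right orthonormalD)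
  also have "\<dots> \<le> (\<Sum>j<n. (cmod (cinner v (y j)))\<^sup>2)"
  proof (rule sum_mono)
    fix j assume j: "j \<in> {..<n}"
    show "(norm ((a j * cinner v (y j)) *\<^sub>C e j))\<^sup>2 \<le> (cmod (cinner v (y j)))\<^sup>2"
      using a[of j] j orthonormal_norm[OF e j]
      by (intro power_mono) (auto simp: norm_scaleC norm_mult mult_left_le_one_le)
  qed
  also have "\<dots> \<le> (norm v)\<^sup>2" using y by (intro Bessel) auto
  finally show "(norm (\<Sum>j<n. (a j * cinner v (y j)) *\<^sub>C e j))\<^sup>2 \<le> (norm v)\<^sup>2" .
qed simp

lemma
  fixes e :: "nat \<Rightarrow> 'h::separable_hilbert_space" and d :: "nat \<Rightarrow> real"
  assumes e: "orthonormal {..<n} e"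
    and d: "\<And>j. j < n \<Longrightarrow> 0 \<le> d j" "\<And>i j. i \<le> j \<Longrightarrow> j < n \<Longrightarrow> d j \<le> d i"
  defines "x \<equiv> \<Sum>j<n. of_real (d j) *\<^sub>C rank_one (e j) (e j)"
  shows compact_diagonal: "compact_operator x"
    and singular_values_diagonal: "singular_values x = (\<lambda>j. if j < n then d j else 0)"
proof -
  have x: "x \<cdot> v = (\<Sum>j<n. (of_real (d j) * cinner v (e j)) *\<^sub>C e j)" for v
    by (simp add: x_def app.sum_left scaleC_scaleC)
  show "compact_operator x"
    by (rule compact_operatorI) (auto intro!: exI[of _ n] exI[of _ e] e simp: x)
  have eig: "x \<cdot> e j = complex_of_real (d j) *\<^sub>C e j" if "j < n" for j
  proof -
    have "x \<cdot> e j = (\<Sum>i<n. if i = j then complex_of_real (d j) *\<^sub>C e j else 0)"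
      unfolding x using e that by (intro sum.cong) (auto simp: orthonormalD)
    then show ?thesis using that by simp
  qed
  have "adj x = x"
  proof (rule adj_unique)
    fix v w
    have "cinner (e i) w = cnj (cinner w (e i))" for i by (rule cinner_commute)
    then show "cinner (x \<cdot> v) w = cinner v (x \<cdot> w)"
      by (simp add: x cinner.sum_left cinner.sum_right cinner_scaleC_left cinner_scaleC_right mult_ac)
  qed
  show "singular_values x = (\<lambda>j. if j < n then d j else 0)" (is "_ = ?s")
  proof (rule singular_values_eqI)
    show "decseq ?s" using d by (auto simp: decseq_def)
    show "0 \<le> ?s j" for j using d by simp
    show "?s \<longlonglongrightarrow> 0"
      by (rule tendsto_eventually) (auto simp: eventually_sequentially intro!: exI[of _ n])
    show "orthonormal {j. 0 < ?s j} e" by (rule orthonormal_subset[OF e]) auto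
    show "(adj x * x) \<cdot> e j = complex_of_real ((?s j)\<^sup>2) *\<^sub>C e j" if "0 < ?s j" for j
      using that eig[of j] by (auto simp: \<open>adj x = x\<close> scaleC_scaleC power2_eq_square split: if_splits)
    fix v assume v: "\<And>j. 0 < ?s j \<Longrightarrow> cinner v (e j) = 0"
    have "(of_real (d j) * cinner v (e j)) *\<^sub>C e j = 0" if "j < n" for j
      using v[of j] d(1)[OF that] that by (cases "d j = 0") (auto simp: less_le)
    then have "x \<cdot> v = 0" unfolding x by (intro sum.neutral) simp
    then show "(adj x * x) \<cdot> v = 0" by (simp add: app.zero_right)
  qed
qed

lemma ex_sorting_permutation:
  fixes d :: "nat \<Rightarrow> real"
  obtains \<pi> where "\<pi> permutes {..<n}" and "\<And>i j. i \<le> j \<Longrightarrow> j < n \<Longrightarrow> d (\<pi> j) \<le> d (\<pi> i)"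
proof -
  define xs where "xs = rev (sort (map d [0..<n]))"
  have "mset xs = mset (map d [0..<n])" by (simp add: xs_def)
  then obtain p where p: "p permutes {..<length (map d [0..<n])}" "permute_list p (map d [0..<n]) = xs"
    by (rule mset_eq_permutation)
  then have p': "p permutes {..<n}" by simp
  have "xs ! i = d (p i)" if "i < n" for i
    using permute_list_nth[OF p(1), of i] p(2) that permutes_in_image[OF p', of i] by simp
  moreover have "xs ! j \<le> xs ! i" if "i \<le> j" "j < n" for i j
    using sorted_rev_nth_mono[of xs i j] that by (simp add: xs_def)
  ultimately show thesis using that[OF p'] by fastforce
qed

section \<open>Pinching, diagonals and comparison with the uniform norm\<close>

context symmetric_norm
begin

lemma gauge_zero: "\<phi> (\<lambda>j. 0) = 0"
  using scale[of "\<lambda>j. 0" 0] by simp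

lemma N_zero [simp]: "N 0 = 0"
  by (simp add: norm_eq_0)

lemma N_scaleR: "N (r *\<^sub>R x) = ennreal \<bar>r\<bar> * N x"
  using norm_scale[of "complex_of_real r" x] by (simp add: scaleC_of_real)

lemma N_uminus: "N (- x) = N x"
  using N_scaleR[of "-1" x] by simp

lemma N_diff: "N (x - y) \<le> N x + N y"
  using norm_triangle[of x "- y"] by (simp add: N_uminus)

lemma N_diff_commute: "N (x - y) = N (y - x)"
  using N_uminus[of "x - y"] by simp

lemma N_mult_left: "N (x * y) \<le> ennreal (norm x) * N y"
  using norm_mult_mult[of x y 1] by simp

lemma N_mult_right: "N (y * x) \<le> ennreal (norm x) * N y"
  using norm_mult_mult[of 1 y x] by (simp add: mult.commute)

lemma N_contraction_left: "norm x \<le> 1 \<Longrightarrow> N (x * y) \<le> N y"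
  using N_mult_left[of x y] mult_right_mono[of "ennreal (norm x)" 1 "N y"]
  by (simp add: order_trans)

lemma N_contraction_right: "norm x \<le> 1 \<Longrightarrow> N (y * x) \<le> N y"
  using N_mult_right[of y x] mult_right_mono[of "ennreal (norm x)" 1 "N y"]
  by (simp add: order_trans)

text \<open>Singular values come sorted whereas \<open>d\<close> is in arbitrary order; permutation
  invariance of \<phi> bridges the two.\<close>

lemma gauge_le_N_diagonal:
  fixes e :: "nat \<Rightarrow> 'h" and d :: "nat \<Rightarrow> real"
  assumes e: "orthonormal {..<n} e" and d: "\<And>j. j < n \<Longrightarrow> 0 \<le> d j"
  shows "ennreal (\<phi> (\<lambda>j. if j < n then d j else 0)) \<le> N (\<Sum>j<n. of_real (d j) *\<^sub>C rank_one (e j) (e j))"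
proof -
  obtain \<pi> where \<pi>: "\<pi> permutes {..<n}" and sorted: "\<And>i j. i \<le> j \<Longrightarrow> j < n \<Longrightarrow> d (\<pi> j) \<le> d (\<pi> i)"
    by (rule ex_sorting_permutation[of n d]) blast
  have \<pi>_less: "\<pi> j < n \<longleftrightarrow> j < n" for j using permutes_in_image[OF \<pi>, of j] by simp
  have e': "orthonormal {..<n} (\<lambda>j. e (\<pi> j))"
    using e permutes_inj[OF \<pi>] by (auto simp: orthonormal_def \<pi>_less inj_eq)
  define x where "x = (\<Sum>j<n. of_real (d (\<pi> j)) *\<^sub>C rank_one (e (\<pi> j)) (e (\<pi> j)))"
  have x: "compact_operator x" "singular_values x = (\<lambda>j. if j < n then d (\<pi> j) else 0)"
    unfolding x_def
    using compact_diagonal[OF e', of "\<lambda>j. d (\<pi> j)"] singular_values_diagonal[OF e', of "\<lambda>j. d (\<pi> j)"]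
      d sorted \<pi>_less by simp_all
  have "\<phi> (\<lambda>j. if j < n then d j else 0) = \<phi> (\<lambda>j. if \<pi> j < n then d (\<pi> j) else 0)"
    using permute[of "\<lambda>j. if j < n then d j else 0" \<pi>] permutes_bij[OF \<pi>] by simp
  also have "ennreal \<dots> \<le> N x"
    unfolding norm_compact[OF x(1)] x(2) by (rule SUP_upper2[of n]) (simp_all add: \<pi>_less cong: if_cong)
  also have "x = (\<Sum>j<n. of_real (d j) *\<^sub>C rank_one (e j) (e j))"
    unfolding x_def using \<pi> by (rule sum.permute[symmetric, unfolded comp_def])
  finally show ?thesis .
qed

text \<open>The pinched operator is the average of \<open>x\<close> and \<open>S * x * S\<close>
  with the reflection \<open>S = 1 - 2 *\<^sub>R p\<close>, and neither multiplication by
  \<open>S\<close> increases \<open>N\<close>.\<close>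

lemma N_pinching:
  assumes p: "norm (1 - 2 *\<^sub>R p) \<le> 1"
  shows "N (p * x * p + (1 - p) * x * (1 - p)) \<le> N x"
proof -
  define S where "S = 1 - 2 *\<^sub>R p"
  have "N (S * x * S) \<le> N x"
    using N_contraction_left[of S "x * S"] N_contraction_right[of S x] p
    by (simp add: S_def mult.assoc order_trans)
  then have "N (x + S * x * S) \<le> N x + N x"
    using norm_triangle[of x "S * x * S"] by (meson add_left_mono order_trans)
  then have "N ((1 / 2) *\<^sub>R (x + S * x * S)) \<le> ennreal (1 / 2) * (N x + N x)"
    by (simp add: N_scaleR mult_left_mono del: ennreal_half)
  also have "\<dots> = N x"
  proof -
    have "ennreal (1 / 2) * (N x + N x) = (ennreal (1 / 2) * ennreal 2) * N x"
      by (simp add: mult.assoc mult_2 del: ennreal_half)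
    also have "ennreal (1 / 2) * ennreal 2 = 1" by (subst ennreal_mult[symmetric]) simp_all
    finally show ?thesis by simp
  qed
  also have "x + S * x * S = 2 *\<^sub>R (p * x * p + (1 - p) * x * (1 - p))"
    by (simp add: S_def algebra_simps scaleR_2)
  finally show ?thesis by simp
qed

text \<open>The vectors \<open>e j\<close> are split off one at a time by pinching with
  \<open>p j\<close>; finally compressing with \<open>P n\<close> removes the remaining
  block.\<close>

lemma N_diagonal_le:
  fixes e :: "nat \<Rightarrow> 'h"
  assumes e: "orthonormal {..<n} e"
  shows "N (\<Sum>j<n. cinner (x \<cdot> e j) (e j) *\<^sub>C rank_one (e j) (e j)) \<le> N x"
proof -
  define p where "p j = rank_one (e j) (e j)" for j
  define P where "P m = (\<Sum>j<m. p j)" for m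
  \<comment> \<open>\<open>Y m\<close> has its first \<open>m\<close> diagonal entries detached and
    an untouched block on the complement: \<open>Y 0\<close> is \<open>x\<close>, and pinching with
    \<open>p m\<close> turns \<open>Y m\<close> into \<open>Y (Suc m)\<close>.\<close>
  define Y where "Y m = (\<Sum>j<m. p j * x * p j) + (1 - P m) * x * (1 - P m)" for m
  have pp: "p i * p j = (if i = j then p i else 0)" if "i < n" "j < n" for i j
    using e that by (intro operator_eqI)
      (auto simp: p_def orthonormalD scaleC_scaleC app.zero_left scaleC_one cinner_scaleC_left)
  have S: "norm (1 - 2 *\<^sub>R p m) \<le> 1" if "m < n" for m
  proof (rule norm_operator_le)
    fix v
    define c where "c = cinner v (e m)"
    have "Re (cinner v (2 *\<^sub>R c *\<^sub>C e m)) = 2 * (cmod c)\<^sup>2"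
      by (simp add: cinner.scaleR_right cinner_scaleC_right mult.commute cmod_power2 flip: c_def)
        (simp add: power2_eq_square)
    then have "(norm (v - 2 *\<^sub>R c *\<^sub>C e m))\<^sup>2 = (norm v)\<^sup>2"
      using orthonormal_norm[OF e, of m] that
      by (simp add: norm_diff_sq norm_scaleC power_mult_distrib)
    then show "norm ((1 - 2 *\<^sub>R p m) \<cdot> v) \<le> 1 * norm v"
      by (simp add: p_def app.diff_left app.scaleR_left c_def)
  qed simp
  have "m \<le> n \<Longrightarrow> N (Y m) \<le> N x" for m
  proof (induction m)
    case 0
    then show ?case by (simp add: Y_def P_def)
  next
    case (Suc m)
    have m: "m < n" using Suc by simp
    have pP: "p m * P m = 0" "P m * p m = 0"
      using m by (simp_all add: P_def sum_distrib_left sum_distrib_right pp)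
    have 1: "p m * (1 - P m) = p m" "(1 - P m) * p m = p m"
      by (simp_all add: algebra_simps pP)
    have 2: "(1 - p m) * (1 - P m) = 1 - P (Suc m)" "(1 - P m) * (1 - p m) = 1 - P (Suc m)"
      by (simp_all add: algebra_simps pP) (simp_all add: P_def)
    have 3: "p m * (p j * x * p j) * p m = 0" "(1 - p m) * (p j * x * p j) * (1 - p m) = p j * x * p j"
      if "j < m" for j
    proof -
      have "p m * p j = 0" "p j * p m = 0" using that m by (simp_all add: pp)
      then have "(1 - p m) * p j = p j" "p j * (1 - p m) = p j" by (simp_all add: algebra_simps)
      with \<open>p m * p j = 0\<close> show "p m * (p j * x * p j) * p m = 0"
        "(1 - p m) * (p j * x * p j) * (1 - p m) = p j * x * p j"
        by (metis mult.assoc mult_zero_left)+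
    qed
    have "p m * Y m * p m = (p m * (1 - P m)) * x * ((1 - P m) * p m)"
      using 3(1) by (simp add: Y_def distrib_left distrib_right sum_distrib_left sum_distrib_right mult.assoc)
    moreover have "(1 - p m) * Y m * (1 - p m) = (\<Sum>j<m. p j * x * p j)
        + ((1 - p m) * (1 - P m)) * x * ((1 - P m) * (1 - p m))"
    proof -
      have "(1 - p m) * (\<Sum>j<m. p j * x * p j) * (1 - p m) = (\<Sum>j<m. p j * x * p j)"
        using 3(2) by (simp only: sum_distrib_left sum_distrib_right) (intro sum.cong, auto)
      then show ?thesis
        unfolding Y_def by (simp only: distrib_left[of "1 - p m"] distrib_right[of _ _ "1 - p m"] mult.assoc)
    qed
    ultimately have "p m * Y m * p m + (1 - p m) * Y m * (1 - p m) = Y (Suc m)"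
      unfolding 1 2 by (simp add: Y_def)
    then show ?case
      using N_pinching[OF S[OF m], of "Y m"] Suc by simp
  qed
  from this[of n] have "N (Y n) \<le> N x" by simp
  have P_idem: "P n * P n = P n"
    by (simp add: P_def sum_distrib_left sum_distrib_right pp)
  have Pp: "P n * p j = p j" "p j * P n = p j" if "j < n" for j
    using that by (simp_all add: P_def sum_distrib_left sum_distrib_right pp)
  have "P n * (1 - P n) = 0" "(1 - P n) * P n = 0" by (simp_all add: algebra_simps P_idem)
  then have "P n * ((1 - P n) * x * (1 - P n)) * P n = 0" by (metis mult.assoc mult_zero_left)
  moreover have "P n * (\<Sum>j<n. p j * x * p j) * P n = (\<Sum>j<n. p j * x * p j)"
    unfolding sum_distrib_left sum_distrib_right
    using Pp by (intro sum.cong refl) (metis lessThan_iff mult.assoc)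
  ultimately have "P n * Y n * P n = (\<Sum>j<n. p j * x * p j)"
    by (simp only: Y_def distrib_left[of "P n"] distrib_right[of _ _ "P n"] add_0_right)
  also have "\<dots> = (\<Sum>j<n. cinner (x \<cdot> e j) (e j) *\<^sub>C p j)"
    by (intro sum.cong refl operator_eqI)
      (simp add: p_def scaleC_scaleC cinner_scaleC_left mult.commute)
  finally have "N (\<Sum>j<n. cinner (x \<cdot> e j) (e j) *\<^sub>C p j) = N (P n * Y n * P n)" by simp
  moreover have "norm (P n) \<le> 1"
  proof (rule norm_operator_le)
    fix v show "norm (P n \<cdot> v) \<le> 1 * norm v"
      using norm_orthonormal_combination_le[OF e orthonormal_contractive[OF e], of "\<lambda>_. 1" v]
      by (simp add: P_def p_def app.sum_left)
  qed simp
  then have "N (P n * Y n * P n) \<le> N (Y n)"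
    using N_contraction_left[of "P n" "Y n"] N_contraction_right[of "P n" "P n * Y n"] by simp
  ultimately show ?thesis using \<open>N (Y n) \<le> N x\<close> by (simp add: p_def)
qed

text \<open>Multiplying from the left by the contraction \<open>W\<close> turns the entries between
  \<open>e j\<close> and \<open>y j\<close> into diagonal entries of \<open>W * x\<close>, with the
  phases \<open>a j\<close> making them non-negative. Thus different vectors on the two sides are
  reduced to the diagonal case.\<close>

lemma gauge_le_N:
  fixes e y :: "nat \<Rightarrow> 'h"
  assumes e: "orthonormal {..<n} e" and y: "orthogonal_contractive {..<n} y"
  shows "ennreal (\<phi> (\<lambda>j. if j < n then cmod (cinner (x \<cdot> e j) (y j)) else 0)) \<le> N x"
proof -
  define a where "a j = cnj (sgn (cinner (x \<cdot> e j) (y j)))" for j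
  define W where "W = (\<Sum>j<n. a j *\<^sub>C rank_one (e j) (y j))"
  have W: "W \<cdot> v = (\<Sum>j<n. (a j * cinner v (y j)) *\<^sub>C e j)" for v
    by (simp add: W_def app.sum_left scaleC_scaleC)
  have "cmod (a j) \<le> 1" for j by (simp add: a_def norm_sgn)
  then have "norm (W \<cdot> v) \<le> 1 * norm v" for v
    using norm_orthonormal_combination_le[OF e y, of a v] by (simp add: W)
  then have "norm W \<le> 1" by (intro norm_operator_le) auto
  have d: "cinner ((W * x) \<cdot> e j) (e j) = of_real (cmod (cinner (x \<cdot> e j) (y j)))" if "j < n" for j
  proof -
    have "cinner ((W * x) \<cdot> e j) (e j) = (\<Sum>i<n. if i = j then a j * cinner (x \<cdot> e j) (y j) else 0)"
      using e that
      unfolding app_times W cinner.sum_left cinner_scaleC_left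
      by (intro sum.cong) (auto simp: orthonormalD)
    also have "\<dots> = a j * cinner (x \<cdot> e j) (y j)" using that by simp
    also have "\<dots> = of_real (cmod (cinner (x \<cdot> e j) (y j)))"
      unfolding a_def by (rule cnj_sgn_mult)
    finally show ?thesis .
  qed
  have "ennreal (\<phi> (\<lambda>j. if j < n then cmod (cinner (x \<cdot> e j) (y j)) else 0))
    \<le> N (\<Sum>j<n. of_real (cmod (cinner (x \<cdot> e j) (y j))) *\<^sub>C rank_one (e j) (e j))"
    using e by (rule gauge_le_N_diagonal) simp
  also have "\<dots> = N (\<Sum>j<n. cinner ((W * x) \<cdot> e j) (e j) *\<^sub>C rank_one (e j) (e j))"
    using d by (intro arg_cong[of _ _ N] sum.cong) auto
  also have "\<dots> \<le> N (W * x)" using e by (rule N_diagonal_le)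
  also have "\<dots> \<le> N x" using \<open>norm W \<le> 1\<close> by (rule N_contraction_left)
  finally show ?thesis .
qed

text \<open>The gauge of (1, 0, 0, ...), which is the constant in the comparison with the uniform
  norm because \<phi> is not normalised.\<close>

definition gauge_unit :: real where "gauge_unit = \<phi> (\<lambda>j. if j < 1 then 1 else 0)"

lemma gauge_unit_pos: "0 < gauge_unit"
  unfolding gauge_unit_def by (rule pos) (auto simp: fun_eq_iff)

lemma gauge_single: "0 \<le> a \<Longrightarrow> \<phi> (\<lambda>j. if j < 1 then a else 0) = a * gauge_unit"
  using scale[of "\<lambda>j. if j < 1 then 1 else 0" a] by (simp add: gauge_unit_def if_distrib cong: if_cong)

text \<open>The case n = 1 of \<open>gauge_le_N\<close>, tested on a normalised vector and its
  normalised image. It makes convergence in \<open>N\<close> imply uniform convergence.\<close>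

lemma norm_le_N: "ennreal (gauge_unit * norm x) \<le> N x"
proof (cases "N x = \<infinity>")
  case False
  define B where "B = enn2real (N x)"
  have B: "N x = ennreal B" "0 \<le> B" using False by (simp_all add: B_def less_top)
  have "norm x \<le> B / gauge_unit"
  proof (rule norm_operator_le)
    fix v
    show "norm (x \<cdot> v) \<le> B / gauge_unit * norm v"
    proof (cases "x \<cdot> v = 0")
      case False
      then have v: "v \<noteq> 0" by (auto simp: app.zero_right)
      define e where "e = (\<lambda>j::nat. (1 / norm v) *\<^sub>R v)"
      define y where "y = (\<lambda>j::nat. (1 / norm (x \<cdot> v)) *\<^sub>R (x \<cdot> v))"
      have "orthonormal {..<1} e" using v by (intro orthonormalI) (auto simp: e_def)
      moreover have "orthogonal_contractive {..<1} y"
        using False by (auto simp: orthogonal_contractive_def y_def)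
      ultimately have "ennreal (\<phi> (\<lambda>j. if j < 1 then cmod (cinner (x \<cdot> e j) (y j)) else 0)) \<le> N x"
        by (rule gauge_le_N)
      moreover have "cmod (cinner (x \<cdot> e j) (y j)) = norm (x \<cdot> v) / norm v" for j
        by (simp add: e_def y_def app.scaleR_right cinner.scaleR_left cinner.scaleR_right cinner_norm
            norm_mult power2_eq_square)
      ultimately have "norm (x \<cdot> v) / norm v * gauge_unit \<le> B"
        using gauge_single[of "norm (x \<cdot> v) / norm v"] B by (simp cong: if_cong)
      then show ?thesis using v gauge_unit_pos by (simp add: field_simps)
    qed (use B gauge_unit_pos in simp)
  qed (use B gauge_unit_pos in simp)
  then show ?thesis using B gauge_unit_pos by (simp add: field_simps)
qed simp

text \<open>Supplies a non-zero direction of finite norm, needed for short loops when the end points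
  coincide.\<close>

lemma N_rank_one_finite:
  assumes "norm (a::'h) = 1" shows "N (rank_one a a) < \<infinity>"
proof -
  define e where "e = (\<lambda>j::nat. a)"
  have e: "orthonormal {..<1} e" using assms by (intro orthonormalI) (auto simp: e_def)
  have eq: "(\<Sum>j<1. of_real 1 *\<^sub>C rank_one (e j) (e j)) = rank_one a a"
    by (simp add: e_def scaleC_one)
  have "compact_operator (rank_one a a)" "singular_values (rank_one a a) = (\<lambda>j. if j < 1 then 1 else 0)"
    using compact_diagonal[OF e, of "\<lambda>_. 1"] singular_values_diagonal[OF e, of "\<lambda>_. 1"]
    unfolding eq by (simp_all del: One_nat_def less_one)
  then have "N (rank_one a a) = (SUP n. ennreal (\<phi> (\<lambda>j. if j < n then if j < 1 then 1 else 0 else 0)))"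
    by (simp add: norm_compact del: One_nat_def less_one cong: if_cong)
  also have "\<dots> \<le> ennreal gauge_unit"
  proof (rule SUP_least)
    fix n :: nat
    have "(\<lambda>j::nat. if j < n then if j < 1 then 1 else 0 else 0)
        = (if n = 0 then (\<lambda>j. 0) else (\<lambda>j. if j < 1 then 1 else (0::real)))" by auto
    then show "ennreal (\<phi> (\<lambda>j. if j < n then if j < 1 then 1 else 0 else 0)) \<le> ennreal gauge_unit"
      using gauge_unit_pos by (simp add: gauge_zero gauge_unit_def)
  qed
  also have "\<dots> < \<infinity>" by simp
  finally show ?thesis .
qed

end

section \<open>Operators of finite norm are compact\<close>

lemma ex_orthonormal_covering:
  fixes f :: "nat \<Rightarrow> 'h::separable_hilbert_space"
  obtains e where "orthonormal {..<m} e"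
    and "\<And>v. \<forall>i<m. cinner v (e i) = 0 \<Longrightarrow> \<forall>i<m. cinner v (f i) = 0"
proof -
  have "\<exists>e. orthonormal {..<m} e \<and> (\<forall>v. (\<forall>i<m. cinner v (e i) = 0) \<longrightarrow> (\<forall>i<m. cinner v (f i) = 0))"
  proof (induction m)
    case 0
    then show ?case by (simp add: orthonormal_def)
  next
    case (Suc m)
    then obtain e where e: "orthonormal {..<m} e"
      and cov: "\<And>v. (\<forall>i<m. cinner v (e i) = 0) \<Longrightarrow> (\<forall>i<m. cinner v (f i) = 0)" by blast
    obtain x where x: "norm x = 1" "\<And>i. i \<in> {..<m} \<Longrightarrow> cinner x (e i) = 0"
      "\<And>v. cinner v x = 0 \<Longrightarrow> (\<And>i. i \<in> {..<m} \<Longrightarrow> cinner v (e i) = 0) \<Longrightarrow> cinner v (f m) = 0"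
      using ex_unit_orthogonal[OF finite_lessThan e, of "f m"] by blast
    define g where "g = e(m := x)"
    have "orthonormal {..<Suc m} g"
      using x e by (intro orthonormalI) (auto simp: g_def less_Suc_eq orthonormal_norm orthonormalD)
    moreover have "\<forall>i<Suc m. cinner v (f i) = 0" if "\<forall>i<Suc m. cinner v (g i) = 0" for v
      using that cov[of v] x(3)[of v] by (auto simp: g_def less_Suc_eq split: if_splits)
    ultimately show ?case by blast
  qed
  then show thesis using that by blast
qed

text \<open>Without compactness there are orthonormal \<open>e n\<close> whose images are orthogonal
  and have norms bounded away from 0. Then \<open>B\<close> sends a basis \<open>b\<close> to
  \<open>e\<close>, and \<open>A\<close> sends the images back to \<open>b\<close>; \<open>A\<close>
  is bounded by the lower bound \<open>d\<close>.\<close>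

lemma noncompact_factor_one:
  fixes x :: "'h::separable_hilbert_space operator"
  assumes "\<not> compact_operator x"
  obtains a b where "a * x * b = 1"
proof -
  obtain d where d: "d > 0" and big: "\<And>m e. orthonormal {..<m::nat} e \<Longrightarrow>
      \<exists>v. (\<forall>i<m. cinner v (e i) = 0) \<and> d * norm v < norm (x \<cdot> v)"
    using compact_operatorI[of x] assms by (meson not_le)
  \<comment> \<open>Orthogonality to \<open>(adj x * x) \<cdot> e i\<close> makes the image of
    \<open>v\<close> orthogonal to the image of \<open>e i\<close>.\<close>
  let ?P = "\<lambda>(e :: nat \<Rightarrow> 'h) n v. norm v = 1 \<and> d \<le> norm (x \<cdot> v) \<and>
    (\<forall>i<n. cinner v (e i) = 0 \<and> cinner v ((adj x * x) \<cdot> e i) = 0)"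
  have "\<exists>e. \<forall>n. ?P e n (e n)"
  proof (rule dependent_wellorder_choice)
    fix n and e :: "nat \<Rightarrow> 'h"
    \<comment> \<open>Both orthogonality conditions as one list of 2 n vectors, which may be
      dependent; hence they are replaced by an orthonormal family with no smaller span.\<close>
    define f where "f i = (if i < n then e i else (adj x * x) \<cdot> e (i - n))" for i
    obtain g where g: "orthonormal {..<n + n} g"
      "\<And>v. \<forall>i<n + n. cinner v (g i) = 0 \<Longrightarrow> \<forall>i<n + n. cinner v (f i) = 0"
      using ex_orthonormal_covering[of "n + n" f] by blast
    obtain v where v: "\<forall>i<n + n. cinner v (g i) = 0" "d * norm v < norm (x \<cdot> v)"
      using big[OF g(1)] by blast
    have "v \<noteq> 0" using v(2) by (auto simp: app.zero_right)
    have 1: "cinner v (f i) = 0" if "i < n + n" for i using g(2)[OF v(1)] that by blast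
    have 2: "cinner v (e i) = 0 \<and> cinner v ((adj x * x) \<cdot> e i) = 0" if "i < n" for i
      using 1[of i] 1[of "n + i"] that by (simp add: f_def)
    show "\<exists>v. ?P e n v"
    proof (intro exI[of _ "(1 / norm v) *\<^sub>R v"] conjI allI impI)
      show "norm ((1 / norm v) *\<^sub>R v) = 1" using \<open>v \<noteq> 0\<close> by simp
      show "d \<le> norm (x \<cdot> ((1 / norm v) *\<^sub>R v))"
        using v(2) \<open>v \<noteq> 0\<close> by (simp add: app.scaleR_right field_simps)
    qed (use 2 in \<open>simp_all add: cinner.scaleR_left\<close>)
  next
    fix v n and f g :: "nat \<Rightarrow> 'h"
    assume "\<And>y. y < n \<Longrightarrow> f y = g y"
    then show "?P f n v = ?P g n v" by simp
  qed
  then obtain e where "\<And>n. ?P e n (e n)" by blast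
  then have e: "\<And>n. norm (e n) = 1" "\<And>n. d \<le> norm (x \<cdot> e n)"
    "\<And>n i. i < n \<Longrightarrow> cinner (e n) (e i) = 0" "\<And>n i. i < n \<Longrightarrow> cinner (e n) ((adj x * x) \<cdot> e i) = 0"
    by simp_all
  have e_on: "orthonormal UNIV e" using e by (intro orthonormalI) auto
  define s where "s n = norm (x \<cdot> e n)" for n
  have s: "s n > 0" "d \<le> s n" for n using e(2)[of n] d by (auto simp: s_def)
  define f where "f n = (1 / s n) *\<^sub>R (x \<cdot> e n)" for n
  have f: "orthonormal UNIV f"
  proof (rule orthonormalI)
    show "norm (f i) = 1" for i using s[of i] by (simp add: f_def s_def)
    show "cinner (f j) (f i) = 0" if "i < j" for i j
      using e(4)[OF that]
      by (simp add: f_def cinner.scaleR_left cinner.scaleR_right adj_right)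
  qed
  obtain b :: "nat \<Rightarrow> 'h" where b: "orthonormal UNIV b"
    and total: "\<And>v. (\<And>i. cinner v (b i) = 0) \<Longrightarrow> v = 0" using ex_orthonormal_basis by blast
  obtain B where B: "\<And>i. B \<cdot> b i = e i"
    using ex_Fourier_operator[OF b, of e 1] e_on by (metis orthonormalD UNIV_I e(1) order_refl zero_le_one)
  have bnd: "norm ((1 / s i) *\<^sub>R b i) \<le> 1 / d" for i
    using s[of i] d b by (simp add: orthonormal_norm frac_le)
  have ort: "cinner ((1 / s i) *\<^sub>R b i) ((1 / s j) *\<^sub>R b j) = 0" if "i \<noteq> j" for i j
    using b that by (simp add: cinner.scaleR_left cinner.scaleR_right orthonormalD)
  obtain A where A: "\<And>i. A \<cdot> f i = (1 / s i) *\<^sub>R b i"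
  proof (rule ex_Fourier_operator[of f "\<lambda>i. (1 / s i) *\<^sub>R b i"])
    fix A assume "\<And>i. A \<cdot> f i = (1 / s i) *\<^sub>R b i"
    then show thesis by (rule that)
  qed (use f ort bnd d in auto)
  have eq: "(A * x * B) \<cdot> b i = b i" for i
  proof -
    have "x \<cdot> e i = s i *\<^sub>R f i" using s[of i] by (simp add: f_def)
    then show ?thesis using s[of i] by (simp add: B A app.scaleR_right)
  qed
  have "A * x * B = 1"
  proof (rule operator_eqI)
    fix v
    have "adj (A * x * B - 1) \<cdot> w = 0" for w
      by (rule total) (simp only: adj_left app.diff_left eq app_one diff_self cinner.zero_right)
    then have "adj (adj (A * x * B - 1)) = adj 0"
      by (metis operator_eqI app.zero_left)
    then show "(A * x * B) \<cdot> v = 1 \<cdot> v" by simp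
  qed
  then show thesis by (rule that)
qed

lemma (in symmetric_norm) norm_ideal_compact:
  assumes "\<not> equivalent_to_uniform_norm N" and "x \<in> norm_ideal N"
  shows "compact_operator x"
proof (rule ccontr)
  assume "\<not> compact_operator x"
  then obtain a b where ab: "a * x * b = 1" by (rule noncompact_factor_one)
  have "N 1 \<le> ennreal (norm a) * N x * ennreal (norm b)"
    using norm_mult_mult[of a x b] ab by simp
  also have "\<dots> < \<infinity>"
    using assms(2) by (simp add: norm_ideal_def ennreal_mult_less_top)
  finally have fin: "N 1 < \<infinity>" .
  define C where "C = enn2real (N 1) + 1"
  have C: "N 1 \<le> ennreal C" "0 < C"
    using fin enn2real_nonneg[of "N 1"] by (auto simp: C_def ennreal_plus intro: add_increasing2 add_nonneg_pos)
  have "N y \<le> ennreal (C * norm y)" for y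
  proof -
    have "N y \<le> ennreal (norm y) * N 1" using N_mult_left[of y 1] by simp
    also have "\<dots> \<le> ennreal (norm y) * ennreal C" using C by (intro mult_left_mono) auto
    finally show ?thesis using C by (simp add: ennreal_mult mult.commute)
  qed
  then have "equivalent_to_uniform_norm N"
    unfolding equivalent_to_uniform_norm_def using norm_le_N gauge_unit_pos C(2) by blast
  with assms(1) show False by simp
qed

section \<open>Supporting functionals of a gauge\<close>

definition sublinear :: "((nat \<Rightarrow> real) \<Rightarrow> real) \<Rightarrow> bool"
  where "sublinear q \<longleftrightarrow> (\<forall>x y. q (\<lambda>j. x j + y j) \<le> q x + q y) \<and> (\<forall>t x. 0 \<le> t \<longrightarrow> q (\<lambda>j. t * x j) = t * q x)"

text \<open>
  The infimum over \<open>t \<ge> 0\<close> of \<open>q (x + t w) - t q w\<close> is the largest sublinear minorant of \<open>q\<close>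
  that is linear along \<open>w\<close> and agrees with \<open>q\<close> at \<open>w\<close>.  Iterating over a basis gives the Hahn-Banach theorem in finite
  dimension.
\<close>

lemma sublinear_minorant:
  fixes w :: "nat \<Rightarrow> real"
  assumes q: "sublinear q"
  obtains q' where "sublinear q'" and "\<And>x. q' x \<le> q x" and "q' (\<lambda>j. - w j) \<le> - q w"
proof -
  have add: "q (\<lambda>j. x j + y j) \<le> q x + q y" for x y using q by (simp add: sublinear_def)
  have hom: "q (\<lambda>j. t * x j) = t * q x" if "0 \<le> t" for t x using q that by (simp add: sublinear_def)
  have q0: "q (\<lambda>j. 0) = 0" using hom[of 0 "\<lambda>j. 0"] by simp
  define f where "f x t = q (\<lambda>j. x j + t * w j) - t * q w" for x t
  define q' where "q' x = (INF t\<in>{0..}. f x t)" for x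
  \<comment> \<open>By subadditivity the values have a lower bound that does not depend on
    \<open>t\<close>, so the infimum over the reals is a genuine one.\<close>
  have lower: "- q (\<lambda>j. - x j) \<le> f x t" if "0 \<le> t" for x t
    using add[of "\<lambda>j. x j + t * w j" "\<lambda>j. - x j"] hom[OF that, of w] by (simp add: f_def)
  then have bdd: "bdd_below (f x ` {0..})" for x by (intro bdd_belowI2) auto
  have le_f: "q' x \<le> f x t" if "0 \<le> t" for x t
    unfolding q'_def using bdd that by (intro cINF_lower) auto
  have ge: "c \<le> q' x" if "\<And>t. 0 \<le> t \<Longrightarrow> c \<le> f x t" for c x
    unfolding q'_def using that by (intro cINF_greatest) auto
  have hom_le: "t * q' x \<le> q' (\<lambda>j. t * x j)" if t: "0 < t" for t x
  proof (rule ge)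
    fix s :: real assume s: "0 \<le> s"
    have "f (\<lambda>j. t * x j) s = t * f x (s / t)"
      using hom[of t "\<lambda>j. x j + s / t * w j"] t by (simp add: f_def distrib_left right_diff_distrib)
    then show "t * q' x \<le> f (\<lambda>j. t * x j) s"
      using le_f[of "s / t" x] s t by simp
  qed
  have "sublinear q'"
    unfolding sublinear_def
  proof (intro conjI allI impI)
    fix x y
    have "q' (\<lambda>j. x j + y j) \<le> f x t + f y s" if "0 \<le> t" "0 \<le> s" for t s
      using le_f[of "t + s" "\<lambda>j. x j + y j"] that add[of "\<lambda>j. x j + t * w j" "\<lambda>j. y j + s * w j"]
      by (simp add: f_def algebra_simps)
    then have "q' (\<lambda>j. x j + y j) - f x t \<le> q' y" if "0 \<le> t" for t
      using that by (intro ge) (auto simp: diff_le_eq add.commute)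
    then have "q' (\<lambda>j. x j + y j) - q' y \<le> q' x"
      by (intro ge) (auto simp: diff_le_eq add.commute)
    then show "q' (\<lambda>j. x j + y j) \<le> q' x + q' y" by simp
  next
    fix t :: real and x assume "0 \<le> t"
    show "q' (\<lambda>j. t * x j) = t * q' x"
    proof (cases "t = 0")
      case True
      have "f (\<lambda>j. 0) s = 0" if "0 \<le> s" for s using hom[OF that, of w] by (simp add: f_def)
      then have "q' (\<lambda>j. 0) = 0" using le_f[of 0 "\<lambda>j. 0"] ge[of 0 "\<lambda>j. 0"] by fastforce
      then show ?thesis using True by simp
    next
      case False
      then have t: "0 < t" using \<open>0 \<le> t\<close> by simp
      have "1 / t * q' (\<lambda>j. t * x j) \<le> q' (\<lambda>j. 1 / t * (t * x j))" using t by (intro hom_le) simp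
      then have "q' (\<lambda>j. t * x j) \<le> t * q' x" using t by (simp add: field_simps)
      then show ?thesis using hom_le[OF t, of x] by simp
    qed
  qed
  moreover have "q' x \<le> q x" for x using le_f[of 0 x] by (simp add: f_def)
  moreover have "q' (\<lambda>j. - w j) \<le> - q w" using le_f[of 1 "\<lambda>j. - w j"] by (simp add: f_def q0)
  ultimately show thesis by (rule that)
qed

text \<open>Linearity along a direction survives the passage to a smaller sublinear p': p'(-w) \<le>
  p(-w) \<le> -p(w) \<le> -p'(w).\<close>

lemma sublinear_minorant_list:
  fixes w :: "nat \<Rightarrow> nat \<Rightarrow> real"
  assumes q: "sublinear q"
  shows "\<exists>q'. sublinear q' \<and> (\<forall>x. q' x \<le> q x) \<and> (\<forall>k<m. q' (\<lambda>j. - w k j) \<le> - q' (w k))"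
proof (induction m)
  case 0
  then show ?case using q by auto
next
  case (Suc m)
  then obtain p where p: "sublinear p" "\<And>x. p x \<le> q x" "\<And>k. k < m \<Longrightarrow> p (\<lambda>j. - w k j) \<le> - p (w k)"
    by blast
  obtain p' where p': "sublinear p'" "\<And>x. p' x \<le> p x" "p' (\<lambda>j. - w m j) \<le> - p (w m)"
    using sublinear_minorant[OF p(1)] by metis
  have "p' (\<lambda>j. - w k j) \<le> - p' (w k)" if "k < Suc m" for k
    using that p(3)[of k] p'(2)[of "\<lambda>j. - w k j"] p'(2)[of "w k"] p'(3) by (cases "k = m") auto
  then show ?case using p' p(2) order_trans by blast
qed

text \<open>The direction \<open>a\<close> is treated first, which pins the value at
  \<open>a\<close> to \<open>q a\<close>; treating the unit vectors afterwards only lowers the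
  functional and makes it linear on the first \<open>n\<close> coordinates.\<close>

lemma sublinear_supporting_functional:
  assumes q: "sublinear q" and trunc: "\<And>b. q (\<lambda>j. if j < n then b j else 0) = q b"
  obtains c :: "nat \<Rightarrow> real" where "\<And>b. (\<Sum>j<n. c j * b j) \<le> q b" and "q a \<le> (\<Sum>j<n. c j * a j)"
proof -
  obtain q1 where q1: "sublinear q1" "\<And>x. q1 x \<le> q x" "q1 (\<lambda>j. - a j) \<le> - q a"
    using sublinear_minorant[OF q, of a] by blast
  define u where "u k = (\<lambda>j. if j = k then 1 else 0 :: real)" for k :: nat
  obtain p where p: "sublinear p" "\<And>x. p x \<le> q1 x" "\<And>k. k < n \<Longrightarrow> p (\<lambda>j. - u k j) \<le> - p (u k)"
    using sublinear_minorant_list[OF q1(1), of n u] by blast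
  have add: "p (\<lambda>j. x j + y j) \<le> p x + p y" for x y using p(1) by (simp add: sublinear_def)
  have hom: "p (\<lambda>j. t * x j) = t * p x" if "0 \<le> t" for t x using p(1) that by (simp add: sublinear_def)
  have p0: "p (\<lambda>j. 0) = 0" using hom[of 0 "\<lambda>j. 0"] by simp
  define c where "c k = p (u k)" for k
  have single: "p (\<lambda>j. t * u k j) \<le> c k * t" if "k < n" for t k
  proof (cases "0 \<le> t")
    case True
    then show ?thesis using hom[of t "u k"] by (simp add: c_def mult.commute)
  next
    case False
    then have "p (\<lambda>j. t * u k j) = - t * p (\<lambda>j. - u k j)" using hom[of "- t" "\<lambda>j. - u k j"] by simp
    also have "\<dots> \<le> - t * - p (u k)" using False p(3)[OF that] by (intro mult_left_mono) auto
    finally show ?thesis by (simp add: c_def mult.commute)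
  qed
  have "m \<le> n \<Longrightarrow> p (\<lambda>j. if j < m then b j else 0) \<le> (\<Sum>j<m. c j * b j)" for m b
  proof (induction m)
    case (Suc m)
    have "(\<lambda>j. if j < Suc m then b j else 0) = (\<lambda>j. (if j < m then b j else 0) + b m * u m j)"
      by (auto simp: u_def less_Suc_eq)
    then show ?case using Suc single[of m "b m"] add[of "\<lambda>j. if j < m then b j else 0" "\<lambda>j. b m * u m j"]
      by simp
  qed (simp add: p0)
  then have upper: "p (\<lambda>j. if j < n then b j else 0) \<le> (\<Sum>j<n. c j * b j)" for b by simp
  have lower: "(\<Sum>j<n. c j * b j) \<le> p (\<lambda>j. if j < n then b j else 0)" for b
  proof -
    have "(\<lambda>j. (if j < n then b j else 0) + (if j < n then - b j else 0)) = (\<lambda>j. 0)" by auto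
    then show ?thesis
      using add[of "\<lambda>j. if j < n then b j else 0" "\<lambda>j. if j < n then - b j else 0"] upper[of "\<lambda>j. - b j"] p0
      by (simp add: sum_negf)
  qed
  show thesis
  proof (rule that[of c])
    fix b
    show "(\<Sum>j<n. c j * b j) \<le> q b"
      using lower[of b] p(2) q1(2) trunc[of b] by (metis order_trans)
  next
    have "- (\<Sum>j<n. c j * a j) \<le> p (\<lambda>j. if j < n then - a j else 0)"
      using lower[of "\<lambda>j. - a j"] by (simp add: sum_negf)
    also have "p (\<lambda>j. if j < n then - a j else 0) = p (\<lambda>j. - a j + (if j < n then 0 else a j))"
      by (rule arg_cong[of _ _ p]) auto
    also have "\<dots> \<le> p (\<lambda>j. - a j) + p (\<lambda>j. if j < n then 0 else a j)" by (rule add)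
    \<comment> \<open>The minorant \<open>p\<close> might see coordinates beyond \<open>n\<close>,
      but it lies below \<open>q\<close>, which ignores them, so the tail contributes at most
      0.\<close>
    also have "p (\<lambda>j. if j < n then 0 else a j) \<le> q (\<lambda>j. if j < n then 0 else a j)"
      using p(2) q1(2) order_trans by blast
    also have "q (\<lambda>j. if j < n then 0 else a j) = q (\<lambda>j. 0)"
      using trunc[of "\<lambda>j. if j < n then 0 else a j"] by (simp cong: if_cong)
    also have "\<dots> = 0" using q by (auto simp: sublinear_def dest: spec[of _ 0])
    finally show "q a \<le> (\<Sum>j<n. c j * a j)" using p(2)[of "\<lambda>j. - a j"] q1(3) by simp
  qed
qed

text \<open>Abel summation: the induction subtracts the smallest weight \<open>c n\<close> from all
  weights, which leaves decreasing non-negative weights on one term fewer and a multiple of a full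
  partial sum.\<close>

lemma sum_weights_mono:
  fixes c x y :: "nat \<Rightarrow> real"
  assumes "\<And>j. j < n \<Longrightarrow> 0 \<le> c j" and "\<And>i j. i \<le> j \<Longrightarrow> j < n \<Longrightarrow> c j \<le> c i"
    and "\<And>m. m \<le> n \<Longrightarrow> (\<Sum>j<m. x j) \<le> (\<Sum>j<m. y j)"
  shows "(\<Sum>j<n. c j * x j) \<le> (\<Sum>j<n. c j * y j)"
  using assms
proof (induction n arbitrary: c)
  case (Suc n)
  have *: "(\<Sum>j<Suc n. c j * z j) = (\<Sum>j<n. (c j - c n) * z j) + c n * (\<Sum>j<Suc n. z j)" for z
    by (simp add: left_diff_distrib sum_subtractf sum_distrib_left distrib_left)
  have "(\<Sum>j<n. (c j - c n) * x j) \<le> (\<Sum>j<n. (c j - c n) * y j)"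
    using Suc.prems by (intro Suc.IH) auto
  moreover have "c n * (\<Sum>j<Suc n. x j) \<le> c n * (\<Sum>j<Suc n. y j)"
    using Suc.prems(1)[of n] Suc.prems(3)[of "Suc n"] by (intro mult_left_mono) auto
  ultimately show ?case unfolding * by linarith
qed simp

text \<open>The decreasing non-negative vectors in the unit ball of the gauge dual to
  \<phi>.\<close>

definition (in symmetric_gauge) dual_weights :: "nat \<Rightarrow> (nat \<Rightarrow> real) \<Rightarrow> bool"
  where "dual_weights n c \<longleftrightarrow> (\<forall>j<n. 0 \<le> c j) \<and> (\<forall>j<n. \<forall>i\<le>j. c j \<le> c i) \<and>
    (\<forall>b. (\<Sum>j<n. c j * b j) \<le> \<phi> (\<lambda>j. if j < n then b j else 0))"

text \<open>A supporting functional at \<open>a\<close> is made non-negative by sign changes and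
  decreasing by a permutation. Both leave \<phi> invariant, so the result stays in the dual unit
  ball; and neither lowers the value at \<open>a\<close>, because \<open>a\<close> is non-negative
  and decreasing.\<close>

lemma (in symmetric_gauge) ex_dual_weights:
  assumes a: "decseq a" "\<And>j. 0 \<le> a j"
  obtains c where "dual_weights n c"
    and "\<phi> (\<lambda>j. if j < n then a j else 0) \<le> (\<Sum>j<n. c j * a j)"
proof -
  define q where "q b = \<phi> (\<lambda>j. if j < n then b j else 0)" for b
  have fin: "finite {j. (if j < n then b j else 0) \<noteq> (0::real)}" for b
    by (rule finite_subset[of _ "{..<n}"]) auto
  have "sublinear q"
    unfolding sublinear_def
  proof (intro conjI allI impI)
    fix x y :: "nat \<Rightarrow> real"
    have "(\<lambda>j. if j < n then x j + y j else 0)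
        = (\<lambda>j. (if j < n then x j else 0) + (if j < n then y j else 0))" by auto
    then show "q (\<lambda>j. x j + y j) \<le> q x + q y"
      using triangle[OF fin[of x] fin[of y]] by (simp add: q_def)
  next
    fix t :: real and x :: "nat \<Rightarrow> real" assume "0 \<le> t"
    have "(\<lambda>j. if j < n then t * x j else 0) = (\<lambda>j. t * (if j < n then x j else 0))" by auto
    then show "q (\<lambda>j. t * x j) = t * q x"
      using scale[OF fin[of x], of t] \<open>0 \<le> t\<close> by (simp add: q_def)
  qed
  moreover have "q (\<lambda>j. if j < n then b j else 0) = q b" for b by (simp add: q_def cong: if_cong)
  ultimately obtain c0 where c0: "\<And>b. (\<Sum>j<n. c0 j * b j) \<le> q b" "q a \<le> (\<Sum>j<n. c0 j * a j)"
    using sublinear_supporting_functional[of q n a] by blast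
  define c1 where "c1 j = \<bar>c0 j\<bar>" for j
  have c1: "(\<Sum>j<n. c1 j * b j) \<le> q b" for b
  proof -
    define b' where "b' j = (if c0 j < 0 then - b j else b j)" for j
    have "(\<Sum>j<n. c1 j * b j) = (\<Sum>j<n. c0 j * b' j)"
      by (intro sum.cong) (auto simp: c1_def b'_def)
    also have "\<dots> \<le> q b'" by (rule c0)
    also have "q b' = \<phi> (\<lambda>j. \<bar>if j < n then b' j else 0\<bar>)" using abs[OF fin[of b']] by (simp add: q_def)
    also have "(\<lambda>j. \<bar>if j < n then b' j else 0\<bar>) = (\<lambda>j. \<bar>if j < n then b j else 0\<bar>)"
      by (auto simp: b'_def)
    also have "\<phi> \<dots> = q b" using abs[OF fin[of b]] by (simp add: q_def)
    finally show ?thesis .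
  qed
  have c1a: "q a \<le> (\<Sum>j<n. c1 j * a j)"
    using a(2) by (intro order_trans[OF c0(2)] sum_mono mult_right_mono) (auto simp: c1_def)
  obtain \<pi> where \<pi>: "\<pi> permutes {..<n}" and sorted: "\<And>i j. i \<le> j \<Longrightarrow> j < n \<Longrightarrow> c1 (\<pi> j) \<le> c1 (\<pi> i)"
    by (rule ex_sorting_permutation[of n c1]) blast
  have \<pi>_less: "\<pi> j < n \<longleftrightarrow> j < n" for j using permutes_in_image[OF \<pi>, of j] by simp
  have inv_less: "inv \<pi> j < n \<longleftrightarrow> j < n" for j
    using permutes_in_image[OF permutes_inv[OF \<pi>], of j] by simp
  have support: "(\<Sum>j<n. c1 (\<pi> j) * b j) \<le> \<phi> (\<lambda>j. if j < n then b j else 0)" for b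
  proof -
    have "(\<Sum>j<n. c1 (\<pi> j) * b j) = (\<Sum>j<n. c1 j * b (inv \<pi> j))"
      using sum.permute[OF \<pi>, of "\<lambda>j. c1 j * b (inv \<pi> j)"] permutes_inverses(2)[OF \<pi>] by (simp add: o_def)
    also have "\<dots> \<le> q (\<lambda>j. b (inv \<pi> j))" by (rule c1)
    also have "\<dots> = \<phi> (\<lambda>j. if inv \<pi> j < n then b (inv \<pi> j) else 0)" by (simp add: q_def inv_less)
    also have "\<dots> = q b"
      using permute[OF fin[of b], of "inv \<pi>"] permutes_bij[OF permutes_inv[OF \<pi>]] by (simp add: q_def)
    finally show ?thesis by (simp add: q_def)
  qed
  show thesis
  proof (rule that[of "\<lambda>j. c1 (\<pi> j)"])
    show "dual_weights n (\<lambda>j. c1 (\<pi> j))"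
      using sorted support by (auto simp: dual_weights_def c1_def)
    have "(\<Sum>j<n. c1 j * a j) = (\<Sum>j<n. c1 (\<pi> j) * a (\<pi> j))"
      using sum.permute[OF \<pi>, of "\<lambda>j. c1 j * a j"] by (simp add: o_def)
    also have "\<dots> \<le> (\<Sum>j<n. c1 (\<pi> j) * a j)"
    proof (rule sum_weights_mono)
      fix m assume "m \<le> n"
      \<comment> \<open>Rearrangement inequality: subtracting the threshold \<open>a m\<close> makes
        terms with index below \<open>m\<close> non-negative and all others at most 0, so the first
        \<open>m\<close> indices are the best choice of \<open>m\<close> indices.\<close>
      define S where "S = \<pi> ` {..<m}"
      have inj: "inj_on \<pi> {..<m}" using permutes_inj[OF \<pi>] by (rule inj_on_subset) simp
      then have S: "finite S" "card S = m" by (simp_all add: S_def card_image)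
      have "(\<Sum>j<m. a (\<pi> j)) - m * a m = (\<Sum>i\<in>S. a i - a m)"
        using S inj by (simp add: S_def sum.reindex sum_subtractf)
      also have "\<dots> \<le> (\<Sum>i\<in>S. if i < m then a i - a m else 0)"
        using a(1) by (intro sum_mono) (auto simp: decseq_def)
      also have "\<dots> = (\<Sum>i\<in>S \<inter> {..<m}. a i - a m)"
        using S(1) by (subst sum.inter_restrict) auto
      also have "\<dots> \<le> (\<Sum>i<m. a i - a m)"
        using a(1) by (intro sum_mono2) (auto simp: decseq_def)
      finally show "(\<Sum>j<m. a (\<pi> j)) \<le> (\<Sum>j<m. a j)" by (simp add: sum_subtractf)
    qed (use sorted in \<open>auto simp: c1_def\<close>)
    finally show "\<phi> (\<lambda>j. if j < n then a j else 0) \<le> (\<Sum>j<n. c1 (\<pi> j) * a j)"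
      using c1a by (simp add: q_def)
  qed
qed

section \<open>Perturbation of singular values\<close>

lemma summable_mult_decseq:
  fixes p g :: "nat \<Rightarrow> real"
  assumes "\<And>i. 0 \<le> p i" "summable p" "decseq g" "\<And>i. 0 \<le> g i"
  shows "summable (\<lambda>i. p i * g i)"
proof (rule summable_comparison_test'[of "\<lambda>i. p i * g 0" 0])
  show "norm (p i * g i) \<le> p i * g 0" for i
    using assms decseqD[OF assms(3), of 0 i] by (simp add: mult_left_mono)
qed (use assms(2) in \<open>rule summable_mult2\<close>)

text \<open>The column masses \<open>q i\<close> lie in [0,1] and add up to at most
  \<open>m\<close>. Against a decreasing \<open>g\<close> the best placement of such mass is on the
  first \<open>m\<close> indices.\<close>

lemma substochastic_sum_le:
  fixes p :: "nat \<Rightarrow> nat \<Rightarrow> real"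
  assumes p: "\<And>j i. 0 \<le> p j i" and row: "\<And>j. j < m \<Longrightarrow> summable (p j) \<and> suminf (p j) \<le> 1"
    and col: "\<And>i. (\<Sum>j<m. p j i) \<le> 1" and g: "decseq g" "\<And>i. 0 \<le> g i"
  shows "(\<Sum>j<m. \<Sum>i. p j i * g i) \<le> (\<Sum>j<m. g j)"
proof -
  have s: "summable (\<lambda>i. p j i * g i)" if "j < m" for j
    using p row[OF that] g by (intro summable_mult_decseq) auto
  define q where "q i = (\<Sum>j<m. p j i)" for i
  have q: "0 \<le> q i" "q i \<le> 1" for i using p col by (auto simp: q_def sum_nonneg)
  have qs: "summable q" unfolding q_def using row by (intro summable_sum) auto
  have "suminf q = (\<Sum>j<m. suminf (p j))" unfolding q_def using row by (intro suminf_sum) auto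
  also have "\<dots> \<le> (\<Sum>j<m. 1)" using row by (intro sum_mono) auto
  finally have qm: "suminf q \<le> m" by simp
  \<comment> \<open>The excess of \<open>g\<close> over the level \<open>g m\<close>. Below
    \<open>m\<close> it is weighted by at most 1, and the level itself is weighted by the total
    mass.\<close>
  define r where "r i = (if i < m then g i - g m else 0)" for i
  have r: "r sums (\<Sum>i<m. g i - g m)"
  proof -
    have "r sums (\<Sum>i<m. r i)" by (rule sums_finite) (auto simp: r_def)
    then show ?thesis by (simp add: r_def)
  qed
  have "(\<Sum>j<m. \<Sum>i. p j i * g i) = (\<Sum>i. \<Sum>j<m. p j i * g i)"
    using s by (intro suminf_sum[symmetric]) auto
  also have "\<dots> = (\<Sum>i. q i * g i)" by (simp add: q_def sum_distrib_right)
  also have "\<dots> \<le> (\<Sum>i. q i * g m + r i)"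
  proof (rule suminf_le)
    show "q i * g i \<le> q i * g m + r i" for i
    proof (cases "i < m")
      case True
      then have "q i * (g i - g m) \<le> 1 * (g i - g m)"
        using q g(1) by (intro mult_right_mono) (auto simp: decseq_def)
      then show ?thesis using True by (simp add: r_def algebra_simps)
    next
      case False
      then show ?thesis using q g(1) by (simp add: r_def decseq_def mult_left_mono)
    qed
    show "summable (\<lambda>i. q i * g i)"
      unfolding q_def sum_distrib_right using s by (intro summable_sum) auto
    show "summable (\<lambda>i. q i * g m + r i)"
      using qs r by (intro summable_add summable_mult2) (auto simp: sums_iff)
  qed
  also have "\<dots> = suminf q * g m + (\<Sum>i<m. g i - g m)"
    using qs r by (subst suminf_add[symmetric]) (auto simp: sums_iff suminf_mult2 intro: summable_mult2)
  also have "\<dots> \<le> m * g m + (\<Sum>i<m. g i - g m)"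
    using qm g(2)[of m] by (intro add_right_mono mult_right_mono) auto
  finally show ?thesis by (simp add: sum_subtractf)
qed

text \<open>
  To first order the functional \<open>\<Sum> c\<^sub>j H(s\<^sub>j\<^sup>2)\<close> changes like \<open>\<parallel>a e\<^sub>j\<parallel>\<^sup>2\<close> along the singular vectors of
  one end point: expand \<open>e\<^sub>j\<close> in the singular vectors of the other end point and use that \<open>H\<close> lies
  above its tangent parabolas.
\<close>

lemma singular_functional_step:
  fixes a a' :: "'h::separable_hilbert_space operator"
  assumes a: "singular_system a e s" and a': "singular_system a' b s'"
    and c: "\<And>j. j < n \<Longrightarrow> 0 \<le> c j" "\<And>i j. i \<le> j \<Longrightarrow> j < n \<Longrightarrow> c j \<le> c i"
    and R: "\<And>j. (s j)\<^sup>2 \<le> R" "\<And>j. (s' j)\<^sup>2 \<le> R"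
    and H: "H 0 = 0" "mono_on {0..R} H" and C: "0 \<le> C"
    and tangent: "\<And>x y. x \<in> {0..R} \<Longrightarrow> y \<in> {0..R} \<Longrightarrow> H x + h x * (y - x) - C * (y - x)\<^sup>2 \<le> H y"
  shows "(\<Sum>j<n. c j * H ((s j)\<^sup>2)) \<le> (\<Sum>j<n. c j * H ((s' j)\<^sup>2))
    + (\<Sum>j<n. c j * (h ((s j)\<^sup>2) * ((norm (a \<cdot> e j))\<^sup>2 - (norm (a' \<cdot> e j))\<^sup>2)))
    + (\<Sum>j<n. c j) * (C * (norm (adj a * a - adj a' * a'))\<^sup>2)"
proof -
  define K where "K = adj a * a"
  define K' where "K' = adj a' * a'"
  \<comment> \<open>Squared overlaps of the two orthonormal families. Bessel in each family gives
    row and column sums at most 1; equality may fail because the families can miss parts of the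
    kernels.\<close>
  define p where "p j i = (cmod (cinner (e j) (b i)))\<^sup>2" for j i
  have p_pos: "0 \<le> p j i" for j i by (simp add: p_def)
  define \<kappa> where "\<kappa> j = (s j)\<^sup>2" for j
  define \<kappa>' where "\<kappa>' j = (s' j)\<^sup>2" for j
  define g where "g i = H (\<kappa>' i)" for i
  have e: "orthonormal UNIV e" and b: "orthonormal UNIV b" using a a' by (auto simp: singular_system_def)
  have \<kappa>: "\<kappa> j \<in> {0..R}" "\<kappa>' j \<in> {0..R}" for j using R by (auto simp: \<kappa>_def \<kappa>'_def)
  have R0: "0 \<in> {0..R}" using \<kappa>(1)[of 0] by auto
  have g_dec: "decseq g"
    unfolding g_def decseq_def
  proof (intro allI impI)
    fix i j :: nat assume "i \<le> j"
    then have "\<kappa>' j \<le> \<kappa>' i"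
      using a' by (auto simp: \<kappa>'_def singular_system_def decseq_def intro!: power_mono)
    then show "H (\<kappa>' j) \<le> H (\<kappa>' i)" using H(2) \<kappa> by (auto simp: mono_on_def)
  qed
  have g_pos: "0 \<le> g i" for i using mono_onD[OF H(2) R0 \<kappa>(2)[of i]] H(1) \<kappa>(2)[of i] by (simp add: g_def)
  have Bessel_row: "(\<Sum>i<k. p j i) \<le> 1" for j k
    using Bessel[of "{..<k}" b "e j"] orthonormal_contractive[OF orthonormal_subset[OF b subset_UNIV]]
      orthonormal_norm[OF e, of j] by (simp add: p_def)
  have row: "summable (p j) \<and> suminf (p j) \<le> 1" for j
  proof -
    have "summable (p j)" using Bessel_row by (intro summableI_nonneg_bounded[where x = 1]) (auto simp: p_def)
    then show ?thesis using Bessel_row by (auto intro: suminf_le_const)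
  qed
  have col: "(\<Sum>j<m. p j i) \<le> 1" for m i
  proof -
    have "(\<Sum>j<m. p j i) = (\<Sum>j<m. (cmod (cinner (b i) (e j)))\<^sup>2)"
      unfolding p_def by (metis cinner_commute complex_mod_cnj)
    then show ?thesis
      using Bessel[of "{..<m}" e "b i"] orthonormal_contractive[OF orthonormal_subset[OF e subset_UNIV]]
        orthonormal_norm[OF b, of i] by simp
  qed
  have step: "H (\<kappa> j) \<le> (\<Sum>i. p j i * g i)
      + h (\<kappa> j) * ((norm (a \<cdot> e j))\<^sup>2 - (norm (a' \<cdot> e j))\<^sup>2) + C * (norm (K - K'))\<^sup>2" for j
  proof -
    define M1 where "M1 = (norm (a' \<cdot> e j))\<^sup>2"
    define M2 where "M2 = (norm (K' \<cdot> e j))\<^sup>2"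
    \<comment> \<open>The part \<open>w\<close> of \<open>e j\<close> missed by \<open>b\<close>
      lies in the kernel of \<open>a'\<close>. Hence \<open>M1\<close> and \<open>M2\<close> are the
      first and second moments of the \<kappa>' with respect to the masses
      \<open>p j\<close>.\<close>
    obtain w where w: "(\<lambda>i. cinner (e j) (b i) *\<^sub>C b i) sums (e j - w)" "\<And>i. cinner w (b i) = 0"
      using Fourier_expansion[OF b, of "e j"] by blast
    have K'b: "K' \<cdot> b i = complex_of_real (\<kappa>' i) *\<^sub>C b i" for i
      using singular_system_eigen[OF a', of i] by (simp only: K'_def \<kappa>'_def)
    have "a' \<cdot> w = 0" using a' w(2) by (simp add: singular_system_def)
    then have "K' \<cdot> w = 0" by (simp add: K'_def app.zero_right)
    have "(\<lambda>i. K' \<cdot> (cinner (e j) (b i) *\<^sub>C b i)) sums (K' \<cdot> (e j - w))"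
      using w(1) by (rule bounded_linear.sums[OF app.bounded_linear_right])
    then have K'e: "(\<lambda>i. (cinner (e j) (b i) * of_real (\<kappa>' i)) *\<^sub>C b i) sums (K' \<cdot> e j)"
      using \<open>K' \<cdot> w = 0\<close> by (simp add: app.diff_right K'b scaleC_scaleC)
    have pair: "(\<lambda>i. cinner (e j) (b i) * of_real (\<kappa>' i) * cinner (b i) v) sums cinner (K' \<cdot> e j) v" for v
      using bounded_linear.sums[OF cinner.bounded_linear_left K'e, of v] by (simp add: cinner_scaleC_left)
    have pji: "cinner (e j) (b i) * cinner (b i) (e j) = of_real (p j i)" for i
      unfolding p_def complex_norm_square using cinner_commute[of "b i" "e j"] by simp
    have "(\<lambda>i. complex_of_real (p j i * \<kappa>' i)) sums cinner (K' \<cdot> e j) (e j)"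
      by (rule sums_cong[THEN iffD1, OF _ pair[of "e j"]]) (simp add: pji[symmetric] mult_ac)
    moreover have "cinner (K' \<cdot> e j) (e j) = of_real M1"
      by (simp only: K'_def app_times adj_left cinner_norm M1_def)
    ultimately have M1: "(\<lambda>i. p j i * \<kappa>' i) sums M1" by (simp only: sums_of_real_iff)
    have "cinner (b i) (K' \<cdot> e j) = of_real (\<kappa>' i) * cinner (b i) (e j)" for i
    proof -
      have "cinner (b i) (K' \<cdot> e j) = cinner (K' \<cdot> b i) (e j)"
        by (simp add: K'_def adj_right adj_left)
      then show ?thesis by (simp add: K'b cinner_scaleC_left)
    qed
    then have "(\<lambda>i. complex_of_real (p j i * (\<kappa>' i)\<^sup>2)) sums cinner (K' \<cdot> e j) (K' \<cdot> e j)"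
      using pair[of "K' \<cdot> e j"] by (simp add: pji[symmetric] power2_eq_square mult_ac)
    then have M2: "(\<lambda>i. p j i * (\<kappa>' i)\<^sup>2) sums M2"
      by (simp only: sums_of_real_iff cinner_norm M2_def)
    \<comment> \<open>The value at 0 of the tangent parabola at \<kappa> j. It is at most
      \<open>H 0 = 0\<close>, so mass missing from row \<open>j\<close> only helps.\<close>
    define A where "A = H (\<kappa> j) - h (\<kappa> j) * \<kappa> j - C * (\<kappa> j)\<^sup>2"
    have "A \<le> 0" using tangent[OF \<kappa>(1)[of j] R0] H(1) by (simp add: A_def)
    have lower: "(\<lambda>i. p j i * A + (h (\<kappa> j) + 2 * C * \<kappa> j) * (p j i * \<kappa>' i) - C * (p j i * (\<kappa>' i)\<^sup>2))
        sums (suminf (p j) * A + (h (\<kappa> j) + 2 * C * \<kappa> j) * M1 - C * M2)"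
      using row[of j] M1 M2 by (intro sums_diff sums_add sums_mult sums_mult2) auto
    have upper: "summable (\<lambda>i. p j i * g i)"
      using p_pos row[of j] g_dec g_pos by (intro summable_mult_decseq) auto
    have "p j i * A + (h (\<kappa> j) + 2 * C * \<kappa> j) * (p j i * \<kappa>' i) - C * (p j i * (\<kappa>' i)\<^sup>2) \<le> p j i * g i" for i
    proof -
      have "p j i * (H (\<kappa> j) + h (\<kappa> j) * (\<kappa>' i - \<kappa> j) - C * (\<kappa>' i - \<kappa> j)\<^sup>2) \<le> p j i * g i"
        unfolding g_def using \<kappa> by (intro mult_left_mono tangent) (auto simp: p_def)
      then show ?thesis by (simp add: A_def power2_eq_square algebra_simps)
    qed
    then have "suminf (p j) * A + (h (\<kappa> j) + 2 * C * \<kappa> j) * M1 - C * M2 \<le> (\<Sum>i. p j i * g i)"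
      using lower upper by (intro sums_le[OF _ lower summable_sums]) auto
    moreover have "A \<le> suminf (p j) * A"
      using row[of j] \<open>A \<le> 0\<close> mult_right_mono_neg[of "suminf (p j)" 1 A] by simp
    ultimately have 1: "A + (h (\<kappa> j) + 2 * C * \<kappa> j) * M1 - C * M2 \<le> (\<Sum>i. p j i * g i)" by linarith
    have Ke: "K \<cdot> e j = complex_of_real (\<kappa> j) *\<^sub>C e j"
      using singular_system_eigen[OF a, of j] by (simp only: K_def \<kappa>_def)
    have "norm (K \<cdot> e j) = \<kappa> j" using \<kappa>(1)[of j] orthonormal_norm[OF e, of j] by (simp add: Ke norm_scaleC)
    moreover have "cinner (K' \<cdot> e j) (K \<cdot> e j) = of_real (\<kappa> j * M1)"
      using \<open>cinner (K' \<cdot> e j) (e j) = of_real M1\<close> by (simp add: Ke cinner_scaleC_right)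
    ultimately have "(norm ((K' - K) \<cdot> e j))\<^sup>2 = M2 - 2 * (\<kappa> j * M1) + (\<kappa> j)\<^sup>2"
      by (simp only: app.diff_left norm_diff_sq M2_def Re_complex_of_real)
    moreover have "(norm ((K' - K) \<cdot> e j))\<^sup>2 \<le> (norm (K - K'))\<^sup>2"
      using norm_app[of "K' - K" "e j"] orthonormal_norm[OF e, of j]
      by (intro power_mono) (auto simp: norm_minus_commute)
    \<comment> \<open>The quadratic terms left by averaging the parabola are exactly the squared
      norm of \<open>K' - K\<close> at \<open>e j\<close>; the linear terms give the difference of
      squared norms in the claim.\<close>
    ultimately have "C * (M2 - 2 * (\<kappa> j * M1) + (\<kappa> j)\<^sup>2) \<le> C * (norm (K - K'))\<^sup>2"
      using C by (intro mult_left_mono) auto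
    moreover have "(norm (a \<cdot> e j))\<^sup>2 = \<kappa> j" using singular_system_norm[OF a, of j] by (simp add: \<kappa>_def)
    ultimately show ?thesis using 1 by (simp add: A_def M1_def algebra_simps)
  qed
  have "(\<Sum>j<n. c j * H (\<kappa> j)) \<le> (\<Sum>j<n. c j * ((\<Sum>i. p j i * g i)
      + h (\<kappa> j) * ((norm (a \<cdot> e j))\<^sup>2 - (norm (a' \<cdot> e j))\<^sup>2) + C * (norm (K - K'))\<^sup>2))"
    using step c(1) by (intro sum_mono mult_left_mono) auto
  also have "\<dots> = (\<Sum>j<n. c j * (\<Sum>i. p j i * g i))
      + (\<Sum>j<n. c j * (h (\<kappa> j) * ((norm (a \<cdot> e j))\<^sup>2 - (norm (a' \<cdot> e j))\<^sup>2)))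
      + (\<Sum>j<n. c j) * (C * (norm (K - K'))\<^sup>2)"
    by (simp only: distrib_left sum.distrib sum_distrib_right)
  also have "(\<Sum>j<n. c j * (\<Sum>i. p j i * g i)) \<le> (\<Sum>j<n. c j * g j)"
    using c row col g_dec g_pos p_pos by (intro sum_weights_mono substochastic_sum_le) auto
  finally show ?thesis by (simp add: K_def K'_def g_def \<kappa>_def \<kappa>'_def)
qed

section \<open>The smoothed angle function\<close>

text \<open>
  For \<open>x = 2 - 2 cos \<theta>\<close> and \<open>r = 1\<close> the value of \<open>arc r x\<close> is \<open>\<bar>\<theta>\<bar>\<close>, which is not smooth at
  \<open>\<theta> = 0\<close> and \<open>\<theta> = \<pi>\<close>; for \<open>r < 1\<close> it is a smooth approximation that is still
  1-Lipschitz in \<open>\<theta>\<close>.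
\<close>

definition arc :: "real \<Rightarrow> real \<Rightarrow> real"
  where "arc r x = arccos (r * (1 - x / 2)) - arccos r"

definition arc_deriv :: "real \<Rightarrow> real \<Rightarrow> real"
  where "arc_deriv r x = r / 2 / sqrt (1 - (r * (1 - x / 2))\<^sup>2)"

lemma arc_argument_bound:
  fixes r x :: real
  assumes "0 < r" "r < 1" "x \<in> {0..4}"
  shows "\<bar>r * (1 - x / 2)\<bar> \<le> r" and "(r * (1 - x / 2))\<^sup>2 \<le> r\<^sup>2" and "(r * (1 - x / 2))\<^sup>2 < 1"
proof -
  have "\<bar>1 - x / 2\<bar> \<le> 1" using assms by auto
  then show 1: "\<bar>r * (1 - x / 2)\<bar> \<le> r" using assms by (simp add: abs_mult)
  then show "(r * (1 - x / 2))\<^sup>2 \<le> r\<^sup>2" using assms by (simp add: abs_le_square_iff[symmetric])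
  moreover have "r\<^sup>2 < 1" using assms by (simp add: power_less_one_iff)
  ultimately show "(r * (1 - x / 2))\<^sup>2 < 1" by simp
qed

lemma arc_mono:
  assumes "0 < r" "r < 1" shows "mono_on {0..4} (arc r)"
proof (rule mono_onI)
  fix x y :: real assume "x \<in> {0..4}" "y \<in> {0..4}" "x \<le> y"
  then show "arc r x \<le> arc r y"
    using assms arc_argument_bound(1)[of r x] arc_argument_bound(1)[of r y]
    unfolding arc_def by (intro diff_right_mono arccos_le_arccos) auto
qed

text \<open>For r < 1 the second derivative \<open>f2\<close> is bounded on [0,4] by some B. Adding
  C x^2 with C = B/2 makes \<open>arc r\<close> convex, and the claim is the tangent line inequality
  of that convex function.\<close>

lemma arc_tangent:
  assumes r: "0 < r" "r < 1"
  obtains C where "0 \<le> C"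
    and "\<And>x y. x \<in> {0..4} \<Longrightarrow> y \<in> {0..4} \<Longrightarrow> arc r x + arc_deriv r x * (y - x) - C * (y - x)\<^sup>2 \<le> arc r y"
proof -
  define u where "u x = r * (1 - x / 2)" for x
  define f2 where "f2 x = - (r / 2) * (r / 2) * u x / ((1 - (u x)\<^sup>2) * sqrt (1 - (u x)\<^sup>2))" for x
  have u: "\<bar>u x\<bar> < 1" "(u x)\<^sup>2 < 1" if "x \<in> {0..4}" for x
    using arc_argument_bound[OF r that] r by (auto simp: u_def)
  have d1: "(arc r has_real_derivative arc_deriv r x) (at x)" if "x \<in> {0..4}" for x
    using u[OF that] unfolding arc_def arc_deriv_def u_def
    by (auto intro!: derivative_eq_intros simp: abs_less_iff field_simps)
  have d2: "(arc_deriv r has_real_derivative f2 x) (at x)" if "x \<in> {0..4}" for x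
  proof -
    define S where "S = (\<lambda>x. sqrt (1 - (u x)\<^sup>2))"
    have w: "0 < 1 - (u x)\<^sup>2" using u(2)[OF that] by simp
    have S: "S x > 0" "S x * S x = 1 - (u x)\<^sup>2" using w by (simp_all add: S_def)
    have "(u has_real_derivative - (r / 2)) (at x)"
      unfolding u_def by (auto intro!: derivative_eq_intros)
    then have "((\<lambda>x. 1 - (u x)\<^sup>2) has_real_derivative r * u x) (at x)"
      by (auto intro!: derivative_eq_intros)
    then have "(S has_real_derivative r * u x * (inverse (sqrt (1 - (u x)\<^sup>2)) / 2)) (at x)"
      unfolding S_def using DERIV_chain2[of sqrt _ "\<lambda>x. 1 - (u x)\<^sup>2", OF DERIV_real_sqrt[OF w]]
      by (simp add: mult.commute)
    then have "((\<lambda>x. r / 2 / S x) has_real_derivative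
        (0 * S x - r / 2 * (r * u x * (inverse (S x) / 2))) / (S x * S x)) (at x)"
      using S(1) by (intro DERIV_divide DERIV_const) (auto simp: S_def)
    moreover have "(0 * S x - r / 2 * (r * u x * (inverse (S x) / 2))) / (S x * S x) = f2 x"
      unfolding S(2) using S(1) by (simp add: f2_def S_def[symmetric] S_def[THEN fun_cong, symmetric] field_simps)
    moreover have "(\<lambda>x. r / 2 / S x) = arc_deriv r" by (simp add: arc_deriv_def S_def u_def fun_eq_iff)
    ultimately show ?thesis by simp
  qed
  have "(1 - (u x)\<^sup>2) * sqrt (1 - (u x)\<^sup>2) \<noteq> 0" if "x \<in> {0..4}" for x
    using u(2)[OF that] by simp
  moreover have "continuous_on {0..4} u" unfolding u_def by (intro continuous_intros) simp
  ultimately have "continuous_on {0..4} f2"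
    unfolding f2_def by (intro continuous_intros) auto
  then have "bounded (f2 ` {0..4})" by (intro compact_imp_bounded compact_continuous_image) auto
  then obtain B where B: "\<And>x. x \<in> {0..4} \<Longrightarrow> \<bar>f2 x\<bar> \<le> B" unfolding bounded_iff by (metis image_eqI real_norm_def)
  then have "0 \<le> B" by (meson abs_ge_zero atLeastAtMost_iff order_refl order_trans zero_le_numeral)
  define C where "C = B / 2"
  have tangent: "(arc_deriv r x + 2 * C * x) * (y - x) \<le> (arc r y + C * y\<^sup>2) - (arc r x + C * x\<^sup>2)"
    if "x \<in> {0..4}" "y \<in> {0..4}" for x y
  proof (rule f''_imp_f'[of "{0..4}" "\<lambda>x. arc r x + C * x\<^sup>2" "\<lambda>x. arc_deriv r x + 2 * C * x" "\<lambda>x. f2 x + 2 * C"])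
    show "((\<lambda>x. arc r x + C * x\<^sup>2) has_real_derivative arc_deriv r x + 2 * C * x) (at x)"
      if "x \<in> {0..4}" for x using d1[OF that] by (auto intro!: derivative_eq_intros)
    show "((\<lambda>x. arc_deriv r x + 2 * C * x) has_real_derivative f2 x + 2 * C) (at x)"
      if "x \<in> {0..4}" for x using d2[OF that] by (auto intro!: derivative_eq_intros)
    show "0 \<le> f2 x + 2 * C" if "x \<in> {0..4}" for x using B[OF that] by (simp add: C_def)
  qed (use that in auto)
  show thesis
  proof (rule that[of C])
    fix x y :: real assume "x \<in> {0..4}" "y \<in> {0..4}"
    from tangent[OF this] show "arc r x + arc_deriv r x * (y - x) - C * (y - x)\<^sup>2 \<le> arc r y"
      by (simp add: power2_eq_square algebra_simps)
  qed (use \<open>0 \<le> B\<close> in \<open>simp add: C_def\<close>)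
qed

text \<open>With x = 2 - 2 cos \<theta> the square root is \<bar>sin \<theta>\<bar> and dx/d\<theta>
  = 2 sin \<theta>, so this is the 1-Lipschitz property in \<theta>. It amounts to r^2 - r^2 cos^2
  \<theta> \<le> 1 - r^2 cos^2 \<theta>.\<close>

lemma arc_deriv_bound:
  assumes r: "0 < r" "r < 1" and x: "x \<in> {0..4}"
  shows "\<bar>2 * arc_deriv r x\<bar> * sqrt (1 - (1 - x / 2)\<^sup>2) \<le> 1"
proof -
  have "r * sqrt (1 - (1 - x / 2)\<^sup>2) = sqrt (r\<^sup>2 * (1 - (1 - x / 2)\<^sup>2))"
    using r by (simp add: real_sqrt_mult)
  also have "r\<^sup>2 * (1 - (1 - x / 2)\<^sup>2) = r\<^sup>2 - (r * (1 - x / 2))\<^sup>2"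
    by (simp only: power_mult_distrib right_diff_distrib[of "r\<^sup>2"] mult_1_right)
  also have "sqrt (r\<^sup>2 - (r * (1 - x / 2))\<^sup>2) \<le> sqrt (1 - (r * (1 - x / 2))\<^sup>2)"
    using r by (intro real_sqrt_le_mono diff_right_mono) (simp add: power_le_one)
  finally show ?thesis
    using r arc_argument_bound(3)[OF r x] by (simp add: arc_deriv_def abs_of_pos field_simps)
qed

section \<open>Growth of the functional along a curve of unitaries\<close>

text \<open>A mean value inequality that asks only for increments to the left of each point, which
  is all that the perturbation estimate provides.\<close>

lemma dini_integral_bound:
  fixes f n :: "real \<Rightarrow> real"
  assumes ab: "a \<le> b" and f: "continuous_on {a..b} f" and n: "continuous_on {a..b} n"
    and dini: "\<And>t \<epsilon>. a < t \<Longrightarrow> t \<le> b \<Longrightarrow> 0 < \<epsilon> \<Longrightarrow>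
      \<exists>d>0. \<forall>s. t - d < s \<longrightarrow> s < t \<longrightarrow> a \<le> s \<longrightarrow> f t - f s \<le> (t - s) * (n t + \<epsilon>)"
  shows "f b - f a \<le> integral {a..b} n"
proof -
  have int: "n integrable_on {s..t}" if "a \<le> s" "t \<le> b" for s t
    using that n by (intro integrable_continuous_real) (auto intro: continuous_on_subset)
  have main: "f b - f a \<le> integral {a..b} n + \<epsilon> * (b - a)" if "0 < \<epsilon>" for \<epsilon>
  proof -
    \<comment> \<open>The slack \<epsilon> t is spent in halves: one on the increment estimate at
      \<open>t\<close>, one on the variation of \<open>n\<close> between \<open>s\<close> and
      \<open>t\<close>.\<close>
    define h where "h t = f t - integral {a..t} n - \<epsilon> * t" for t
    have h: "continuous_on {a..b} h"
      unfolding h_def using f int ab by (intro continuous_intros indefinite_integral_continuous_1) auto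
    \<comment> \<open>The least point \<open>t\<close> of this closed set must be \<open>a\<close>:
      otherwise a point \<open>s\<close> slightly to its left satisfies \<open>h t \<le> h s\<close>
      and belongs to the set as well.\<close>
    define A where "A = {t \<in> {a..b}. h b \<le> h t}"
    have "A = {a..b} \<inter> h -` {h b..}" by (auto simp: A_def)
    then have "closed A"
      using continuous_closed_preimage[OF h, of "{h b..}"] by simp
    moreover have "bounded A" by (rule bounded_subset[of "{a..b}"]) (auto simp: A_def)
    ultimately have "compact A" by (simp add: compact_eq_bounded_closed)
    moreover have "b \<in> A" using ab by (simp add: A_def)
    ultimately obtain t where t: "t \<in> A" "\<And>s. s \<in> A \<Longrightarrow> t \<le> s"
      using compact_attains_inf[of A] by blast
    have "t = a"
    proof (rule ccontr)
      assume "t \<noteq> a"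
      then have at: "a < t" "t \<le> b" using t(1) by (auto simp: A_def)
      obtain d where d: "d > 0" "\<And>s. t - d < s \<Longrightarrow> s < t \<Longrightarrow> a \<le> s \<Longrightarrow> f t - f s \<le> (t - s) * (n t + \<epsilon> / 2)"
        using dini[OF at, of "\<epsilon> / 2"] \<open>0 < \<epsilon>\<close> by auto
      obtain d' where d': "d' > 0" "\<And>x. x \<in> {a..b} \<Longrightarrow> dist x t < d' \<Longrightarrow> dist (n x) (n t) < \<epsilon> / 2"
        using n at \<open>0 < \<epsilon>\<close> unfolding continuous_on_iff
        by (metis atLeastAtMost_iff half_gt_zero less_imp_le)
      define s where "s = max a (t - min d d' / 2)"
      have s: "a \<le> s" "s < t" "t - d < s" "t - d' < s" using d d' at by (auto simp: s_def)
      have "(t - s) * (n t - \<epsilon> / 2) = integral {s..t} (\<lambda>_. n t - \<epsilon> / 2)" using s by simp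
      also have "\<dots> \<le> integral {s..t} n"
      proof (rule integral_le)
        show "n integrable_on {s..t}" using int s at by simp
        show "n t - \<epsilon> / 2 \<le> n x" if "x \<in> {s..t}" for x
        proof -
          have "\<bar>n x - n t\<bar> < \<epsilon> / 2"
            using d'(2)[of x] that s at by (simp add: dist_real_def)
          then show ?thesis by linarith
        qed
      qed auto
      finally have "(t - s) * (n t - \<epsilon> / 2) \<le> integral {a..t} n - integral {a..s} n"
        using Henstock_Kurzweil_Integration.integral_combine[of a s t n] int[of a t] s at by simp
      then have I: "(t - s) * (n t - \<epsilon> / 2) + (\<epsilon> * t - \<epsilon> * s)
          \<le> integral {a..t} n - integral {a..s} n + (\<epsilon> * t - \<epsilon> * s)" by (rule add_right_mono)
      have "f t - f s \<le> (t - s) * (n t + \<epsilon> / 2)" using d s by simp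
      also have "\<dots> = (t - s) * (n t - \<epsilon> / 2) + (\<epsilon> * t - \<epsilon> * s)" by (simp add: field_simps)
      also note I
      finally have "h t \<le> h s" by (simp add: h_def)
      then have "s \<in> A" using t(1) s at by (auto simp: A_def)
      then show False using t(2) s by fastforce
    qed
    then have "h b \<le> h a" using t(1) by (simp add: A_def)
    then show ?thesis by (simp add: h_def algebra_simps)
  qed
  show ?thesis
  proof (rule field_le_epsilon)
    fix \<epsilon> :: real assume "0 < \<epsilon>"
    have "\<epsilon> / (b - a + 1) * (b - a) \<le> \<epsilon>"
      using ab \<open>0 < \<epsilon>\<close> by (simp add: field_simps)
    then show "f b - f a \<le> integral {a..b} n + \<epsilon>"
      using main[of "\<epsilon> / (b - a + 1)"] ab \<open>0 < \<epsilon>\<close> by simp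
  qed
qed

section \<open>The modulus of g - 1 for a unitary g\<close>

lemma bounded_linear_adj: "bounded_linear (adj :: 'h::separable_hilbert_space operator \<Rightarrow> 'h operator)"
  by (rule bounded_linear_intro[where K = 1]) (simp_all add: norm_adj)

text \<open>Affine dependence on \<open>g\<close> is the reason for working with squared singular
  values: increments of the square are linear in increments of the curve.\<close>

lemma unitary_minus_one_square:
  assumes "unitary g" shows "adj (g - 1) * (g - 1) = 2 *\<^sub>R 1 - (g + adj g)"
  using assms by (simp add: unitary_def algebra_simps scaleR_2)

lemma unitary_minus_one_norm_sq:
  assumes "unitary g" "norm v = 1" shows "(norm ((g - 1) \<cdot> v))\<^sup>2 = 2 - 2 * Re (cinner (g \<cdot> v) v)"
  using assms by (simp add: app.diff_left norm_diff_sq unitary_norm_app)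

lemma singular_system_unit: "singular_system x e s \<Longrightarrow> norm (e j) = 1"
  using orthonormal_norm[of UNIV e j] by (simp add: singular_system_def)

lemma singular_system_unitary_le:
  assumes "unitary g" and "singular_system (g - 1) e s"
  shows "(s j)\<^sup>2 \<in> {0..4}"
proof -
  have "norm (g - 1) \<le> norm g + norm (1 :: 'a operator)" by (rule norm_triangle_ineq4)
  then have "norm (g - 1) \<le> 2" using unitary_norm_le[OF assms(1)] by simp
  moreover have "s j \<le> norm (g - 1)"
    using norm_app[of "g - 1" "e j"] singular_system_norm[OF assms(2), of j]
      singular_system_unit[OF assms(2), of j] by simp
  moreover have "0 \<le> s j" using assms(2) by (simp add: singular_system_def)
  ultimately have "(s j)\<^sup>2 \<le> 2\<^sup>2" by (intro power_mono) auto
  then show ?thesis by simp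
qed

context symmetric_norm
begin

text \<open>
  On the singular vectors \<open>e\<^sub>j\<close> of \<open>g - 1\<close> the operator \<open>(g + g\<^sup>*)/2\<close> is diagonal, and \<open>g\<^sup>* D\<close> is
  skew-adjoint, so only \<open>(g - g\<^sup>*)/2\<close> contributes to \<open>Re \<langle>D e\<^sub>j, e\<^sub>j\<rangle>\<close>.  It maps the \<open>e\<^sub>j\<close> to orthogonal
  vectors of length \<open>\<bar>sin \<theta>\<^sub>j\<bar>\<close>, a factor that the derivative of \<open>arc\<close> compensates.
\<close>

lemma first_variation_bound:
  fixes g D :: "'h operator"
  assumes g: "unitary g" and tangent: "adj g * D + adj D * g = 0" and D: "N D < \<infinity>"
    and sys: "singular_system (g - 1) e s" and r: "0 < r" "r < 1"
    and c: "dual_weights n c"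
  shows "(\<Sum>j<n. c j * (arc_deriv r ((s j)\<^sup>2) * (- 2 * Re (cinner (D \<cdot> e j) (e j))))) \<le> enn2real (N D)"
proof -
  define X where "X = adj g * D"
  define h where "h j = arc_deriv r ((s j)\<^sup>2)" for j
  define \<rho> where "\<rho> j = 1 - (s j)\<^sup>2 / 2" for j
  define B where "B = (1 / 2) *\<^sub>R (g - adj g)"
  define M where "M = (1 / 2) *\<^sub>R (g + adj g)"
  define y where "y j = (2 * h j) *\<^sub>R (B \<cdot> e j)" for j
  have e: "orthonormal UNIV e" using sys by (simp add: singular_system_def)
  have gg: "g * adj g = 1" "adj g * g = 1" using g by (simp_all add: unitary_def)
  have skew: "adj X = - X"
    using tangent by (simp add: X_def eq_neg_iff_add_eq_0 add.commute)
  have "g * X = D" using gg by (simp add: X_def mult.assoc[symmetric])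
  have Me: "M \<cdot> e j = complex_of_real (\<rho> j) *\<^sub>C e j" for j
  proof -
    have "complex_of_real ((s j)\<^sup>2) *\<^sub>C e j = (2 *\<^sub>R 1 - (g + adj g)) \<cdot> e j"
      using singular_system_eigen[OF sys, of j] unitary_minus_one_square[OF g] by (simp only:)
    then have "(s j)\<^sup>2 *\<^sub>R e j = 2 *\<^sub>R e j - 2 *\<^sub>R (M \<cdot> e j)"
      by (simp only: scaleC_of_real) (simp add: M_def app.diff_left app.scaleR_left)
    then have "2 *\<^sub>R (M \<cdot> e j) = 2 *\<^sub>R (\<rho> j *\<^sub>R e j)"
      by (simp add: \<rho>_def algebra_simps)
    then have "M \<cdot> e j = \<rho> j *\<^sub>R e j" by (simp only: scaleR_cancel_left) simp
    then show ?thesis by (simp add: scaleC_of_real)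
  qed
  \<comment> \<open>The operator form of sin^2 = 1 - cos^2, with \<open>M\<close> as cosine and
    \<open>B\<close> as i times sine.\<close>
  have BB: "adj B * B = 1 - M * M"
  proof -
    have "4 *\<^sub>R (adj B * B) = 4 *\<^sub>R (1 - M * M)"
      by (simp add: B_def M_def algebra_simps gg scaleR_2) (simp add: scaleR_conv_of_real)
    then show ?thesis by simp
  qed
  have inner: "cinner (B \<cdot> e i) (B \<cdot> e j) = of_real (1 - (\<rho> j)\<^sup>2) * cinner (e i) (e j)" for i j
  proof -
    have "cinner (B \<cdot> e i) (B \<cdot> e j) = cinner (e i) ((adj B * B) \<cdot> e j)"
      by (simp add: adj_right)
    also have "(adj B * B) \<cdot> e j = complex_of_real (1 - (\<rho> j)\<^sup>2) *\<^sub>C e j"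
      by (simp add: BB app.diff_left Me scaleC_scaleC scaleC.diff_left scaleC_one power2_eq_square)
    finally show ?thesis by (simp add: cinner_scaleC_right)
  qed
  have nB: "(norm (B \<cdot> e j))\<^sup>2 = 1 - (\<rho> j)\<^sup>2" for j
    using inner[of j j] unfolding cinner_norm
    by (simp only: singular_system_unit[OF sys] power_one of_real_1 mult_1_right of_real_eq_iff)
  have y: "orthogonal_contractive {..<n} y"
    unfolding orthogonal_contractive_def
  proof (intro conjI ballI impI)
    fix i j :: nat assume "i \<noteq> j"
    then show "cinner (y i) (y j) = 0"
      using e by (simp add: y_def cinner.scaleR_left cinner.scaleR_right inner orthonormalD)
  next
    fix j
    have "norm (B \<cdot> e j) = sqrt (1 - (\<rho> j)\<^sup>2)" by (simp add: nB[symmetric])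
    then show "norm (y j) \<le> 1"
      using arc_deriv_bound[OF r singular_system_unitary_le[OF g sys, of j]]
      by (simp add: y_def h_def \<rho>_def)
  qed
  \<comment> \<open>Substitute \<open>adj g = M - B\<close>. The part with \<open>M\<close>
    multiplies a diagonal entry of the skew-adjoint \<open>X\<close> by a real number; its real part
    vanishes and only \<open>B\<close> remains.\<close>
  have var: "h j * (- 2 * Re (cinner (D \<cdot> e j) (e j))) = Re (cinner (X \<cdot> e j) (y j))" for j
  proof -
    have "cinner (D \<cdot> e j) (e j) = cinner (X \<cdot> e j) (adj g \<cdot> e j)"
      unfolding \<open>g * X = D\<close>[symmetric] by (simp add: adj_right)
    also have "adj g = M - B" by (simp add: M_def B_def algebra_simps flip: scaleR_add_left)
    also have "cinner (X \<cdot> e j) ((M - B) \<cdot> e j)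
      = of_real (\<rho> j) * cinner (X \<cdot> e j) (e j) - cinner (X \<cdot> e j) (B \<cdot> e j)"
      by (simp add: app.diff_left cinner.diff_right Me cinner_scaleC_right)
    also have "Re \<dots> = \<rho> j * Re (cinner (X \<cdot> e j) (e j)) - Re (cinner (X \<cdot> e j) (B \<cdot> e j))" by simp
    also have "cinner (X \<cdot> e j) (e j) = - cnj (cinner (X \<cdot> e j) (e j))"
    proof -
      have "cinner (X \<cdot> e j) (e j) = - cinner (e j) (X \<cdot> e j)"
        by (simp add: adj_right skew app.minus_left cinner.minus_right)
      then show ?thesis using cinner_commute[of "e j" "X \<cdot> e j"] by simp
    qed
    then have "Re (cinner (X \<cdot> e j) (e j)) = 0"
      by (metis add.inverse_inverse cnj.simps(1) equal_neg_zero uminus_complex.simps(1))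
    finally show ?thesis by (simp add: y_def cinner.scaleR_right)
  qed
  have "(\<Sum>j<n. c j * (h j * (- 2 * Re (cinner (D \<cdot> e j) (e j)))))
      \<le> (\<Sum>j<n. c j * cmod (cinner (X \<cdot> e j) (y j)))"
    unfolding var using c by (auto simp: dual_weights_def intro!: sum_mono mult_left_mono complex_Re_le_cmod)
  also have "\<dots> \<le> \<phi> (\<lambda>j. if j < n then cmod (cinner (X \<cdot> e j) (y j)) else 0)"
    using c by (simp add: dual_weights_def)
  also have "\<dots> \<le> enn2real (N D)"
  proof -
    have "ennreal (\<phi> (\<lambda>j. if j < n then cmod (cinner (X \<cdot> e j) (y j)) else 0)) \<le> N X"
      using orthonormal_subset[OF e subset_UNIV] y by (rule gauge_le_N)
    also have "N X \<le> N D"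
      unfolding X_def using g by (intro N_contraction_left unitary_norm_le unitary_adj)
    finally have "ennreal (\<phi> (\<lambda>j. if j < n then cmod (cinner (X \<cdot> e j) (y j)) else 0))
      \<le> ennreal (enn2real (N D))" using D by simp
    then show ?thesis using enn2real_nonneg[of "N D"] by (auto simp: ennreal_le_iff2)
  qed
  finally show ?thesis by (simp add: h_def)
qed

section \<open>Derivatives with respect to the symmetric norm\<close>

lemma tendsto_if_N_tendsto:
  assumes "((\<lambda>s. N (F s)) \<longlongrightarrow> 0) A"
  shows "(F \<longlongrightarrow> 0) A"
proof (rule tendstoI)
  fix \<epsilon> :: real assume "0 < \<epsilon>"
  then have "0 < ennreal (gauge_unit * \<epsilon>)" using gauge_unit_pos by simp
  with assms have "\<forall>\<^sub>F s in A. N (F s) < ennreal (gauge_unit * \<epsilon>)" by (rule order_tendstoD)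
  then show "\<forall>\<^sub>F s in A. dist (F s) 0 < \<epsilon>"
  proof eventually_elim
    case (elim s)
    then have "ennreal (gauge_unit * norm (F s)) < ennreal (gauge_unit * \<epsilon>)"
      using norm_le_N[of "F s"] by (rule le_less_trans[rotated])
    then show ?case using gauge_unit_pos by (simp add: ennreal_less_iff)
  qed
qed

lemma has_norm_derivative_vector:
  assumes "has_norm_derivative N \<gamma> D t S"
  shows "(\<gamma> has_vector_derivative D) (at t within S)"
  unfolding has_vector_derivative_def has_derivative_iff_norm
proof (intro conjI bounded_linear_scaleR_left)
  have "((\<lambda>s. norm ((\<gamma> s - \<gamma> t) /\<^sub>R (s - t) - D)) \<longlongrightarrow> 0) (at t within S)"
    using assms unfolding has_norm_derivative_def by (intro tendsto_norm_zero tendsto_if_N_tendsto)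
  moreover have "\<forall>\<^sub>F s in at t within S. norm ((\<gamma> s - \<gamma> t) /\<^sub>R (s - t) - D)
      = norm (\<gamma> s - \<gamma> t - (s - t) *\<^sub>R D) / norm (s - t)"
    unfolding eventually_at_topological
  proof (intro exI[of _ UNIV] conjI ballI impI)
    fix s assume "s \<noteq> t"
    then have "(\<gamma> s - \<gamma> t) /\<^sub>R (s - t) - D = (\<gamma> s - \<gamma> t - (s - t) *\<^sub>R D) /\<^sub>R (s - t)"
      by (simp add: scaleR_diff_right)
    then show "norm ((\<gamma> s - \<gamma> t) /\<^sub>R (s - t) - D) = norm (\<gamma> s - \<gamma> t - (s - t) *\<^sub>R D) / norm (s - t)"
      by (simp add: divide_inverse mult.commute)
  qed auto
  ultimately show "((\<lambda>s. norm (\<gamma> s - \<gamma> t - (s - t) *\<^sub>R D) / norm (s - t)) \<longlongrightarrow> 0) (at t within S)"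
    by (rule Lim_transform_eventually)
qed

lemma at_within_Icc_nontrivial: "a < b \<Longrightarrow> t \<in> {a..b} \<Longrightarrow> at t within {a..b} \<noteq> bot" for a b t :: real
  by (simp add: trivial_limit_within)

text \<open>A single difference quotient at \<open>N\<close>-distance less than 1 from
  \<open>D\<close> suffices: its numerator is a difference of two elements of the ideal.\<close>

lemma has_norm_derivative_finite:
  assumes D: "has_norm_derivative N \<gamma> D t {a..b}" and "a < b" "t \<in> {a..b}"
    and \<gamma>: "\<And>t. t \<in> {a..b} \<Longrightarrow> \<gamma> t \<in> unitary_group N"
  shows "N D < \<infinity>"
proof -
  have "\<forall>\<^sub>F s in at t within {a..b}. N ((\<gamma> s - \<gamma> t) /\<^sub>R (s - t) - D) < 1"
    using D unfolding has_norm_derivative_def by (rule order_tendstoD) simp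
  moreover have "\<forall>\<^sub>F s in at t within {a..b}. s \<in> {a..b}" by (simp add: eventually_at_filter)
  ultimately have "\<forall>\<^sub>F s in at t within {a..b}. s \<in> {a..b} \<and> N ((\<gamma> s - \<gamma> t) /\<^sub>R (s - t) - D) < 1"
    by eventually_elim simp
  then obtain s where s: "s \<in> {a..b}" "N ((\<gamma> s - \<gamma> t) /\<^sub>R (s - t) - D) < 1"
    using at_within_Icc_nontrivial[OF assms(2,3)] by (auto dest: eventually_happens')
  define q where "q = (\<gamma> s - \<gamma> t) /\<^sub>R (s - t)"
  have "N (\<gamma> s - 1) < \<infinity>" "N (\<gamma> t - 1) < \<infinity>"
    using \<gamma>[OF s(1)] \<gamma>[OF assms(3)] by (auto simp: unitary_group_def norm_ideal_def)
  then have "N (\<gamma> s - \<gamma> t) < \<infinity>"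
    using N_diff[of "\<gamma> s - 1" "\<gamma> t - 1"] by (simp add: le_less_trans)
  then have "N q < \<infinity>" by (simp add: q_def N_scaleR ennreal_mult_less_top)
  moreover have "N (q - D) < \<infinity>" using s(2) by (simp add: q_def less_trans[OF _ ennreal_one_less_top])
  ultimately show ?thesis
    using N_diff[of q "q - D"] by (simp add: le_less_trans)
qed

lemma N_continuous_on:
  assumes D: "\<And>t. t \<in> S \<Longrightarrow> N (D t) < \<infinity>"
    and cont: "\<And>t. t \<in> S \<Longrightarrow> ((\<lambda>s. N (D s - D t)) \<longlongrightarrow> 0) (at t within S)"
  shows "continuous_on S (\<lambda>t. enn2real (N (D t)))"
  unfolding continuous_on_def
proof (intro ballI tendstoI)
  fix t and \<epsilon> :: real assume t: "t \<in> S" and "0 < \<epsilon>"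
  then have "\<forall>\<^sub>F s in at t within S. N (D s - D t) < ennreal \<epsilon>"
    by (intro order_tendstoD(2)[OF cont]) auto
  moreover have "\<forall>\<^sub>F s in at t within S. s \<in> S" by (simp add: eventually_at_filter)
  ultimately show "\<forall>\<^sub>F s in at t within S. dist (enn2real (N (D s))) (enn2real (N (D t))) < \<epsilon>"
  proof eventually_elim
    case (elim s)
    define \<delta> where "\<delta> = enn2real (N (D s - D t))"
    have fin: "N (D s - D t) = ennreal \<delta>" "N (D s) = ennreal (enn2real (N (D s)))"
      "N (D t) = ennreal (enn2real (N (D t)))" "0 \<le> \<delta>"
      using elim D[OF elim(2)] D[OF t] less_trans[OF elim(1), of top] by (auto simp: \<delta>_def less_top[symmetric])
    have "N (D s) \<le> N (D s - D t) + N (D t)" "N (D t) \<le> N (D s - D t) + N (D s)"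
      using norm_triangle[of "D s - D t" "D t"] norm_triangle[of "D t - D s" "D s"]
      by (simp_all add: N_diff_commute[of "D t"])
    then have "enn2real (N (D s)) \<le> \<delta> + enn2real (N (D t))" "enn2real (N (D t)) \<le> \<delta> + enn2real (N (D s))"
      using fin by (metis enn2real_nonneg ennreal_le_iff ennreal_plus add_nonneg_nonneg)+
    moreover have "\<delta> < \<epsilon>" using elim(1) fin(1,4) by (simp add: ennreal_less_iff)
    ultimately show ?case by (simp add: dist_real_def abs_less_iff)
  qed
qed

text \<open>Both sides are derivatives of the constant curve
  \<open>adj (\<gamma> t) * \<gamma> t\<close>, and derivatives within a non-degenerate interval are
  unique.\<close>

lemma tangent_relation:
  assumes \<gamma>: "\<And>t. t \<in> {a..b} \<Longrightarrow> unitary (\<gamma> t)" and ab: "a < b" "t \<in> {a..b}"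
    and D: "(\<gamma> has_vector_derivative D) (at t within {a..b})"
  shows "adj (\<gamma> t) * D + adj D * \<gamma> t = (0 :: 'h operator)"
proof (rule vector_derivative_unique_within[OF at_within_Icc_nontrivial[OF ab]])
  show "((\<lambda>t. adj (\<gamma> t) * \<gamma> t) has_vector_derivative adj (\<gamma> t) * D + adj D * \<gamma> t) (at t within {a..b})"
    by (intro has_vector_derivative_mult bounded_linear.has_vector_derivative[OF bounded_linear_adj] D)
  show "((\<lambda>t. adj (\<gamma> t) * \<gamma> t) has_vector_derivative 0) (at t within {a..b})"
    by (rule has_vector_derivative_transform[OF ab(2) _ has_vector_derivative_const[of 1]])
      (use \<gamma> in \<open>auto simp: unitary_def\<close>)
qed

text \<open>The singular systems are chosen independently for each \<open>t\<close>. Continuity of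
  \<open>f\<close> comes from the increment estimate applied in both orders, and the left Dini bound
  comes from the same estimate with the later point as base.\<close>

lemma functional_growth:
  fixes \<gamma> D :: "real \<Rightarrow> 'h operator"
  assumes ab: "a < b" and \<gamma>: "\<And>t. t \<in> {a..b} \<Longrightarrow> \<gamma> t \<in> unitary_group N"
    and D: "\<And>t. t \<in> {a..b} \<Longrightarrow> has_norm_derivative N \<gamma> (D t) t {a..b}"
    and D_cont: "\<And>t. t \<in> {a..b} \<Longrightarrow> ((\<lambda>s. N (D s - D t)) \<longlongrightarrow> 0) (at t within {a..b})"
    and sys: "\<And>t. t \<in> {a..b} \<Longrightarrow> singular_system (\<gamma> t - 1) (e t) (s t)"
    and r: "0 < r" "r < 1"
    and weights: "dual_weights n c"
  shows "(\<Sum>j<n. c j * arc r ((s b j)\<^sup>2)) - (\<Sum>j<n. c j * arc r ((s a j)\<^sup>2))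
    \<le> integral {a..b} (\<lambda>t. enn2real (N (D t)))"
proof -
  have c: "\<And>j. j < n \<Longrightarrow> 0 \<le> c j" "\<And>i j. i \<le> j \<Longrightarrow> j < n \<Longrightarrow> c j \<le> c i"
    using weights by (auto simp: dual_weights_def)
  have u: "unitary (\<gamma> t)" if "t \<in> {a..b}" for t using \<gamma>[OF that] by (simp add: unitary_group_def)
  have DN: "N (D t) < \<infinity>" if "t \<in> {a..b}" for t
    using D[OF that] ab that \<gamma> by (rule has_norm_derivative_finite)
  have DV: "(\<gamma> has_vector_derivative D t) (at t within {a..b})" if "t \<in> {a..b}" for t
    using D[OF that] by (rule has_norm_derivative_vector)
  have \<gamma>_cont: "continuous_on {a..b} \<gamma>"
    using DV by (rule continuous_on_vector_derivative)
  define f where "f t = (\<Sum>j<n. c j * arc r ((s t j)\<^sup>2))" for t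
  obtain C where C: "0 \<le> C" "\<And>x y. x \<in> {0..4} \<Longrightarrow> y \<in> {0..4} \<Longrightarrow>
      arc r x + arc_deriv r x * (y - x) - C * (y - x)\<^sup>2 \<le> arc r y"
    using arc_tangent[OF r] by blast
  \<comment> \<open>The factor 4 is the square of the 2 that appears when the increment of
    \<open>adj (\<gamma> t - 1) * (\<gamma> t - 1)\<close> is bounded by twice the increment of the
    curve.\<close>
  define C' where "C' = (\<Sum>j<n. c j) * (4 * C)"
  have C': "0 \<le> C'" using C(1) c(1) by (auto simp: C'_def intro!: mult_nonneg_nonneg sum_nonneg)
  have kap: "(s t j)\<^sup>2 \<in> {0..4}" if "t \<in> {a..b}" for t j
    using u[OF that] sys[OF that] by (rule singular_system_unitary_le)
  have e1: "norm (e t j) = 1" if "t \<in> {a..b}" for t j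
    using sys[OF that] by (rule singular_system_unit)
  define V where "V t x = (\<Sum>j<n. c j * (arc_deriv r ((s t j)\<^sup>2) * (- 2 * Re (cinner (x \<cdot> e t j) (e t j)))))"
    for t x
  \<comment> \<open>Only the singular vectors at \<open>t\<close> occur. So \<open>V t\<close> is a
    fixed real-linear functional, and the difference quotient can be passed to its limit inside it
    as t' tends to t.\<close>
  have step: "f t - f t' \<le> V t (\<gamma> t - \<gamma> t') + C' * (norm (\<gamma> t - \<gamma> t'))\<^sup>2"
    if t: "t \<in> {a..b}" "t' \<in> {a..b}" for t t'
  proof -
    have "f t \<le> f t' + (\<Sum>j<n. c j * (arc_deriv r ((s t j)\<^sup>2) *
        ((norm ((\<gamma> t - 1) \<cdot> e t j))\<^sup>2 - (norm ((\<gamma> t' - 1) \<cdot> e t j))\<^sup>2)))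
      + (\<Sum>j<n. c j) * (C * (norm (adj (\<gamma> t - 1) * (\<gamma> t - 1) - adj (\<gamma> t' - 1) * (\<gamma> t' - 1)))\<^sup>2)"
      unfolding f_def
    proof (rule singular_functional_step[OF sys[OF t(1)] sys[OF t(2)] c(1,2)])
      show "arc r 0 = 0" by (simp add: arc_def)
      show "mono_on {0..4} (arc r)" using r by (rule arc_mono)
    qed (use C kap t in auto)
    also have "(\<Sum>j<n. c j * (arc_deriv r ((s t j)\<^sup>2) *
        ((norm ((\<gamma> t - 1) \<cdot> e t j))\<^sup>2 - (norm ((\<gamma> t' - 1) \<cdot> e t j))\<^sup>2))) = V t (\<gamma> t - \<gamma> t')"
      unfolding V_def unitary_minus_one_norm_sq[OF u[OF t(1)] e1[OF t(1)]]
        unitary_minus_one_norm_sq[OF u[OF t(2)] e1[OF t(1)]]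
      by (simp add: app.diff_left cinner.diff_left algebra_simps)
    also have "(\<Sum>j<n. c j) * (C * (norm (adj (\<gamma> t - 1) * (\<gamma> t - 1) - adj (\<gamma> t' - 1) * (\<gamma> t' - 1)))\<^sup>2)
        \<le> (\<Sum>j<n. c j) * (C * (2 * norm (\<gamma> t - \<gamma> t'))\<^sup>2)"
    proof -
      have "adj (\<gamma> t - 1) * (\<gamma> t - 1) - adj (\<gamma> t' - 1) * (\<gamma> t' - 1) = - ((\<gamma> t - \<gamma> t') + adj (\<gamma> t - \<gamma> t'))"
        unfolding unitary_minus_one_square[OF u[OF t(1)]] unitary_minus_one_square[OF u[OF t(2)]] by simp
      then have "norm (adj (\<gamma> t - 1) * (\<gamma> t - 1) - adj (\<gamma> t' - 1) * (\<gamma> t' - 1)) \<le> 2 * norm (\<gamma> t - \<gamma> t')"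
        using norm_triangle_ineq[of "\<gamma> t - \<gamma> t'" "adj (\<gamma> t - \<gamma> t')"]
        by (simp only: norm_minus_cancel norm_adj)
      then show ?thesis
        using C(1) c(1) by (intro mult_left_mono power_mono sum_nonneg) auto
    qed
    finally show ?thesis by (simp add: C'_def power_mult_distrib algebra_simps)
  qed
  \<comment> \<open>A crude bound, diverging as r -> 1, that is used only to show continuity of
    \<open>f\<close>; the sharp bound on \<open>V t (D t)\<close> comes from
    \<open>first_variation_bound\<close>.\<close>
  define L where "L = (\<Sum>j<n. c j) * (r / sqrt (1 - r\<^sup>2))"
  have VL: "V t x \<le> L * norm x" if "t \<in> {a..b}" for t x
  proof -
    have "arc_deriv r ((s t j)\<^sup>2) * (- 2 * Re (cinner (x \<cdot> e t j) (e t j))) \<le> r / sqrt (1 - r\<^sup>2) * norm x" for j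
    proof -
      have "r\<^sup>2 < 1" using r by (simp add: power_less_one_iff)
      then have "\<bar>arc_deriv r ((s t j)\<^sup>2)\<bar> \<le> r / 2 / sqrt (1 - r\<^sup>2)"
        using arc_argument_bound(2,3)[OF r kap[OF that, of j]] r
        unfolding arc_deriv_def by (simp add: frac_le)
      moreover have "cmod (cinner (x \<cdot> e t j) (e t j)) \<le> norm x"
        using cinner_Cauchy_Schwarz[of "x \<cdot> e t j" "e t j"] norm_app[of x "e t j"] e1[OF that, of j] by simp
      then have "\<bar>- 2 * Re (cinner (x \<cdot> e t j) (e t j))\<bar> \<le> 2 * norm x"
        using abs_Re_le_cmod[of "cinner (x \<cdot> e t j) (e t j)"] by simp
      ultimately have "\<bar>arc_deriv r ((s t j)\<^sup>2)\<bar> * \<bar>- 2 * Re (cinner (x \<cdot> e t j) (e t j))\<bar>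
          \<le> (r / 2 / sqrt (1 - r\<^sup>2)) * (2 * norm x)"
        by (intro mult_mono) auto
      then show ?thesis by (simp only: abs_mult[symmetric]) simp
    qed
    then have "V t x \<le> (\<Sum>j<n. c j * (r / sqrt (1 - r\<^sup>2) * norm x))"
      unfolding V_def using c(1) by (intro sum_mono mult_left_mono) auto
    then show ?thesis by (simp only: L_def sum_distrib_right mult.assoc)
  qed
  have "continuous_on {a..b} f"
    unfolding continuous_on_def
  proof
    fix t assume t: "t \<in> {a..b}"
    have lip: "norm (f t' - f t) \<le> norm (\<gamma> t' - \<gamma> t) * (L + C' * norm (\<gamma> t' - \<gamma> t))" if "t' \<in> {a..b}" for t'
      using step[OF t that] step[OF that t] VL[OF t, of "\<gamma> t - \<gamma> t'"] VL[OF that, of "\<gamma> t' - \<gamma> t"]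
      by (simp add: abs_le_iff norm_minus_commute[of "\<gamma> t"] power2_eq_square algebra_simps)
    have "(\<gamma> \<longlongrightarrow> \<gamma> t) (at t within {a..b})" using \<gamma>_cont t by (simp add: continuous_on_def)
    then have "((\<lambda>t'. norm (\<gamma> t' - \<gamma> t) * (L + C' * norm (\<gamma> t' - \<gamma> t)))
        \<longlongrightarrow> norm (\<gamma> t - \<gamma> t) * (L + C' * norm (\<gamma> t - \<gamma> t))) (at t within {a..b})"
      by (intro tendsto_intros)
    then have lim: "((\<lambda>t'. norm (\<gamma> t' - \<gamma> t) * (L + C' * norm (\<gamma> t' - \<gamma> t))) \<longlongrightarrow> 0) (at t within {a..b})"
      by simp
    have "\<forall>\<^sub>F t' in at t within {a..b}. t' \<in> {a..b}" by (simp add: eventually_at_filter)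
    then have "\<forall>\<^sub>F t' in at t within {a..b}.
        norm (f t' - f t) \<le> norm (\<gamma> t' - \<gamma> t) * (L + C' * norm (\<gamma> t' - \<gamma> t))"
      by eventually_elim (rule lip)
    then have "((\<lambda>t'. f t' - f t) \<longlongrightarrow> 0) (at t within {a..b})"
      using lim by (rule Lim_null_comparison)
    then show "(f \<longlongrightarrow> f t) (at t within {a..b})" by (simp add: Lim_null[of f])
  qed
  moreover have "continuous_on {a..b} (\<lambda>t. enn2real (N (D t)))"
    using DN D_cont by (rule N_continuous_on)
  ultimately have "f b - f a \<le> integral {a..b} (\<lambda>t. enn2real (N (D t)))"
  proof (rule dini_integral_bound[OF less_imp_le[OF ab]])
    fix t \<epsilon> :: real assume t: "a < t" "t \<le> b" and "0 < \<epsilon>"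
    then have tab: "t \<in> {a..b}" by simp
    define Q where "Q t' = (\<gamma> t' - \<gamma> t) /\<^sub>R (t' - t)" for t'
    have "((\<lambda>t'. Q t' - D t) \<longlongrightarrow> 0) (at t within {a..b})"
      using D[OF tab] unfolding has_norm_derivative_def Q_def by (rule tendsto_if_N_tendsto)
    then have Q: "(Q \<longlongrightarrow> D t) (at t within {a..b})" by (simp add: Lim_null[of Q])
    have "(\<gamma> \<longlongrightarrow> \<gamma> t) (at t within {a..b})" using \<gamma>_cont tab by (simp add: continuous_on_def)
    then have "((\<lambda>t'. V t (Q t') + C' * (norm (Q t') * norm (\<gamma> t - \<gamma> t')))
        \<longlongrightarrow> V t (D t) + C' * (norm (D t) * norm (\<gamma> t - \<gamma> t))) (at t within {a..b})"
      unfolding V_def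
      by (intro tendsto_intros app.tendsto cinner.tendsto Q)
    moreover have "V t (D t) \<le> enn2real (N (D t))"
      unfolding V_def using u[OF tab] tangent_relation[OF u ab tab DV[OF tab]] DN[OF tab] sys[OF tab] r weights
      by (rule first_variation_bound)
    then have "V t (D t) + C' * (norm (D t) * norm (\<gamma> t - \<gamma> t)) < enn2real (N (D t)) + \<epsilon>"
      using \<open>0 < \<epsilon>\<close> by simp
    ultimately have "\<forall>\<^sub>F t' in at t within {a..b}.
        V t (Q t') + C' * (norm (Q t') * norm (\<gamma> t - \<gamma> t')) < enn2real (N (D t)) + \<epsilon>"
      by (rule order_tendstoD)
    then obtain d where d: "d > 0" "\<And>t'. t' \<in> {a..b} \<Longrightarrow> t' \<noteq> t \<Longrightarrow> dist t' t < d \<Longrightarrow>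
        V t (Q t') + C' * (norm (Q t') * norm (\<gamma> t - \<gamma> t')) < enn2real (N (D t)) + \<epsilon>"
      unfolding eventually_at by blast
    show "\<exists>d>0. \<forall>t'. t - d < t' \<longrightarrow> t' < t \<longrightarrow> a \<le> t' \<longrightarrow> f t - f t' \<le> (t - t') * (enn2real (N (D t)) + \<epsilon>)"
    proof (intro exI[of _ d] conjI allI impI d(1))
      fix t' assume t': "t - d < t'" "t' < t" "a \<le> t'"
      have \<Delta>: "\<gamma> t - \<gamma> t' = (t - t') *\<^sub>R Q t'"
      proof -
        have "(\<gamma> t' - \<gamma> t) /\<^sub>R (t' - t) = (\<gamma> t - \<gamma> t') /\<^sub>R (t - t')"
          using t'(2) by (metis (no_types, opaque_lifting) inverse_minus_eq minus_diff_eq scaleR_minus_left scaleR_minus_right minus_minus)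
        then show ?thesis using t'(2) by (simp add: Q_def)
      qed
      have "V t (\<gamma> t - \<gamma> t') = (t - t') * V t (Q t')"
        unfolding \<Delta> by (simp add: V_def app.scaleR_left cinner.scaleR_left sum_distrib_left mult_ac)
      moreover have "(norm (\<gamma> t - \<gamma> t'))\<^sup>2 = (t - t') * (norm (Q t') * norm (\<gamma> t - \<gamma> t'))"
        using t'(2) by (simp add: \<Delta> power2_eq_square)
      moreover have "t' \<in> {a..b}" using t' t by simp
      ultimately have "f t - f t' \<le> (t - t') * V t (Q t')
          + C' * ((t - t') * (norm (Q t') * norm (\<gamma> t - \<gamma> t')))"
        using step[OF tab] by metis
      also have "\<dots> = (t - t') * (V t (Q t') + C' * (norm (Q t') * norm (\<gamma> t - \<gamma> t')))"
        by (simp only: distrib_left mult.left_commute)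
      also have "\<dots> \<le> (t - t') * (enn2real (N (D t)) + \<epsilon>)"
        using d(2)[of t'] t' t by (intro mult_left_mono less_imp_le) (auto simp: dist_real_def)
      finally show "f t - f t' \<le> (t - t') * (enn2real (N (D t)) + \<epsilon>)" .
    qed
  qed
  then show ?thesis by (simp add: f_def)
qed

end

section \<open>Lengths of curves\<close>

lemma breakpoints_mono:
  fixes \<tau> :: "nat \<Rightarrow> real"
  assumes "\<And>i. i < n \<Longrightarrow> \<tau> i < \<tau> (Suc i)" and "i \<le> k" and "k \<le> n"
  shows "\<tau> i \<le> \<tau> k"
  using assms(2,3)
proof (induction k rule: dec_induct)
  case (step k)
  then show ?case using assms(1)[of k] by simp
qed simp

context symmetric_norm
begin

lemma N_unitary_left: "unitary w \<Longrightarrow> N (w * x) = N x"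
proof (rule antisym)
  assume w: "unitary w"
  show "N (w * x) \<le> N x" using w by (intro N_contraction_left unitary_norm_le)
  have "N (adj w * (w * x)) \<le> N (w * x)" using w by (intro N_contraction_left unitary_norm_le unitary_adj)
  then show "N x \<le> N (w * x)" using w by (simp add: unitary_def mult.assoc[symmetric])
qed

lemma unitary_group_mult:
  assumes u: "u \<in> unitary_group N" and w: "w \<in> unitary_group N"
  shows "u * w \<in> unitary_group N"
proof -
  have "N (u * w - 1) = N (u * (w - 1) + (u - 1))" by (simp add: algebra_simps)
  also have "\<dots> \<le> N (u * (w - 1)) + N (u - 1)" by (rule norm_triangle)
  also have "\<dots> < \<infinity>" using u w by (simp add: unitary_group_def norm_ideal_def N_unitary_left)
  finally show ?thesis using u w by (simp add: unitary_group_def norm_ideal_def unitary_mult)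
qed

lemma unitary_group_adj:
  assumes "u \<in> unitary_group N" shows "adj u \<in> unitary_group N"
proof -
  have u: "unitary u" using assms by (simp add: unitary_group_def)
  have "adj u - 1 = - (adj u * (u - 1))" using u by (simp add: unitary_def algebra_simps)
  then have "N (adj u - 1) = N (u - 1)"
    using N_unitary_left[OF unitary_adj[OF u]] by (simp add: N_uminus)
  then show ?thesis using assms by (simp add: unitary_group_def norm_ideal_def unitary_adj)
qed

section \<open>Derivatives on pieces and on the unit interval\<close>

lemma norm_derivative_eqI:
  assumes "has_norm_derivative N \<gamma> D t {0..1}" and "t \<in> {0..1}"
  shows "norm_derivative N \<gamma> t = D"
  unfolding norm_derivative_def
proof (rule the_equality, rule assms(1))
  fix D' assume "has_norm_derivative N \<gamma> D' t {0..1}"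
  then show "D' = D"
    using vector_derivative_unique_within[OF at_within_Icc_nontrivial[OF zero_less_one assms(2)]]
      has_norm_derivative_vector assms(1) by blast
qed

lemma has_norm_derivative_interior:
  assumes "has_norm_derivative N \<gamma> D t {a..b}" and "a < t" "t < b" and "0 \<le> a" "b \<le> 1"
  shows "has_norm_derivative N \<gamma> D t {0..1}"
proof -
  have "at t within {a..b} = at t" "at t within {0..1} = at t"
    using assms by (auto intro!: at_within_Icc_at)
  then show ?thesis using assms(1) by (simp add: has_norm_derivative_def)
qed

lemma has_norm_derivative_cong:
  assumes "\<And>s. s \<in> S \<Longrightarrow> \<gamma> s = \<gamma>' s" and "t \<in> S"
  shows "has_norm_derivative N \<gamma> D t S \<longleftrightarrow> has_norm_derivative N \<gamma>' D t S"
proof -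
  have "\<forall>\<^sub>F s in at t within S. s \<in> S" by (simp add: eventually_at_filter)
  then have "\<forall>\<^sub>F s in at t within S. N ((\<gamma> s - \<gamma> t) /\<^sub>R (s - t) - D) = N ((\<gamma>' s - \<gamma>' t) /\<^sub>R (s - t) - D)"
    by eventually_elim (simp add: assms)
  then show ?thesis unfolding has_norm_derivative_def by (rule tendsto_cong)
qed

text \<open>Multiplying by \<open>adj u\<close> preserves \<open>N\<close> and hence the speed.
  Growth estimates on the smooth pieces telescope; the remaining work matches gauge integrals over
  pieces with the Lebesgue integral in \<open>curve_length\<close>.\<close>

lemma curve_length_ge_functional:
  fixes \<gamma> :: "real \<Rightarrow> 'h operator" and u v :: "'h operator"
  assumes \<gamma>: "\<gamma> \<in> joining_curves N u v" and u: "u \<in> unitary_group N"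
    and sys: "\<And>t. t \<in> {0..1} \<Longrightarrow> singular_system (adj u * \<gamma> t - 1) (e t) (s t)"
    and r: "0 < r" "r < 1"
    and c: "dual_weights n c"
  shows "ennreal ((\<Sum>j<n. c j * arc r ((s 1 j)\<^sup>2)) - (\<Sum>j<n. c j * arc r ((s 0 j)\<^sup>2))) \<le> curve_length N \<gamma>"
proof -
  define F where "F t = (\<Sum>j<n. c j * arc r ((s t j)\<^sup>2))" for t
  have \<gamma>U: "\<gamma> t \<in> unitary_group N" if "t \<in> {0..1}" for t
    using \<gamma> that by (auto simp: joining_curves_def)
  obtain m \<tau> where \<tau>: "\<tau> 0 = 0" "\<tau> m = 1"
    and pieces: "\<And>i. i < m \<Longrightarrow> \<tau> i < \<tau> (Suc i) \<and> smooth_on_interval N \<gamma> (\<tau> i) (\<tau> (Suc i))"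
    using \<gamma> unfolding joining_curves_def piecewise_smooth_def by auto
  have mono: "\<tau> i \<le> \<tau> k" if "i \<le> k" "k \<le> m" for i k
    using pieces that by (intro breakpoints_mono[of m]) auto
  have range: "0 \<le> \<tau> i" "\<tau> (Suc i) \<le> 1" if "i < m" for i
    using mono[of 0 i] mono[of "Suc i" m] that \<tau> by auto
  \<comment> \<open>One derivative per piece, since the one-sided derivatives at a breakpoint may
    differ.\<close>
  have "\<exists>D. \<forall>i<m. \<forall>t\<in>{\<tau> i..\<tau> (Suc i)}. has_norm_derivative N \<gamma> (D i t) t {\<tau> i..\<tau> (Suc i)} \<and>
      ((\<lambda>s. N (D i s - D i t)) \<longlongrightarrow> 0) (at t within {\<tau> i..\<tau> (Suc i)})"
    using pieces unfolding smooth_on_interval_def by (intro choice) metis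
  then obtain D where D: "\<And>i t. i < m \<Longrightarrow> t \<in> {\<tau> i..\<tau> (Suc i)} \<Longrightarrow>
      has_norm_derivative N \<gamma> (D i t) t {\<tau> i..\<tau> (Suc i)}"
    and D_cont: "\<And>i t. i < m \<Longrightarrow> t \<in> {\<tau> i..\<tau> (Suc i)} \<Longrightarrow>
      ((\<lambda>s. N (D i s - D i t)) \<longlongrightarrow> 0) (at t within {\<tau> i..\<tau> (Suc i)})" by blast
  have uu: "unitary (adj u)" using u by (simp add: unitary_group_def unitary_adj)
  define \<nu> where "\<nu> i t = enn2real (N (D i t))" for i t
  define J where "J i = integral {\<tau> i..\<tau> (Suc i)} (\<nu> i)" for i
  have fin: "N (D i t) < \<infinity>" if "i < m" "t \<in> {\<tau> i..\<tau> (Suc i)}" for i t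
    using D[OF that] pieces[OF that(1)] that(2) \<gamma>U range[OF that(1)]
    by (intro has_norm_derivative_finite[of \<gamma> "D i t" t "\<tau> i" "\<tau> (Suc i)"]) auto
  have \<nu>_cont: "continuous_on {\<tau> i..\<tau> (Suc i)} (\<nu> i)" if "i < m" for i
    unfolding \<nu>_def using fin[OF that] D_cont[OF that] by (rule N_continuous_on)
  have growth: "F (\<tau> (Suc i)) - F (\<tau> i) \<le> J i" if i: "i < m" for i
  proof -
    have "F (\<tau> (Suc i)) - F (\<tau> i) \<le> integral {\<tau> i..\<tau> (Suc i)} (\<lambda>t. enn2real (N (adj u * D i t)))"
      unfolding F_def
    proof (rule functional_growth[of _ _ "\<lambda>t. adj u * \<gamma> t"])
      fix t assume t: "t \<in> {\<tau> i..\<tau> (Suc i)}"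
      then have t01: "t \<in> {0..1}" using range[OF i] by auto
      show "adj u * \<gamma> t \<in> unitary_group N"
        using u \<gamma>U[OF t01] by (intro unitary_group_mult unitary_group_adj)
      show "singular_system (adj u * \<gamma> t - 1) (e t) (s t)" using t01 by (rule sys)
      have "(adj u * \<gamma> s - adj u * \<gamma> t) /\<^sub>R (s - t) - adj u * D i t
          = adj u * ((\<gamma> s - \<gamma> t) /\<^sub>R (s - t) - D i t)" for s
        by (simp add: right_diff_distrib)
      then show "has_norm_derivative N (\<lambda>t. adj u * \<gamma> t) (adj u * D i t) t {\<tau> i..\<tau> (Suc i)}"
        using D[OF i t] by (simp add: has_norm_derivative_def N_unitary_left[OF uu])
      show "((\<lambda>s. N (adj u * D i s - adj u * D i t)) \<longlongrightarrow> 0) (at t within {\<tau> i..\<tau> (Suc i)})"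
        using D_cont[OF i t] by (simp add: right_diff_distrib[symmetric] N_unitary_left[OF uu])
    qed (use pieces[OF i] r c in auto)
    also have "(\<lambda>t. enn2real (N (adj u * D i t))) = \<nu> i"
      by (simp add: \<nu>_def fun_eq_iff N_unitary_left[OF uu])
    finally show ?thesis by (simp add: J_def)
  qed
  \<comment> \<open>Open intervals leave out the breakpoints, where \<open>norm_derivative\<close>
    may be unspecified; the integral does not notice.\<close>
  define g where "g i t = ennreal (indicator {\<tau> i<..<\<tau> (Suc i)} t *\<^sub>R \<nu> i t)" for i t
  have g_meas: "(\<lambda>t. indicator {\<tau> i<..<\<tau> (Suc i)} t *\<^sub>R \<nu> i t) \<in> borel_measurable borel" if "i < m" for i
    using \<nu>_cont[OF that]
    by (intro borel_measurable_continuous_on_indicator) (auto intro: continuous_on_subset)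
  have g_int: "(\<integral>\<^sup>+t. g i t \<partial>lborel) = ennreal (J i)" if "i < m" for i
    unfolding g_def
  proof (rule nn_integral_has_integral_lborel[OF g_meas[OF that]])
    have "(\<nu> i has_integral J i) {\<tau> i..\<tau> (Suc i)}"
      unfolding J_def using \<nu>_cont[OF that] by (intro integrable_integral integrable_continuous_real)
    then have "(\<nu> i has_integral J i) {\<tau> i<..<\<tau> (Suc i)}" by (simp add: has_integral_Icc_iff_Ioo)
    then have "((\<lambda>t. if t \<in> {\<tau> i<..<\<tau> (Suc i)} then \<nu> i t else 0) has_integral J i) UNIV"
      by (simp only: has_integral_restrict_UNIV)
    moreover have "(\<lambda>t. if t \<in> {\<tau> i<..<\<tau> (Suc i)} then \<nu> i t else 0)
        = (\<lambda>t. indicator {\<tau> i<..<\<tau> (Suc i)} t *\<^sub>R \<nu> i t)"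
      by (auto simp: indicator_def)
    ultimately show "((\<lambda>t. indicator {\<tau> i<..<\<tau> (Suc i)} t *\<^sub>R \<nu> i t) has_integral J i) UNIV" by simp
  qed (simp add: \<nu>_def)
  have J0: "0 \<le> J i" if "i < m" for i
    unfolding J_def
    by (intro Henstock_Kurzweil_Integration.integral_nonneg integrable_continuous_real \<nu>_cont that)
      (simp add: \<nu>_def)
  \<comment> \<open>At each \<open>t\<close> at most one summand is non-zero. A measurable minorant
    is enough, because \<open>nn_integral\<close> is monotone for arbitrary integrands.\<close>
  have le: "(\<Sum>i<m. g i t) \<le> N (norm_derivative N \<gamma> t) * indicator {0..1} t" for t
  proof (cases "\<exists>i<m. t \<in> {\<tau> i<..<\<tau> (Suc i)}")
    case True
    then obtain i where i: "i < m" "t \<in> {\<tau> i<..<\<tau> (Suc i)}" by blast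
    have other: "g k t = 0" if "k < m" "k \<noteq> i" for k
    proof (cases "k < i")
      case True
      then have "\<tau> (Suc k) \<le> \<tau> i" using i by (intro mono) auto
      then show ?thesis using i by (simp add: g_def)
    next
      case False
      then have "\<tau> (Suc i) \<le> \<tau> k" using that by (intro mono) auto
      then show ?thesis using i by (simp add: g_def)
    qed
    have "(\<Sum>k<m. g k t) = (\<Sum>k<m. if k = i then g i t else 0)"
      using other by (intro sum.cong) auto
    also have "\<dots> = N (D i t)" using i fin[OF i(1), of t] by (simp add: g_def \<nu>_def)
    also have "D i t = norm_derivative N \<gamma> t"
      using D[OF i(1), of t] i range[OF i(1)]
      by (intro norm_derivative_eqI[symmetric] has_norm_derivative_interior[of \<gamma> _ t "\<tau> i" "\<tau> (Suc i)"]) auto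
    finally show ?thesis using i range[OF i(1)] by (simp add: indicator_def)
  next
    case False
    then have "g i t = 0" if "i < m" for i using that by (auto simp: g_def)
    then show ?thesis by simp
  qed
  have "F 1 - F 0 = (\<Sum>i<m. F (\<tau> (Suc i)) - F (\<tau> i))"
    using sum_lessThan_telescope[of "\<lambda>i. F (\<tau> i)" m] \<tau> by simp
  also have "\<dots> \<le> (\<Sum>i<m. J i)" using growth by (intro sum_mono) auto
  finally have "ennreal (F 1 - F 0) \<le> ennreal (\<Sum>i<m. J i)" by (rule ennreal_leI)
  also have "\<dots> = (\<Sum>i<m. ennreal (J i))" using J0 by (intro sum_ennreal[symmetric]) auto
  also have "\<dots> = (\<Sum>i<m. \<integral>\<^sup>+t. g i t \<partial>lborel)" using g_int by simp
  also have "\<dots> = (\<integral>\<^sup>+t. (\<Sum>i<m. g i t) \<partial>lborel)"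
    using g_meas by (intro nn_integral_sum[symmetric]) (auto simp: g_def intro!: measurable_compose[OF _ measurable_ennreal])
  also have "\<dots> \<le> curve_length N \<gamma>"
    unfolding curve_length_def using le by (intro nn_integral_mono) auto
  finally show ?thesis by (simp add: F_def)
qed

end

section \<open>Exponential curves\<close>

lemma exp_eigenvector:
  fixes x :: "'h::separable_hilbert_space operator"
  assumes "x \<cdot> v = \<mu> *\<^sub>C v"
  shows "exp x \<cdot> v = exp \<mu> *\<^sub>C v"
proof -
  have pow: "(x ^ k) \<cdot> v = (\<mu> ^ k) *\<^sub>C v" for k
    by (induction k) (simp_all add: scaleC_one assms scaleC_scaleC mult.commute)
  have "(\<lambda>k. (x ^ k /\<^sub>R fact k) \<cdot> v) sums (exp x \<cdot> v)"
    using exp_converges by (rule bounded_linear.sums[OF app.bounded_linear_left])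
  moreover have "(\<lambda>k. (\<mu> ^ k /\<^sub>R fact k) *\<^sub>C v) sums (exp \<mu> *\<^sub>C v)"
    using exp_converges by (rule bounded_linear.sums[OF scaleC.bounded_linear_left])
  moreover have "(x ^ k /\<^sub>R fact k) \<cdot> v = (\<mu> ^ k /\<^sub>R fact k) *\<^sub>C v" for k
    by (simp add: app.scaleR_left pow scaleC.scaleR_left)
  ultimately show ?thesis by (simp add: sums_unique2)
qed

lemma adj_exp: "adj (exp x) = exp (adj x :: 'h::separable_hilbert_space operator)"
proof -
  have pow: "adj (x ^ k) = adj x ^ k" for k
    by (induction k) (simp_all add: power_commutes)
  have "(\<lambda>k. adj (x ^ k /\<^sub>R fact k)) sums adj (exp x)"
    using exp_converges by (rule bounded_linear.sums[OF bounded_linear_adj])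
  then have "(\<lambda>k. adj x ^ k /\<^sub>R fact k) sums adj (exp x)" by (simp add: pow)
  then show ?thesis using exp_converges sums_unique2 by blast
qed

lemma unitary_exp:
  fixes x :: "'h::separable_hilbert_space operator"
  assumes "adj x = - x" shows "unitary (exp x)"
  using exp_minus_inverse[of x] exp_minus_inverse[of "- x"] by (simp add: unitary_def adj_exp assms)

text \<open>The remainder is written with a factor \<open>x\<close> so that it stays in the ideal:
  its \<open>N\<close> is at most \<open>norm y * N x\<close>, and \<open>norm y\<close> tends to 0
  with \<open>x\<close>.\<close>

lemma exp_remainder_factor:
  fixes x :: "'a::{real_normed_algebra_1,banach}"
  obtains y where "exp x = 1 + x + x * y" and "norm y \<le> norm x * exp (norm x)"
proof -
  define f where "f n = inverse (fact (n + 2)) *\<^sub>R x ^ (n + 1)" for n :: nat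
  have bound: "norm (f n) \<le> norm x * (norm x ^ n /\<^sub>R fact n)" for n
  proof -
    have "norm (f n) \<le> inverse (fact (n + 2)) * norm x ^ (n + 1)"
      using norm_power_ineq[of x "n + 1"] by (simp add: f_def mult_left_mono del: fact_Suc power_Suc)
    also have "\<dots> \<le> inverse (fact n) * norm x ^ (n + 1)"
      by (intro mult_right_mono le_imp_inverse_le fact_mono) auto
    finally show ?thesis by (simp add: mult_ac)
  qed
  have s: "(\<lambda>n. norm x * (norm x ^ n /\<^sub>R fact n)) sums (norm x * exp (norm x))"
    by (intro sums_mult exp_converges)
  have f: "summable f"
    using bound by (intro summable_comparison_test'[OF sums_summable[OF s]]) auto
  have "exp x = 1 + x + (\<Sum>n. x * f n)"
    unfolding exp_first_two_terms[of x] by (simp add: f_def)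
  also have "(\<Sum>n. x * f n) = x * suminf f" using f by (rule suminf_mult)
  finally have "exp x = 1 + x + x * suminf f" .
  moreover have "norm (suminf f) \<le> norm x * exp (norm x)"
    using bound s by (intro norm_suminf_le[of f "\<lambda>n. norm x * (norm x ^ n /\<^sub>R fact n)", THEN order_trans])
      (auto simp: sums_iff)
  ultimately show thesis by (rule that)
qed

context symmetric_norm
begin

lemma exp_in_unitary_group:
  assumes "adj A = - A" "N A < \<infinity>"
  shows "exp A \<in> unitary_group N"
proof -
  obtain y where y: "exp A = 1 + A + A * y" using exp_remainder_factor by blast
  have "N (exp A - 1) = N (A * (1 + y))" by (simp add: y algebra_simps)
  also have "\<dots> \<le> ennreal (norm (1 + y)) * N A" by (rule N_mult_right)
  also have "\<dots> < \<infinity>" using assms(2) by (simp add: ennreal_mult_less_top)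
  finally show ?thesis using assms(1) by (simp add: unitary_group_def norm_ideal_def unitary_exp)
qed

context
  fixes w A :: "'h operator"
  assumes w: "w \<in> unitary_group N" and A: "adj A = - A" "N A < \<infinity>"
begin

lemma exp_curve_in_group: "w * exp (t *\<^sub>R A) \<in> unitary_group N"
proof -
  have "adj (t *\<^sub>R A) = - (t *\<^sub>R A)" "N (t *\<^sub>R A) < \<infinity>"
    using A by (simp_all add: N_scaleR ennreal_mult_less_top)
  then show ?thesis using w by (intro unitary_group_mult exp_in_unitary_group)
qed

text \<open>The error of the difference quotient is \<open>w * exp (t *\<^sub>R A) * (A * y)\<close>
  with \<open>y\<close> from \<open>exp_remainder_factor\<close>. The unitary factor drops out of
  \<open>N\<close>, and what is left is at most \<open>norm y * N A\<close>.\<close>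

lemma exp_curve_derivative:
  "has_norm_derivative N (\<lambda>t. w * exp (t *\<^sub>R A)) (w * exp (t *\<^sub>R A) * A) t S"
  unfolding has_norm_derivative_def
proof (rule tendsto_sandwich[OF _ _ tendsto_const])
  let ?g = "\<lambda>s. ennreal (norm ((s - t) *\<^sub>R A) * exp (norm ((s - t) *\<^sub>R A)) * enn2real (N A))"
  show "\<forall>\<^sub>F s in at t within S. 0 \<le> N ((w * exp (s *\<^sub>R A) - w * exp (t *\<^sub>R A)) /\<^sub>R (s - t) - w * exp (t *\<^sub>R A) * A)"
    by simp
  show "\<forall>\<^sub>F s in at t within S.
      N ((w * exp (s *\<^sub>R A) - w * exp (t *\<^sub>R A)) /\<^sub>R (s - t) - w * exp (t *\<^sub>R A) * A) \<le> ?g s"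
    unfolding eventually_at_topological
  proof (intro exI[of _ UNIV] conjI ballI impI)
    fix s assume "s \<noteq> t"
    define X where "X = (s - t) *\<^sub>R A"
    obtain y where y: "exp X = 1 + X + X * y" "norm y \<le> norm X * exp (norm X)"
      using exp_remainder_factor by blast
    have "s *\<^sub>R A = t *\<^sub>R A + X" by (simp add: X_def scaleR_left_diff_distrib)
    moreover have "t *\<^sub>R A * X = X * t *\<^sub>R A" by (simp add: X_def mult.commute)
    ultimately have "exp (s *\<^sub>R A) = exp (t *\<^sub>R A) * exp X" by (simp add: exp_add_commuting)
    then have "w * exp (s *\<^sub>R A) - w * exp (t *\<^sub>R A) = w * exp (t *\<^sub>R A) * (X + X * y)"
      by (simp add: y(1) distrib_left mult.assoc)
    also have "\<dots> = (s - t) *\<^sub>R (w * exp (t *\<^sub>R A) * (A + A * y))"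
      by (simp add: X_def scaleR_add_right[symmetric])
    finally have "w * exp (s *\<^sub>R A) - w * exp (t *\<^sub>R A) = (s - t) *\<^sub>R (w * exp (t *\<^sub>R A) * (A + A * y))" .
    then have "(w * exp (s *\<^sub>R A) - w * exp (t *\<^sub>R A)) /\<^sub>R (s - t) - w * exp (t *\<^sub>R A) * A
        = w * exp (t *\<^sub>R A) * (A * y)"
      using \<open>s \<noteq> t\<close> by (simp add: distrib_left)
    then have "N ((w * exp (s *\<^sub>R A) - w * exp (t *\<^sub>R A)) /\<^sub>R (s - t) - w * exp (t *\<^sub>R A) * A) = N (A * y)"
      using exp_curve_in_group[of t] by (simp add: N_unitary_left unitary_group_def)
    also have "\<dots> \<le> ennreal (norm y) * N A" by (rule N_mult_right)
    also have "\<dots> = ennreal (norm y * enn2real (N A))" using A(2) by (simp add: ennreal_mult)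
    also have "\<dots> \<le> ?g s" using y(2) by (intro ennreal_leI mult_right_mono) (auto simp: X_def)
    finally show "N ((w * exp (s *\<^sub>R A) - w * exp (t *\<^sub>R A)) /\<^sub>R (s - t) - w * exp (t *\<^sub>R A) * A) \<le> ?g s" .
  qed auto
  have "(?g \<longlongrightarrow> ennreal (norm ((t - t) *\<^sub>R A) * exp (norm ((t - t) *\<^sub>R A)) * enn2real (N A))) (at t within S)"
    by (intro tendsto_intros)
  then show "(?g \<longlongrightarrow> 0) (at t within S)" by simp
qed

lemma exp_curve_derivative_continuous:
  "((\<lambda>s. N (w * exp (s *\<^sub>R A) * A - w * exp (t *\<^sub>R A) * A)) \<longlongrightarrow> 0) (at t within S)"
proof (rule tendsto_sandwich[OF _ _ tendsto_const])
  let ?g = "\<lambda>s. ennreal (norm (w * exp (s *\<^sub>R A) - w * exp (t *\<^sub>R A)) * enn2real (N A))"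
  show "\<forall>\<^sub>F s in at t within S. 0 \<le> N (w * exp (s *\<^sub>R A) * A - w * exp (t *\<^sub>R A) * A)" by simp
  have "N (w * exp (s *\<^sub>R A) * A - w * exp (t *\<^sub>R A) * A) \<le> ?g s" for s
    using N_mult_left[of "w * exp (s *\<^sub>R A) - w * exp (t *\<^sub>R A)" A] A(2)
    by (simp add: ennreal_mult left_diff_distrib)
  then show "\<forall>\<^sub>F s in at t within S. N (w * exp (s *\<^sub>R A) * A - w * exp (t *\<^sub>R A) * A) \<le> ?g s"
    by (intro always_eventually) auto
  have "((\<lambda>s. exp (s *\<^sub>R A)) \<longlongrightarrow> exp (t *\<^sub>R A)) (at t within S)"
    using has_vector_derivative_continuous[OF exp_scaleR_has_vector_derivative_right]
    by (simp add: continuous_within)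
  then have "(?g \<longlongrightarrow> ennreal (norm (w * exp (t *\<^sub>R A) - w * exp (t *\<^sub>R A)) * enn2real (N A))) (at t within S)"
    by (intro tendsto_intros)
  then show "(?g \<longlongrightarrow> 0) (at t within S)" by simp
qed

lemma N_exp_curve_derivative: "N (w * exp (t *\<^sub>R A) * A) = N A"
  using exp_curve_in_group[of t] by (simp add: unitary_group_def N_unitary_left)

text \<open>The curve has to agree with the exponential only on the interval, so the lemma also
  covers pieces of a longer curve.\<close>

lemma exp_curve_smooth:
  assumes "A \<noteq> 0" and eq: "\<And>t. t \<in> {a..b} \<Longrightarrow> \<gamma> t = w * exp (t *\<^sub>R A)"
  shows "smooth_on_interval N \<gamma> a b"
  unfolding smooth_on_interval_def
proof (intro exI[of _ "\<lambda>t. w * exp (t *\<^sub>R A) * A"] ballI conjI)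
  fix t assume t: "t \<in> {a..b}"
  show "has_norm_derivative N \<gamma> (w * exp (t *\<^sub>R A) * A) t {a..b}"
    using exp_curve_derivative[of t "{a..b}"] 
      has_norm_derivative_cong[of "{a..b}" \<gamma> "\<lambda>t. w * exp (t *\<^sub>R A)", OF eq t] by blast
  show "w * exp (t *\<^sub>R A) * A \<noteq> 0"
    using N_exp_curve_derivative[of t] assms(1) by (metis norm_eq_0)
qed (rule exp_curve_derivative_continuous)

lemma exp_curve_length: "curve_length N (\<lambda>t. w * exp (t *\<^sub>R A)) = N A"
proof -
  have "norm_derivative N (\<lambda>t. w * exp (t *\<^sub>R A)) t = w * exp (t *\<^sub>R A) * A" if "t \<in> {0..1}" for t
    using exp_curve_derivative that by (rule norm_derivative_eqI)
  then have "curve_length N (\<lambda>t. w * exp (t *\<^sub>R A)) = (\<integral>\<^sup>+t\<in>{0..1::real}. N A \<partial>lborel)"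
    unfolding curve_length_def
    by (intro nn_integral_cong) (auto simp: N_exp_curve_derivative indicator_def)
  then show ?thesis by (simp add: nn_integral_cmult_indicator)
qed

lemma exp_curve_joining:
  assumes "A \<noteq> 0"
  shows "(\<lambda>t. w * exp (t *\<^sub>R A)) \<in> joining_curves N w (w * exp A)"
proof -
  have "smooth_on_interval N (\<lambda>t. w * exp (t *\<^sub>R A)) 0 1" using assms by (rule exp_curve_smooth) simp
  then have "piecewise_smooth N (\<lambda>t. w * exp (t *\<^sub>R A))"
    unfolding piecewise_smooth_def by (intro exI[of _ 1] exI[of _ real]) simp
  then show ?thesis using exp_curve_in_group by (auto simp: joining_curves_def)
qed

end

text \<open>
  Constant curves are not admissible, so a point is joined to itself by running a short piece of an
  exponential curve back and forth.
\<close>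

lemma ex_short_loop:
  assumes u: "u \<in> unitary_group N" and A: "adj A = - A" "N A < \<infinity>" "A \<noteq> 0"
  obtains \<gamma> where "\<gamma> \<in> joining_curves N u u" and "curve_length N \<gamma> \<le> N A"
proof -
  \<comment> \<open>The second formula starts at exp(A) exp(-A/2) = exp(A/2), where the first one
    ends, and returns to the start at time 1. The speed is \<open>N A\<close> throughout.\<close>
  define \<gamma> where "\<gamma> t = (if t \<le> 1 / 2 then u * exp (t *\<^sub>R A) else u * exp A * exp (t *\<^sub>R (- A)))" for t :: real
  have uA: "u * exp A \<in> unitary_group N" using exp_curve_in_group[OF u A(1,2), of 1] by simp
  have A': "adj (- A) = - (- A)" "N (- A) < \<infinity>" "- A \<noteq> 0" using A by (simp_all add: N_uminus)
  have \<gamma>2: "\<gamma> t = u * exp A * exp (t *\<^sub>R (- A))" if "1 / 2 \<le> t" for t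
  proof (cases "t = 1 / 2")
    case True
    have "A = (1 / 2) *\<^sub>R A + (1 / 2) *\<^sub>R A" by (simp add: scaleR_add_left[symmetric])
    then have "exp A = exp ((1 / 2) *\<^sub>R A) * exp ((1 / 2) *\<^sub>R A)"
      by (metis exp_add_commuting)
    then have "exp A * exp (- ((1 / 2) *\<^sub>R A)) = exp ((1 / 2) *\<^sub>R A)"
      by (simp add: mult.assoc exp_minus_inverse)
    then show ?thesis unfolding True by (simp add: \<gamma>_def mult.assoc)
  qed (use that in \<open>simp add: \<gamma>_def\<close>)
  have \<gamma>1: "\<gamma> t = u * exp (t *\<^sub>R A)" if "t \<le> 1 / 2" for t using that by (simp add: \<gamma>_def)
  have "smooth_on_interval N \<gamma> 0 (1 / 2)"
    using A(3) by (rule exp_curve_smooth[OF u A(1,2)]) (simp add: \<gamma>1)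
  moreover have "smooth_on_interval N \<gamma> (1 / 2) 1"
    using A'(3) by (rule exp_curve_smooth[OF uA A'(1,2)]) (simp add: \<gamma>2)
  ultimately have "\<forall>i<2. real i / 2 < real (Suc i) / 2 \<and> smooth_on_interval N \<gamma> (real i / 2) (real (Suc i) / 2)"
    by (auto simp: less_2_cases_iff)
  then have "piecewise_smooth N \<gamma>"
    unfolding piecewise_smooth_def by (intro exI[of _ 2] exI[of _ "\<lambda>i. real i / 2"]) simp
  moreover have "\<gamma> t \<in> unitary_group N" for t
    using exp_curve_in_group[OF u A(1,2), of t] exp_curve_in_group[OF uA A'(1,2), of t] by (simp add: \<gamma>_def)
  moreover have "\<gamma> 0 = u" "\<gamma> 1 = u"
    by (simp_all add: \<gamma>_def mult.assoc exp_minus_inverse)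
  ultimately have "\<gamma> \<in> joining_curves N u u" by (auto simp: joining_curves_def)
  moreover have "curve_length N \<gamma> \<le> N A"
  proof -
    have d: "N (norm_derivative N \<gamma> t) = N A" if t: "t \<in> {0..1}" "t \<noteq> 0" "t \<noteq> 1" "t \<noteq> 1 / 2" for t
    proof (cases "t < 1 / 2")
      case True
      have "has_norm_derivative N \<gamma> (u * exp (t *\<^sub>R A) * A) t {0..1/2}"
        using exp_curve_derivative[OF u A(1,2), of t "{0..1/2}"] t True
        by (subst has_norm_derivative_cong[of "{0..1/2}" \<gamma> "\<lambda>t. u * exp (t *\<^sub>R A)"]) (auto simp: \<gamma>1)
      then have "norm_derivative N \<gamma> t = u * exp (t *\<^sub>R A) * A"
        using t True by (intro norm_derivative_eqI has_norm_derivative_interior[of \<gamma> _ t 0 "1/2"]) auto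
      then show ?thesis by (simp add: N_exp_curve_derivative[OF u A(1,2)])
    next
      case False
      have "has_norm_derivative N \<gamma> (u * exp A * exp (t *\<^sub>R (- A)) * (- A)) t {1/2..1}"
        using exp_curve_derivative[OF uA A'(1,2), of t "{1/2..1}"] t False
        by (subst has_norm_derivative_cong[of "{1/2..1}" \<gamma> "\<lambda>t. u * exp A * exp (t *\<^sub>R (- A))"]) (auto simp: \<gamma>2)
      then have "norm_derivative N \<gamma> t = u * exp A * exp (t *\<^sub>R (- A)) * (- A)"
        using t False by (intro norm_derivative_eqI has_norm_derivative_interior[of \<gamma> _ t "1/2" 1]) auto
      then show ?thesis using N_exp_curve_derivative[OF uA A'(1,2), of t] by (simp only: N_uminus)
    qed
    have "AE t in lborel. t \<noteq> (0::real) \<and> t \<noteq> 1 \<and> t \<noteq> 1 / 2"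
      by (intro AE_conjI AE_lborel_singleton)
    then have "AE t in lborel. N (norm_derivative N \<gamma> t) * indicator {0..1} t = N A * indicator {0..1} t"
      by eventually_elim (auto simp: d indicator_def)
    then have "curve_length N \<gamma> = (\<integral>\<^sup>+t\<in>{0..1::real}. N A \<partial>lborel)"
      unfolding curve_length_def by (rule nn_integral_cong_AE)
    then show ?thesis by (simp add: nn_integral_cmult_indicator)
  qed
  ultimately show thesis by (rule that)
qed

end

section \<open>The end point\<close>

text \<open>A singular vector of \<open>z\<close> is an eigenvector of z^2, but not of
  \<open>z\<close> if it mixes the eigenvalues \<sigma> and -\<sigma>. The sum of both exponentials
  is 2 cos z, which is even and cannot tell them apart.\<close>

lemma exp_plus_exp_singular_vector:
  fixes z :: "'h::separable_hilbert_space operator"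
  assumes z: "hermitian z" and sys: "singular_system z e \<sigma>"
  shows "(exp (\<i> *\<^sub>C z) + exp (- (\<i> *\<^sub>C z))) \<cdot> e j = complex_of_real (2 * cos (\<sigma> j)) *\<^sub>C e j"
proof -
  define S where "S = exp (\<i> *\<^sub>C z) + exp (- (\<i> *\<^sub>C z))"
  have eig: "S \<cdot> v = complex_of_real (2 * cos \<mu>) *\<^sub>C v" if "z \<cdot> v = complex_of_real \<mu> *\<^sub>C v" for v \<mu>
  proof -
    have "exp (\<i> *\<^sub>C z) \<cdot> v = exp (\<i> * of_real \<mu>) *\<^sub>C v"
      using that by (intro exp_eigenvector) (simp add: scaleC_scaleC)
    moreover have "exp (- (\<i> *\<^sub>C z)) \<cdot> v = exp (- (\<i> * of_real \<mu>)) *\<^sub>C v"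
      using that by (intro exp_eigenvector) (simp add: scaleC_scaleC app.minus_left scaleC.minus_left)
    moreover have "exp (\<i> * of_real \<mu>) + exp (- (\<i> * of_real \<mu>)) = complex_of_real (2 * cos \<mu>)"
      by (simp add: cos_of_real[symmetric] cos_exp_eq)
    ultimately show ?thesis by (simp add: S_def app.add_left scaleC_add_left[symmetric])
  qed
  have zz: "z \<cdot> z \<cdot> e j = complex_of_real ((\<sigma> j)\<^sup>2) *\<^sub>C e j"
    using singular_system_eigen[OF sys, of j] z by (simp only: hermitian_def app_times)
  show ?thesis
  proof (cases "\<sigma> j = 0")
    case True
    then have "z \<cdot> e j = 0" using singular_system_norm[OF sys, of j] by simp
    then show ?thesis using eig[of "e j" 0] True by (simp add: S_def scaleC.zero_left)
  next
    case False
    \<comment> \<open>Up to a factor, \<open>p\<close> and \<open>q\<close> are the components of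
      \<open>e j\<close> for the eigenvalues \<sigma> and -\<sigma>; their sum is 2 \<sigma> times
      \<open>e j\<close>.\<close>
    define p where "p = complex_of_real (\<sigma> j) *\<^sub>C e j + z \<cdot> e j"
    define q where "q = complex_of_real (\<sigma> j) *\<^sub>C e j - z \<cdot> e j"
    have "z \<cdot> p = complex_of_real (\<sigma> j) *\<^sub>C p"
      by (simp add: p_def app.add_right scaleC_add_right zz scaleC_scaleC power2_eq_square add.commute)
    then have p: "S \<cdot> p = complex_of_real (2 * cos (\<sigma> j)) *\<^sub>C p" by (rule eig)
    have "z \<cdot> q = complex_of_real (- \<sigma> j) *\<^sub>C q"
      by (simp add: q_def app.diff_right scaleC.diff_right zz scaleC_scaleC power2_eq_square scaleC.minus_left)
    then have "S \<cdot> q = complex_of_real (2 * cos (- \<sigma> j)) *\<^sub>C q" by (rule eig)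
    then have "S \<cdot> (p + q) = complex_of_real (2 * cos (\<sigma> j)) *\<^sub>C (p + q)"
      using p by (simp add: app.add_right scaleC_add_right)
    moreover have "p + q = complex_of_real (2 * \<sigma> j) *\<^sub>C e j"
      by (simp add: p_def q_def scaleC_add_left[symmetric])
    ultimately have "complex_of_real (2 * \<sigma> j) *\<^sub>C (S \<cdot> e j)
        = complex_of_real (2 * \<sigma> j) *\<^sub>C (complex_of_real (2 * cos (\<sigma> j)) *\<^sub>C e j)"
      by (simp only: app_scaleC_right scaleC_scaleC mult.commute)
    then have "S \<cdot> e j = complex_of_real (2 * cos (\<sigma> j)) *\<^sub>C e j"
      using False by (subst (asm) complex_vector.scale_left_imp_eq[of "complex_of_real (2 * \<sigma> j)"]) auto
    then show ?thesis by (simp add: S_def)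
  qed
qed

lemma skew_of_hermitian: "hermitian z \<Longrightarrow> adj (\<i> *\<^sub>C z) = - (\<i> *\<^sub>C z :: 'h::separable_hilbert_space operator)"
  by (simp add: hermitian_def complex_vector.scale_minus_left)

text \<open>The singular vectors of \<open>z\<close> are kept, and \<sigma> becomes the chord length
  2 sin(\<sigma>/2). The bound on \<open>norm z\<close> keeps \<sigma>/2 in [0, \<pi>/2], where the
  sine increases, so the order is preserved.\<close>

lemma singular_system_exp:
  fixes z :: "'h::separable_hilbert_space operator"
  assumes z: "hermitian z" "norm z \<le> pi" and sys: "singular_system z e \<sigma>"
  shows "singular_system (exp (\<i> *\<^sub>C z) - 1) e (\<lambda>j. 2 * sin (\<sigma> j / 2))"
  unfolding singular_system_def
proof (intro conjI allI impI)
  have \<sigma>: "0 \<le> \<sigma> j" "\<sigma> j \<le> pi" for j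
    using sys z(2) norm_app[of z "e j"] singular_system_norm[OF sys, of j] singular_system_unit[OF sys, of j]
    by (auto simp: singular_system_def)
  show "orthonormal UNIV e" using sys by (simp add: singular_system_def)
  show "decseq (\<lambda>j. 2 * sin (\<sigma> j / 2))"
    unfolding decseq_def
  proof (intro allI impI)
    fix i j :: nat assume "i \<le> j"
    then have "\<sigma> j \<le> \<sigma> i" using sys by (simp add: singular_system_def decseq_def)
    then show "2 * sin (\<sigma> j / 2) \<le> 2 * sin (\<sigma> i / 2)"
      using \<sigma>[of i] \<sigma>[of j] by (intro mult_left_mono sin_monotone_2pi_le) auto
  qed
  show "0 \<le> 2 * sin (\<sigma> j / 2)" for j using \<sigma>[of j] by (simp add: sin_ge_zero)
  have "\<sigma> \<longlonglongrightarrow> 0" using sys by (simp add: singular_system_def)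
  then have "(\<lambda>j. 2 * sin (\<sigma> j / 2)) \<longlonglongrightarrow> 2 * sin (0 / 2)" by (intro tendsto_intros) simp_all
  then show "(\<lambda>j. 2 * sin (\<sigma> j / 2)) \<longlonglongrightarrow> 0" by simp
  define E where "E = exp (\<i> *\<^sub>C z)"
  have E: "unitary E" "adj E = exp (- (\<i> *\<^sub>C z))"
    using unitary_exp[OF skew_of_hermitian[OF z(1)]] unfolding E_def adj_exp skew_of_hermitian[OF z(1)]
    by (simp_all only:)
  show "cinner ((exp (\<i> *\<^sub>C z) - 1) \<cdot> e j) ((exp (\<i> *\<^sub>C z) - 1) \<cdot> w)
      = of_real ((2 * sin (\<sigma> j / 2))\<^sup>2) * cinner (e j) w" for j w
  proof -
    have "cinner ((E - 1) \<cdot> e j) ((E - 1) \<cdot> w) = cinner ((adj (E - 1) * (E - 1)) \<cdot> e j) w"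
      by (simp only: app_times adj_left)
    also have "(adj (E - 1) * (E - 1)) \<cdot> e j = 2 *\<^sub>R e j - complex_of_real (2 * cos (\<sigma> j)) *\<^sub>C e j"
      unfolding unitary_minus_one_square[OF E(1)] E(2)
      using exp_plus_exp_singular_vector[OF z(1) sys, of j] by (simp add: app.diff_left app.scaleR_left E_def)
    also have "\<dots> = complex_of_real (2 - 2 * cos (\<sigma> j)) *\<^sub>C e j"
      by (simp only: scaleC_of_real scaleR_left_diff_distrib)
    also have "2 - 2 * cos (\<sigma> j) = (2 * sin (\<sigma> j / 2))\<^sup>2"
      using cos_double_sin[of "\<sigma> j / 2"] by (simp add: power_mult_distrib)
    finally show ?thesis by (simp only: E_def cinner_scaleC_left)
  qed
  fix v assume "\<forall>j. cinner v (e j) = 0"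
  then have "z \<cdot> v = 0" using sys by (simp add: singular_system_def)
  then have "exp (\<i> *\<^sub>C z) \<cdot> v = exp 0 *\<^sub>C v"
    by (intro exp_eigenvector) (simp add: scaleC.zero_left scaleC.zero_right)
  then show "(exp (\<i> *\<^sub>C z) - 1) \<cdot> v = 0" by (simp add: app.diff_left scaleC_one)
qed

text \<open>The values are arccos(r cos \<theta>) - arccos(r), with r tending to 1; continuity of
  arccos on [-1,1] gives \<theta> in the limit. The 2 in the denominator keeps r positive at k =
  0.\<close>

lemma arc_limit:
  assumes "0 \<le> \<theta>" "\<theta> \<le> pi"
  shows "(\<lambda>k. arc (1 - 1 / (real k + 2)) ((2 * sin (\<theta> / 2))\<^sup>2)) \<longlonglongrightarrow> \<theta>"
proof -
  define r where "r k = 1 - 1 / (real k + 2)" for k :: nat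
  have r: "0 < r k" "r k < 1" for k by (simp_all add: r_def)
  have "(\<lambda>k. 1 / (real k + 2)) \<longlonglongrightarrow> 0"
    using LIMSEQ_Suc[OF LIMSEQ_inverse_real_of_nat] by (simp add: inverse_eq_divide add.commute)
  then have lim: "r \<longlonglongrightarrow> 1"
    unfolding r_def using tendsto_diff[OF tendsto_const[of "1::real"]] by fastforce
  have in_range: "r k * cos x \<in> {-1..1}" for k x
  proof -
    have "\<bar>r k * cos x\<bar> \<le> 1 * 1"
      unfolding abs_mult using r[of k] by (intro mult_mono) auto
    then show ?thesis by (simp add: abs_le_iff)
  qed
  have conv: "(\<lambda>k. arccos (r k * cos x)) \<longlonglongrightarrow> arccos (1 * cos x)" for x
  proof (rule continuous_on_tendsto_compose[OF continuous_on_arccos'])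
    show "(\<lambda>k. r k * cos x) \<longlonglongrightarrow> 1 * cos x" by (intro tendsto_intros lim)
  qed (use in_range in auto)
  have "(\<lambda>k. arccos (r k * cos \<theta>) - arccos (r k * cos 0)) \<longlonglongrightarrow> arccos (1 * cos \<theta>) - arccos (1 * cos 0)"
    by (intro tendsto_diff conv)
  moreover have "1 - (2 * sin (\<theta> / 2))\<^sup>2 / 2 = cos \<theta>"
    using cos_double_sin[of "\<theta> / 2"] by (simp add: power_mult_distrib)
  ultimately show ?thesis
    using assms by (simp add: arc_def r_def arccos_cos)
qed

text \<open>For each \<open>n\<close> the weights are chosen to support \<phi> at the first
  \<open>n\<close> singular values of \<open>z\<close>; then r -> 1 with the weights fixed, and the
  supremum over \<open>n\<close> is \<open>N z\<close>.\<close>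

lemma (in symmetric_norm) curve_length_ge:
  fixes u v z :: "'h operator"
  assumes not_equiv: "\<not> equivalent_to_uniform_norm N"
    and u: "u \<in> unitary_group N" and zI: "z \<in> norm_ideal N"
    and z: "hermitian z" "norm z \<le> pi" and \<gamma>: "\<gamma> \<in> joining_curves N u (u * exp (\<i> *\<^sub>C z))"
  shows "N z \<le> curve_length N \<gamma>"
proof -
  have z_compact: "compact_operator z" using not_equiv zI by (rule norm_ideal_compact)
  then obtain e \<sigma> where sys: "singular_system z e \<sigma>" by (rule ex_singular_system)
  have \<sigma>: "decseq \<sigma>" "\<And>j. 0 \<le> \<sigma> j" using sys by (simp_all add: singular_system_def)
  have \<sigma>_pi: "\<sigma> j \<le> pi" for j
    using z(2) norm_app[of z "e j"] singular_system_norm[OF sys, of j] singular_system_unit[OF sys, of j] by simp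
  have uu: "adj u * u = 1" using u by (simp add: unitary_group_def unitary_def)
  have ends: "\<gamma> 0 = u" "adj u * \<gamma> 1 = exp (\<i> *\<^sub>C z)"
    using \<gamma> uu by (simp_all add: joining_curves_def mult.assoc[symmetric])
  have "\<exists>e' s. singular_system (adj u * \<gamma> t - 1) e' s" if "t \<in> {0..1}" for t
  proof -
    have "adj u * \<gamma> t \<in> unitary_group N"
      using u \<gamma> that by (intro unitary_group_mult unitary_group_adj) (auto simp: joining_curves_def)
    then have "compact_operator (adj u * \<gamma> t - 1)"
      using not_equiv by (intro norm_ideal_compact) (auto simp: unitary_group_def)
    then show ?thesis using ex_singular_system by blast
  qed
  then obtain e' s' where sys': "\<And>t. t \<in> {0..1} \<Longrightarrow> singular_system (adj u * \<gamma> t - 1) (e' t) (s' t)"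
    by metis
  \<comment> \<open>At time 1 an arbitrary singular system is replaced by the one inherited from
    \<open>z\<close>, so that the end value is explicit.\<close>
  define s where "s = s'(1 := \<lambda>j. 2 * sin (\<sigma> j / 2))"
  have s: "singular_system (adj u * \<gamma> t - 1) ((e'(1 := e)) t) (s t)" if "t \<in> {0..1}" for t
    using sys'[OF that] singular_system_exp[OF z sys] ends by (simp add: s_def)
  have s0: "s 0 j = 0" for j
    using singular_system_norm[OF s[of 0], of j] ends uu by (simp add: app.zero_left)
  have s1: "s 1 j = 2 * sin (\<sigma> j / 2)" for j by (simp add: s_def)
  have bound: "ennreal (\<phi> (\<lambda>j. if j < n then \<sigma> j else 0)) \<le> curve_length N \<gamma>" for n
  proof (cases "curve_length N \<gamma> = \<infinity>")
    case False
    then obtain L where L: "curve_length N \<gamma> = ennreal L" "0 \<le> L" by (cases "curve_length N \<gamma>") auto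
    obtain c where c: "dual_weights n c" "\<phi> (\<lambda>j. if j < n then \<sigma> j else 0) \<le> (\<Sum>j<n. c j * \<sigma> j)"
      using ex_dual_weights[OF \<sigma>, of n] by blast
    have "(\<Sum>j<n. c j * arc (1 - 1 / (real k + 2)) ((2 * sin (\<sigma> j / 2))\<^sup>2)) \<le> L" for k
    proof -
      have "ennreal ((\<Sum>j<n. c j * arc (1 - 1 / (real k + 2)) ((s 1 j)\<^sup>2))
          - (\<Sum>j<n. c j * arc (1 - 1 / (real k + 2)) ((s 0 j)\<^sup>2))) \<le> curve_length N \<gamma>"
        using \<gamma> u s _ _ c(1) by (rule curve_length_ge_functional) simp_all
      then show ?thesis using L by (simp add: s0 s1 arc_def)
    qed
    moreover have "(\<lambda>k. \<Sum>j<n. c j * arc (1 - 1 / (real k + 2)) ((2 * sin (\<sigma> j / 2))\<^sup>2))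
        \<longlonglongrightarrow> (\<Sum>j<n. c j * \<sigma> j)"
      using \<sigma>(2) \<sigma>_pi by (intro tendsto_sum tendsto_mult tendsto_const arc_limit)
    ultimately have "(\<Sum>j<n. c j * \<sigma> j) \<le> L" by (intro LIMSEQ_le_const2) auto
    then show ?thesis using c(2) L by (simp add: ennreal_leI)
  qed simp
  show ?thesis
    unfolding norm_compact[OF z_compact] singular_system_values[OF sys] using bound by (rule SUP_least)
qed

theorem theorem4p7:
  fixes N :: "'h::separable_hilbert_space operator \<Rightarrow> ennreal"
    and \<phi> :: "(nat \<Rightarrow> real) \<Rightarrow> real"
    and u v z :: "'h operator"
  assumes "symmetric_norm \<phi> N"
    and "\<not> equivalent_to_uniform_norm N"
    and "u \<in> unitary_group N" and "v \<in> unitary_group N"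
    and "z \<in> norm_ideal N" and "hermitian z" and "norm z \<le> pi"
    and "v = u * exp (\<i> *\<^sub>C z)"
  shows "(\<forall>\<gamma> \<in> joining_curves N u v.
            curve_length N (\<lambda>t. u * exp ((\<i> * complex_of_real t) *\<^sub>C z)) \<le> curve_length N \<gamma>)
         \<and> curve_dist N u v = N z"
proof -
  interpret symmetric_norm \<phi> N by fact
  note u = \<open>u \<in> unitary_group N\<close>
  define A where "A = \<i> *\<^sub>C z"
  have NA: "N A = N z" by (simp add: A_def norm_scale)
  have A: "adj A = - A" "N A < \<infinity>"
    using assms(5) skew_of_hermitian[OF assms(6)] unfolding NA norm_ideal_def by (simp_all only: A_def mem_Collect_eq)
  have "(\<lambda>t. u * exp ((\<i> * complex_of_real t) *\<^sub>C z)) = (\<lambda>t. u * exp (t *\<^sub>R A))"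
    by (simp add: A_def scaleC_of_real[symmetric] scaleC_scaleC mult.commute)
  then have length: "curve_length N (\<lambda>t. u * exp ((\<i> * complex_of_real t) *\<^sub>C z)) = N z"
    using exp_curve_length[OF u A] by (simp add: NA)
  have ge: "N z \<le> curve_length N \<gamma>" if "\<gamma> \<in> joining_curves N u v" for \<gamma>
    using assms(2,3,5,6,7) that unfolding assms(8) by (rule curve_length_ge)
  have "curve_dist N u v \<le> N z"
  proof (cases "z = 0")
    case False
    then have "A \<noteq> 0" using NA norm_eq_0 by metis
    then have "(\<lambda>t. u * exp (t *\<^sub>R A)) \<in> joining_curves N u v"
      unfolding assms(8) A_def[symmetric] by (rule exp_curve_joining[OF u A])
    then show ?thesis
      unfolding curve_dist_def using exp_curve_length[OF u A] NA by (metis INF_lower)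
  next
    case True
    then have uv: "v = u" using assms(8) by (simp add: scaleC.zero_right complex_vector.scale_zero_right)
    \<comment> \<open>The exponential curve is now constant, hence not admissible. Distance 0 is
      reached as an infimum over loops generated by small multiples of the skew-adjoint rank-one
      operator \<open>B\<close>.\<close>
    obtain x :: 'h where "x \<noteq> 0" using exists_nonzero by blast
    define a where "a = (1 / norm x) *\<^sub>R x"
    have a: "norm a = 1" using \<open>x \<noteq> 0\<close> by (simp add: a_def)
    define B where "B = \<i> *\<^sub>C rank_one a a"
    have "adj (rank_one a a) = rank_one a a"
      by (rule adj_unique) (simp add: cinner_scaleC_left cinner_scaleC_right cinner_commute[of a] mult.commute)
    then have B: "adj B = - B" by (simp add: B_def skew_of_hermitian hermitian_def)
    define P where "P = enn2real (N B)"
    have "N B = N (rank_one a a)" by (simp add: B_def norm_scale)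
    then have P: "N B = ennreal P" "0 \<le> P" using N_rank_one_finite[OF a] by (simp_all add: P_def)
    have "B \<cdot> a = \<i> *\<^sub>C a" using a by (simp add: B_def cinner_norm scaleC_one)
    then have "norm (B \<cdot> a) = 1" using a by (simp add: norm_scaleC)
    then have "B \<noteq> 0" by (auto simp: app.zero_left)
    have "curve_dist N u v \<le> ennreal \<epsilon>" if "0 < \<epsilon>" for \<epsilon>
    proof -
      \<comment> \<open>Scaled so that the loop has length at most \<eta> P \<le> \<epsilon>; the
        summand 1 keeps the denominator positive.\<close>
      define \<eta> where "\<eta> = \<epsilon> / (P + 1)"
      have \<eta>: "0 < \<eta>" "\<eta> * P \<le> \<epsilon>" using that P(2) by (simp_all add: \<eta>_def field_simps)
      have N\<eta>: "N (\<eta> *\<^sub>R B) = ennreal (\<eta> * P)" using \<eta> P by (simp add: N_scaleR ennreal_mult)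
      obtain \<gamma> where \<gamma>: "\<gamma> \<in> joining_curves N u u" "curve_length N \<gamma> \<le> N (\<eta> *\<^sub>R B)"
      proof (rule ex_short_loop[OF u, of "\<eta> *\<^sub>R B"])
        show "adj (\<eta> *\<^sub>R B) = - (\<eta> *\<^sub>R B)" by (simp add: B)
      qed (use \<eta> \<open>B \<noteq> 0\<close> N\<eta> in auto)
      have "curve_dist N u v \<le> curve_length N \<gamma>"
        unfolding curve_dist_def uv using \<gamma>(1) by (rule INF_lower)
      also have "\<dots> \<le> ennreal \<epsilon>" using \<gamma>(2) \<eta>(2) unfolding N\<eta> by (meson ennreal_leI order_trans)
      finally show ?thesis .
    qed
    then have "curve_dist N u v \<le> 0 + ennreal \<epsilon>" if "0 < \<epsilon>" for \<epsilon> using that by simp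
    then have "curve_dist N u v \<le> 0" by (rule ennreal_le_epsilon)
    then show ?thesis by simp
  qed
  moreover have "N z \<le> curve_dist N u v"
    unfolding curve_dist_def using ge by (rule INF_greatest)
  ultimately show ?thesis using ge length by (simp add: antisym)
qed



end
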